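(* Let $d\ge 1$, $0<s<1$, $a=1-2s$, and let $u\in\mathscr S(\mathbb R^{d+1})$. Let $U$ be the solution of the extension problem $$\partial_tU-i\bigl(\Delta_xU+\mathscr B^{(a)}_zU\bigr)=0\quad\text{for } x\in\mathbb R^d,\ z>0,\ t\in\mathbb R,\qquad U(x,0,t)=u(x,t),$$ selected by the decay / limiting-absorption prescription described in the context. Then, for every $(\xi,\tau)$ with $p(\xi,\tau)\neq0$ and every $z>0$, $$\widehat U(\xi,z,\tau)=\frac{2^{1-s}}{\Gamma(s)}\Bigl(z\,\theta(\xi,\tau)|p(\xi,\tau)|^{1/2}\Bigr)^{s}K_s\Bigl(z\,\theta(\xi,\tau)|p(\xi,\tau)|^{1/2}\Bigr)\,\widehat u(\xi,\tau),$$ the Dirichlet datum is attained in the sense that $\lim_{z\to0^+}\widehat U(\xi,z,\tau)=\widehat u(\xi,\tau)$, and the weighted Neumann derivative recovers $\mathcal L^s u$: for every $(\xi,\tau)$ with $p(\xi,\tau)\ne0$, $$-\frac{2^{2s-1}\Gamma(s)e^{i\frac{\pi s}{2}}}{\Gamma(1-s)}\lim_{z\to0^+}z^{a}\,\partial_z\widehat U(\xi,z,\tau)=(i\,p(\xi,\tau))^s\,\widehat u(\xi,\tau)=\widehat{\mathcal L^su}(\xi,\tau).$$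
   Context: Fourier transform on $\mathbb R^{d+1}=\mathbb R^d_x\times\mathbb R_t$: $\widehat u(\xi,\tau)=\int_{\mathbb R^{d+1}}e^{-2\pi i(\tau t+\langle\xi,x\rangle)}u(x,t)\,dx\,dt$. For a function $U(x,z,t)$, $\widehat U(\xi,z,\tau)$ is the partial Fourier transform in $(x,t)$ with $z>0$ fixed. $\mathscr B_z^{(a)}=\partial_{zz}+\frac az\partial_z$ is the Bessel operator on $z>0$. $p(\xi,\tau)=2\pi\tau+4\pi^2|\xi|^2$. The phase is $\theta(\xi,\tau)=1$ if $p(\xi,\tau)>0$ and $\theta(\xi,\tau)=-i$ if $p(\xi,\tau)<0$. Complex powers and square roots use the principal branch ($-\pi<\arg<\pi$). $K_s$ is the modified Bessel function of the third kind (Macdonald function), $K_s(w)=\frac\pi2\frac{I_{-s}(w)-I_s(w)}{\sin\pi s}$. The fully fractional Schrödinger operator $\mathcal L^s=(\partial_t-i\Delta_x)^s$ is defined on $u\in\mathscr S(\mathbb R^{d+1})$ by $$\mathcal L^su(x,t)=-\frac{s}{\Gamma(1-s)}\int_0^\infty\frac{P_\sigma u(x,t)-u(x,t)}{\sigma^{1+s}}\,d\sigma,\qquad P_\sigma u(x,t)=\bigl(e^{i\sigma\Delta_x}u(\cdot,t-\sigma)\bigr)(x).$$ Selection of the solution: taking the Fourier transform in $(x,t)$ turns the extension problem into the ODE $\mathscr B_z^{(a)}\widehat U(\xi,z,\tau)=p(\xi,\tau)\widehat U(\xi,z,\tau)$, $\widehat U(\xi,0,\tau)=\widehat u(\xi,\tau)$,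 which has two linearly independent solutions. One writes $\widehat U=m_s(z;p)\widehat u$, where for $\operatorname{Re}p>0$, $m_s(z;p)$ is the solution normalized by $m_s(0^+;p)=1$ that decays as $z\to\infty$, namely $m_s(z;p)=\frac{2^{1-s}}{\Gamma(s)}(z\sqrt p)^sK_s(z\sqrt p)$ with $\operatorname{Re}\sqrt p>0$, and for $p<0$ it is the limiting-absorption boundary value from the lower half-plane, $m_s(z;p)=\lim_{\varepsilon\downarrow0}\frac{2^{1-s}}{\Gamma(s)}(z\sqrt{p-i\varepsilon})^sK_s(z\sqrt{p-i\varepsilon})$, the square root being chosen with positive real part before passing to the limit. *)

theory Defs
  imports "HOL-Analysis.Analysis"
begin

section \<open>Schwartz functions and the Fourier transform\<close>

text \<open>Iterated directional derivatives; for a list of basis vectors these are the partial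
  derivatives of arbitrary order.\<close>

primrec iter_deriv :: "'a::euclidean_space list \<Rightarrow> ('a \<Rightarrow> complex) \<Rightarrow> 'a \<Rightarrow> complex" where
  "iter_deriv [] f = f"
| "iter_deriv (b # bs) f = (\<lambda>x. frechet_derivative (iter_deriv bs f) (at x) b)"

definition schwartz :: "('a::euclidean_space \<Rightarrow> complex) \<Rightarrow> bool" where
  "schwartz f \<longleftrightarrow>
     (\<forall>bs \<in> lists Basis.
        (\<forall>x. iter_deriv bs f differentiable (at x)) \<and>
        (\<forall>k::nat. \<exists>C. \<forall>x. (1 + norm x) ^ k * norm (iter_deriv bs f x) \<le> C))"

text \<open>On \<open>(real ^ 'n) \<times> real\<close> the inner product of \<open>(\<xi>, \<tau>)\<close> and \<open>(x, t)\<close> is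
  \<open>\<xi> \<bullet> x + \<tau> * t\<close>, and \<open>lborel\<close> is \<open>(n+1)\<close>-dimensional Lebesgue measure.\<close>

definition fourier :: "('a::euclidean_space \<Rightarrow> complex) \<Rightarrow> 'a \<Rightarrow> complex" where
  "fourier f \<zeta> = (\<integral>y. exp (- (2 * of_real pi * \<i> * of_real (\<zeta> \<bullet> y))) * f y \<partial>lborel)"

text \<open>For Schwartz \<open>u\<close> the functions \<open>U(\<cdot>,z,\<cdot>)\<close> and \<open>\<L>\<^sup>s u\<close> are bounded, but for \<open>n \<ge> 2\<close> they
  are in general not Lebesgue integrable over space-time (they decay only like
  \<open>t powr (- 1 - s)\<close> times a free Schroedinger wave). Their Fourier transforms are therefore taken
  in the sense of tempered distributions: \<open>F\<close> represents the transform of \<open>f\<close> if it satisfies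
  the multiplication formula against all Schwartz functions.\<close>

definition fourier_pair :: "('a::euclidean_space \<Rightarrow> complex) \<Rightarrow> ('a \<Rightarrow> complex) \<Rightarrow> bool" where
  "fourier_pair f F \<longleftrightarrow>
     (\<forall>\<phi>. schwartz \<phi> \<longrightarrow>
        integrable lborel (\<lambda>y. f y * fourier \<phi> y) \<and>
        integrable lborel (\<lambda>y. F y * \<phi> y) \<and>
        (\<integral>y. f y * fourier \<phi> y \<partial>lborel) = (\<integral>y. F y * \<phi> y \<partial>lborel))"

text \<open>\<open>F\<close> is only determined almost everywhere. Its value at a point is meaningful where some
  representative is continuous: two representatives that are both continuous at \<open>\<zeta>\<close>
  agree at \<open>\<zeta>\<close>. For integrable \<open>f\<close> this value is \<open>fourier f \<zeta>\<close>.\<close>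

definition has_fourier_at :: "('a::euclidean_space \<Rightarrow> complex) \<Rightarrow> 'a \<Rightarrow> complex \<Rightarrow> bool" where
  "has_fourier_at f \<zeta> c \<longleftrightarrow> (\<exists>F. fourier_pair f F \<and> isCont F \<zeta> \<and> F \<zeta> = c)"


section \<open>The fully fractional Schroedinger operator\<close>

definition schroedinger_group ::
    "real \<Rightarrow> (real ^ 'n \<Rightarrow> complex) \<Rightarrow> real ^ 'n \<Rightarrow> complex" where
  "schroedinger_group \<sigma> f x =
     (\<integral>\<xi>. exp (2 * of_real pi * \<i> * of_real (\<xi> \<bullet> x))
           * exp (- (\<i> * of_real (\<sigma> * (4 * pi\<^sup>2 * (norm \<xi>)\<^sup>2)))) * fourier f \<xi> \<partial>lborel)"

definition evolutive_group ::
    "real \<Rightarrow> ((real ^ 'n) \<times> real \<Rightarrow> complex) \<Rightarrow> (real ^ 'n) \<times> real \<Rightarrow> complex" where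
  "evolutive_group \<sigma> u = (\<lambda>(x, t). schroedinger_group \<sigma> (\<lambda>y. u (y, t - \<sigma>)) x)"

definition frac_schroedinger ::
    "real \<Rightarrow> ((real ^ 'n) \<times> real \<Rightarrow> complex) \<Rightarrow> (real ^ 'n) \<times> real \<Rightarrow> complex" where
  "frac_schroedinger s u y =
     - of_real (s / Gamma (1 - s)) *
       (LINT \<sigma>:{0<..}|lborel. (evolutive_group \<sigma> u y - u y) / of_real (\<sigma> powr (1 + s)))"

definition symb :: "real ^ 'n \<Rightarrow> real \<Rightarrow> real" where
  "symb \<xi> \<tau> = 2 * pi * \<tau> + 4 * pi\<^sup>2 * (norm \<xi>)\<^sup>2"

text \<open>The value on \<open>symb \<xi> \<tau> = 0\<close> is irrelevant.\<close>

definition phase :: "real ^ 'n \<Rightarrow> real \<Rightarrow> complex" where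
  "phase \<xi> \<tau> = (if symb \<xi> \<tau> > 0 then 1 else - \<i>)"


section \<open>Modified Bessel functions\<close>

definition Bessel_I :: "real \<Rightarrow> complex \<Rightarrow> complex" where
  "Bessel_I \<nu> w =
     (w / 2) powr of_real \<nu> *
     (\<Sum>k. (w / 2) ^ (2 * k) * rGamma (of_nat k + of_real \<nu> + 1) / fact k)"

definition Bessel_K :: "real \<Rightarrow> complex \<Rightarrow> complex" where
  "Bessel_K \<nu> w = of_real (pi / 2) * (Bessel_I (- \<nu>) w - Bessel_I \<nu> w) / of_real (sin (pi * \<nu>))"


section \<open>The extension problem\<close>

definition bessel_op :: "real \<Rightarrow> (real \<Rightarrow> complex) \<Rightarrow> real \<Rightarrow> complex" where
  "bessel_op a f z =
     vector_derivative (\<lambda>y. vector_derivative f (at y)) (at z)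
     + of_real (a / z) * vector_derivative f (at z)"

definition twice_diff_pos :: "(real \<Rightarrow> complex) \<Rightarrow> bool" where
  "twice_diff_pos f \<longleftrightarrow>
     (\<forall>z>0. f differentiable (at z) \<and> (\<lambda>y. vector_derivative f (at y)) differentiable (at z))"

definition laplacian :: "(real ^ 'n \<Rightarrow> complex) \<Rightarrow> real ^ 'n \<Rightarrow> complex" where
  "laplacian f x = (\<Sum>b\<in>Basis. iter_deriv [b, b] f x)"

definition twice_diff :: "(real ^ 'n \<Rightarrow> complex) \<Rightarrow> bool" where
  "twice_diff f \<longleftrightarrow>
     (\<forall>x. f differentiable (at x) \<and> (\<forall>b\<in>Basis. iter_deriv [b] f differentiable (at x)))"

definition extension_solution ::
    "real \<Rightarrow> ((real ^ 'n) \<times> real \<Rightarrow> complex) \<Rightarrow> (real ^ 'n \<Rightarrow> real \<Rightarrow> real \<Rightarrow> complex) \<Rightarrow> bool" where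
  "extension_solution a u U \<longleftrightarrow>
     (\<forall>z t. z > 0 \<longrightarrow> twice_diff (\<lambda>x. U x z t)) \<and>
     (\<forall>x t. twice_diff_pos (\<lambda>z. U x z t)) \<and>
     (\<forall>x z t. z > 0 \<longrightarrow> (\<lambda>t'. U x z t') differentiable (at t)) \<and>
     (\<forall>x z t. z > 0 \<longrightarrow>
        vector_derivative (\<lambda>t'. U x z t') (at t)
        - \<i> * (laplacian (\<lambda>x'. U x' z t) x + bessel_op a (\<lambda>z'. U x z' t) z) = 0) \<and>
     (\<forall>x t. U x 0 t = u (x, t) \<and> continuous (at_right 0) (\<lambda>z. U x z t))"

text \<open>The selected solution \<open>m_s(\<cdot>;p)\<close> of the Bessel equation: the normalized decaying one for
  \<open>p > 0\<close>, the limiting-absorption boundary value from the lower half-plane for \<open>p < 0\<close>.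
  In the latter case \<open>csqrt (p - i \<epsilon>)\<close> is the root with positive real part. The argument \<open>z = 0\<close>
  and the value \<open>p = 0\<close> are left unconstrained.\<close>

definition selected_profile :: "real \<Rightarrow> real \<Rightarrow> (real \<Rightarrow> complex) \<Rightarrow> bool" where
  "selected_profile s p m \<longleftrightarrow>
     (p > 0 \<longrightarrow>
        twice_diff_pos m \<and>
        (\<forall>z>0. bessel_op (1 - 2 * s) m z = of_real p * m z) \<and>
        (m \<longlongrightarrow> 1) (at_right 0) \<and> (m \<longlongrightarrow> 0) at_top) \<and>
     (p < 0 \<longrightarrow>
        (\<forall>z>0. ((\<lambda>\<epsilon>::real.
            let w = of_real z * csqrt (of_real p - \<i> * of_real \<epsilon>)
            in of_real (2 powr (1 - s) / Gamma s) * w powr of_real s * Bessel_K s w)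
          \<longlongrightarrow> m z) (at_right 0)))"

end

theory Submission
  imports Defs "HOL-Probability.Sinc_Integral" "HOL-Probability.Characteristic_Functions"
begin

text \<open>
  The Fourier transform in \<open>(x, t)\<close> makes both sides multiplication operators with symbols depending on
  \<open>p = symb \<xi> \<tau>\<close> only. So the theorem is a statement on one ordinary differential equation and one on
  one oscillatory integral.

  The equation \<open>m'' + (1 - 2s)/z m' = p m\<close> has two explicit power series solutions, with exponents 0 and
  \<open>2s\<close> at \<open>z = 0\<close>. The weighted derivative exchanges them and replaces \<open>s\<close> by \<open>1 - s\<close>
  (\<open>has_field_derivative_frob_zero\<close>, \<open>has_field_derivative_frob_two\<close>). This symmetry gives the equation, the
  constancy of Wronskians and hence the general solution (\<open>bessel_ode_general_solution\<close>), and the Neumann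
  limit (\<open>macdonald_profile_boundary\<close>). For \<open>p > 0\<close> the decaying solution with value 1 at 0 is then found
  by comparing the growth of the two solutions, that is from \<open>bessel_series_ratio_tendsto\<close>. That limit is
  proved on the power series: weighted by its terms, \<open>k (k + s)\<close> has mean exactly \<open>x\<close>, and Jensen's inequality
  then bounds the ratio of the two series. For \<open>p < 0\<close> the limiting absorption value is the value at \<open>- \<i> z sqrt \<bar>p\<bar>\<close>
  because the profile is continuous off the negative axis.

  On the operator side, Fourier inversion shows that \<open>P\<^sub>\<sigma>\<close> multiplies by \<open>exp (- \<i> \<sigma> p)\<close>
  (\<open>evolutive_group_fourier\<close>), so \<open>\<L>\<^sup>s\<close> multiplies by
  \<open>- s / \<Gamma>(1 - s)\<close> times the integral of \<open>exp (- \<i> \<sigma> p) - 1\<close> against \<open>d\<sigma>\<close> over \<open>\<sigma>\<close> to the power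
  \<open>1 + s\<close>. This integral is homogeneous of degree \<open>s\<close> and holomorphic when \<open>\<i> p\<close> is replaced by \<open>w\<close> with
  \<open>Re w > 0\<close>, hence a multiple of \<open>w powr s\<close> (\<open>frac_integral_right_half_plane\<close>), and the boundary value is
  \<open>(\<i> p) powr s\<close>. The rapid decay of the transform of a Schwartz function (\<open>fourier_schwartz_decay\<close>)
  justifies all exchanges of integrals and makes the product with \<open>(\<i> p) powr s\<close> integrable and continuous,
  so that it is the distributional transform of \<open>\<L>\<^sup>s u\<close> with a well-defined value at every point.
\<close>

section \<open>Power series of the modified Bessel functions\<close>

text \<open>The common entire factor of the Bessel functions:
  \<open>I\<^sub>\<nu>(w) = (w/2)\<^sup>\<nu>\<close> times this series at \<open>w\<^sup>2/4\<close>. At the arguments of the theorem \<open>w\<^sup>2/4\<close> is the real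
  number \<open>p z\<^sup>2/4\<close> for either sign of \<open>p\<close>, so the series is kept polymorphic: real for estimates and
  derivatives in \<open>z\<close>, complex for continuity in \<open>w\<close>.\<close>

definition bessel_series :: "real \<Rightarrow> 'a::{real_normed_field,banach} \<Rightarrow> 'a" where
  "bessel_series \<nu> x = (\<Sum>k. of_real (rGamma (of_nat k + \<nu> + 1) / fact k) * x ^ k)"

lemma summable_bessel_series:
  fixes x :: "'a::{real_normed_field,banach}"
  shows "summable (\<lambda>k. of_real (rGamma (of_nat k + \<nu> + 1) / fact k) * x ^ k)"
proof (rule summable_ratio_test)
  \<comment> \<open>From this index on \<open>y = n + \<nu> + 1\<close> is at least \<open>2 \<bar>x\<bar>\<close>, so each term is at most half of the one before.\<close>
  define N where "N = nat \<lceil>2 * norm x + \<bar>\<nu>\<bar> + 1\<rceil>"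
  fix n assume n: "n \<ge> N"
  then have n': "real n \<ge> 2 * norm x + \<bar>\<nu>\<bar> + 1" unfolding N_def by linarith
  define y where "y = real n + \<nu> + 1"
  have y: "y > 0" "y \<ge> 2 * norm x" "y \<ge> 1" using n' norm_ge_zero[of x] unfolding y_def by linarith+
  have "rGamma (of_nat (Suc n) + \<nu> + 1) = rGamma y / y"
    using rGamma_plus1[of y] y by (simp add: y_def field_simps)
  then have "norm (of_real (rGamma (of_nat (Suc n) + \<nu> + 1) / fact (Suc n)) * x ^ Suc n)
     = (norm x / (y * real (Suc n))) * norm (of_real (rGamma (of_nat n + \<nu> + 1) / fact n) * x ^ n)"
    using y by (simp only: norm_mult norm_power norm_of_real y_def[symmetric] abs_mult abs_divide)
      (simp add: field_simps)
  also have "\<dots> \<le> (1/2) * norm (of_real (rGamma (of_nat n + \<nu> + 1) / fact n) * x ^ n)"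
  proof (rule mult_right_mono)
    have "norm x * 2 \<le> y * 1" using y by simp
    also have "\<dots> \<le> y * real (Suc n)" using y by (intro mult_left_mono) auto
    finally have "norm x * 2 \<le> y * real (Suc n)" .
    moreover have "y * real (Suc n) > 0" using y by simp
    ultimately show "norm x / (y * real (Suc n)) \<le> 1/2" by (simp only: divide_le_eq if_True)
  qed auto
  finally show "norm (of_real (rGamma (of_nat (Suc n) + \<nu> + 1) / fact (Suc n)) * x ^ Suc n)
     \<le> (1/2) * norm (of_real (rGamma (of_nat n + \<nu> + 1) / fact n) * x ^ n)" .
qed auto

lemma bessel_series_sums:
  "(\<lambda>k. of_real (rGamma (of_nat k + \<nu> + 1) / fact k) * x ^ k) sums bessel_series \<nu> x"
  unfolding bessel_series_def using summable_bessel_series by (rule summable_sums)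

lemma bessel_series_of_real:
  "bessel_series \<nu> (of_real x) = (of_real (bessel_series \<nu> x) :: 'a::{real_normed_field,banach})"
proof (rule sums_unique2[OF bessel_series_sums])
  show "(\<lambda>k. of_real (rGamma (of_nat k + \<nu> + 1) / fact k) * of_real x ^ k) sums (of_real (bessel_series \<nu> x) :: 'a)"
    using sums_of_real[OF bessel_series_sums[of \<nu> x]]
    by (simp only: of_real_power of_real_mult id_apply of_real_eq_id)
qed

text \<open>Differentiating shifts the index up because \<open>k / k! = 1 / (k-1)!\<close>; the recurrence below shifts it
  down because \<open>(k + \<nu>) / \<Gamma>(k + \<nu> + 1) = 1 / \<Gamma>(k + \<nu>)\<close>. Together they give the derivative of
  \<open>x\<^sup>\<nu>\<close> times the series as \<open>x\<close> to the power \<open>\<nu> - 1\<close> times the series of index \<open>\<nu> - 1\<close>.\<close>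

lemma has_field_derivative_bessel_series:
  "(bessel_series \<nu> has_field_derivative bessel_series (\<nu> + 1) x) (at x)"
proof -
  have d: "diffs (\<lambda>k. of_real (rGamma (of_nat k + \<nu> + 1) / fact k)) =
        (\<lambda>k. of_real (rGamma (of_nat k + (\<nu> + 1) + 1) / fact k) :: 'a)"
  proof
    fix k
    have "real (Suc k) * (rGamma (real (Suc k) + \<nu> + 1) / fact (Suc k)) =
        rGamma (of_nat k + (\<nu> + 1) + 1) / fact k"
      by (simp add: add_ac nonzero_mult_divide_mult_cancel_left[of "1 + real k"])
    then have "of_real (real (Suc k)) * of_real (rGamma (real (Suc k) + \<nu> + 1) / fact (Suc k)) =
        (of_real (rGamma (of_nat k + (\<nu> + 1) + 1) / fact k) :: 'a)"
      by (simp only: of_real_mult[symmetric])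
    then show "diffs (\<lambda>k. of_real (rGamma (of_nat k + \<nu> + 1) / fact k)) k = (of_real (rGamma (of_nat k + (\<nu> + 1) + 1) / fact k) :: 'a)"
      by (simp only: diffs_def of_real_of_nat_eq)
  qed
  show ?thesis
    using termdiffs_strong_converges_everywhere[OF summable_bessel_series, of \<nu> x]
    unfolding d bessel_series_def[symmetric] by (simp add: bessel_series_def[abs_def])
qed

lemma tendsto_bessel_series [tendsto_intros]:
  "(f \<longlongrightarrow> l) F \<Longrightarrow> ((\<lambda>x. bessel_series \<nu> (f x)) \<longlongrightarrow> bessel_series \<nu> l) F"
  using has_field_derivative_bessel_series[of \<nu> l] DERIV_isCont isCont_tendsto_compose by blast

lemma bessel_series_0: "bessel_series \<nu> 0 = of_real (rGamma (\<nu> + 1))"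
proof -
  have "(\<lambda>k. of_real (rGamma (of_nat k + \<nu> + 1) / fact k) * (0::'a) ^ k) sums of_real (rGamma (\<nu> + 1))"
    using powser_sums_zero[of "\<lambda>k. of_real (rGamma (of_nat k + \<nu> + 1) / fact k) :: 'a"] by simp
  then show ?thesis using bessel_series_sums sums_unique2 by blast
qed

lemma bessel_series_recurrence:
  "bessel_series (\<nu> - 1) x = of_real \<nu> * bessel_series \<nu> x + x * bessel_series (\<nu> + 1) x"
proof -
  let ?c = "\<lambda>\<nu> k. of_real (rGamma (of_nat k + \<nu> + 1) / fact k) :: 'a"
  have "(\<lambda>k. x * (?c (\<nu> + 1) k * x ^ k)) sums (x * bessel_series (\<nu> + 1) x)"
    by (intro sums_mult bessel_series_sums)
  also have "(\<lambda>k. x * (?c (\<nu> + 1) k * x ^ k)) =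
      (\<lambda>k. of_real (real (Suc k) * (rGamma (of_nat (Suc k) + \<nu> + 1) / fact (Suc k))) * x ^ Suc k)"
  proof
    fix k
    have "real (Suc k) * (rGamma (of_nat (Suc k) + \<nu> + 1) / fact (Suc k)) = rGamma (of_nat k + (\<nu> + 1) + 1) / fact k"
      by (simp add: add_ac nonzero_mult_divide_mult_cancel_left[of "1 + real k"])
    then show "x * (?c (\<nu> + 1) k * x ^ k) =
      of_real (real (Suc k) * (rGamma (of_nat (Suc k) + \<nu> + 1) / fact (Suc k))) * x ^ Suc k"
      by (simp only: power_Suc mult_ac)
  qed
  finally have "(\<lambda>k. of_real (real k * (rGamma (of_nat k + \<nu> + 1) / fact k)) * x ^ k)
        sums (x * bessel_series (\<nu> + 1) x)"
    by (subst (asm) sums_Suc_iff) simp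
  from sums_add[OF sums_mult[OF bessel_series_sums, of "of_real \<nu>" \<nu> x] this]
  have "(\<lambda>k. of_real \<nu> * (?c \<nu> k * x ^ k) + of_real (real k * (rGamma (of_nat k + \<nu> + 1) / fact k)) * x ^ k)
     sums (of_real \<nu> * bessel_series \<nu> x + x * bessel_series (\<nu> + 1) x)" .
  also have "(\<lambda>k. of_real \<nu> * (?c \<nu> k * x ^ k) + of_real (real k * (rGamma (of_nat k + \<nu> + 1) / fact k)) * x ^ k)
     = (\<lambda>k. ?c (\<nu> - 1) k * x ^ k)"
  proof
    fix k
    have "rGamma (of_nat k + (\<nu> - 1) + 1) / fact k =
       \<nu> * (rGamma (of_nat k + \<nu> + 1) / fact k) + real k * (rGamma (of_nat k + \<nu> + 1) / fact k)"
      using rGamma_plus1[of "real k + \<nu>"] by (simp add: field_simps)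
    then show "of_real \<nu> * (?c \<nu> k * x ^ k) + of_real (real k * (rGamma (of_nat k + \<nu> + 1) / fact k)) * x ^ k
       = ?c (\<nu> - 1) k * x ^ k"
      by (simp only: of_real_add of_real_mult distrib_right mult.assoc)
  qed
  finally show ?thesis using bessel_series_sums sums_unique2 by blast
qed

text \<open>All terms are nonnegative, so the sum is at least each of its first two terms.\<close>

lemma bessel_series_ge:
  fixes x :: real
  assumes "\<nu> > -1" "x \<ge> 0"
  shows "bessel_series \<nu> x \<ge> rGamma (\<nu> + 1)"
    and "bessel_series \<nu> x \<ge> rGamma (\<nu> + 2) * x"
proof -
  have pos: "rGamma (of_nat k + \<nu> + 1) / fact k * x ^ k \<ge> 0" for k
    using assms by (auto simp: rGamma_inverse_Gamma intro!: Gamma_real_nonneg)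
  have s: "(\<lambda>k. rGamma (of_nat k + \<nu> + 1) / fact k * x ^ k) sums bessel_series \<nu> x"
    using bessel_series_sums[of \<nu> x] by simp
  have "(\<Sum>k\<in>I. rGamma (of_nat k + \<nu> + 1) / fact k * x ^ k) \<le> bessel_series \<nu> x" if "finite I" for I
    unfolding sums_unique[OF s] using pos s that by (intro sum_le_suminf) (auto simp: sums_iff)
  from this[of "{0}"] this[of "{1}"]
  show "bessel_series \<nu> x \<ge> rGamma (\<nu> + 1)" "bessel_series \<nu> x \<ge> rGamma (\<nu> + 2) * x"
    by (auto simp: add_ac)
qed

text \<open>Log-convexity of \<open>\<Gamma>\<close> on the segment from \<open>y\<close> to \<open>y + 1\<close>.\<close>

lemma Gamma_add_le:
  fixes y s :: real
  assumes "y > 0" "0 \<le> s" "s \<le> 1"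
  shows "Gamma (y + s) \<le> y powr s * Gamma y"
proof -
  have "(ln \<circ> Gamma) ((1 - s) *\<^sub>R y + s *\<^sub>R (y + 1)) \<le> (1 - s) * (ln \<circ> Gamma) y + s * (ln \<circ> Gamma) (y + 1)"
    using assms by (intro convex_onD[OF log_convex_Gamma_real]) auto
  moreover have "(1 - s) *\<^sub>R y + s *\<^sub>R (y + 1) = y + s" by (simp add: algebra_simps)
  moreover have "Gamma (y + 1) = y * Gamma y" using assms Gamma_plus1[of y] by (metis nonpos_Ints_nonpos not_le)
  ultimately have "ln (Gamma (y + s)) \<le> (1 - s) * ln (Gamma y) + s * ln (y * Gamma y)" by simp
  also have "\<dots> = ln (y powr s * Gamma y)"
    using assms by (simp add: ln_mult ln_powr Gamma_real_pos algebra_simps)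
  finally show ?thesis using assms by (subst (asm) ln_le_cancel_iff) (auto intro!: Gamma_real_pos)
qed

text \<open>Two applications of the previous bound, passing from \<open>k + 1 - s\<close> to \<open>k + 1\<close> and from there to
  \<open>k + 1 + s\<close>. It compares the coefficients of the series of index \<open>-s\<close> and \<open>s\<close>.\<close>

lemma rGamma_diff_le:
  fixes s :: real
  assumes s: "0 < s" "s < 1"
  shows "rGamma (real k + - s + 1) \<le> (real k + 1) powr (2 * s) * rGamma (real k + s + 1)"
proof -
  have 1: "Gamma (real k + 1 + s) \<le> (real k + 1) powr s * Gamma (real k + 1)"
    using s by (intro Gamma_add_le) auto
  have 2: "Gamma (real k + 1) \<le> (real k + 1 - s) powr s * Gamma (real k + 1 - s)"
    using Gamma_add_le[of "real k + 1 - s" s] s by simp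
  have 3: "(real k + 1 - s) powr s \<le> (real k + 1) powr s" using s by (intro powr_mono2) auto
  have g: "Gamma (real k + 1 - s) > 0" "Gamma (real k + 1 + s) > 0" using s by (auto intro!: Gamma_real_pos)
  have "Gamma (real k + 1 + s) \<le> (real k + 1) powr s * ((real k + 1) powr s * Gamma (real k + 1 - s))"
    using 1 2 3 g by (meson mult_left_mono mult_right_mono order_trans powr_ge_zero less_imp_le)
  also have "\<dots> = (real k + 1) powr (2 * s) * Gamma (real k + 1 - s)"
    by (simp add: powr_add[symmetric] mult.assoc[symmetric])
  finally show ?thesis using g by (simp add: rGamma_inverse_Gamma field_simps)
qed

lemma young_powr:
  fixes x y s :: real
  assumes "x > 0" "y > 0" "0 < s" "s < 1"
  shows "y powr s \<le> x powr s * (s * (y / x) + (1 - s))"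
proof -
  have "(y / x) powr s * 1 powr (1 - s) \<le> s * (y / x) + (1 - s) * 1"
    using assms by (intro Youngs_inequality_0) auto
  then have "x powr s * (y / x) powr s \<le> x powr s * (s * (y / x) + (1 - s))"
    by (intro mult_left_mono) auto
  moreover have "x powr s * (y / x) powr s = y powr s" using assms by (simp add: powr_divide)
  ultimately show ?thesis by simp
qed

text \<open>If the terms of the series are read as weights on \<open>k\<close>, the mean of \<open>k (k + \<nu>)\<close> is exactly \<open>x\<close>. So
  the weights sit near \<open>k\<^sup>2 = x\<close>, which is what makes the ratio of two series computable.\<close>

lemma bessel_series_second_moment:
  fixes x :: real
  shows "(\<lambda>k. real k * (real k + \<nu>) * (rGamma (of_nat k + \<nu> + 1) / fact k * x ^ k)) sums (x * bessel_series \<nu> x)"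
proof -
  have "(\<lambda>k. x * (rGamma (of_nat k + \<nu> + 1) / fact k * x ^ k)) sums (x * bessel_series \<nu> x)"
    using bessel_series_sums[of \<nu> x] by (intro sums_mult) simp
  also have "(\<lambda>k. x * (rGamma (of_nat k + \<nu> + 1) / fact k * x ^ k)) =
     (\<lambda>k. real (Suc k) * (real (Suc k) + \<nu>) * (rGamma (of_nat (Suc k) + \<nu> + 1) / fact (Suc k) * x ^ Suc k))"
  proof
    fix k
    have "(real (Suc k) + \<nu>) * rGamma (of_nat (Suc k) + \<nu> + 1) = rGamma (of_nat k + \<nu> + 1)"
      using rGamma_plus1[of "real k + \<nu> + 1"] by (simp add: add_ac)
    moreover have "real (Suc k) * (real (Suc k) + \<nu>) * (rGamma (of_nat (Suc k) + \<nu> + 1) / fact (Suc k) * x ^ Suc k) =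
      (real (Suc k) / fact (Suc k)) * ((real (Suc k) + \<nu>) * rGamma (of_nat (Suc k) + \<nu> + 1)) * (x * x ^ k)"
      by simp
    moreover have "real (Suc k) / fact (Suc k) = 1 / fact k" by simp
    ultimately show "x * (rGamma (of_nat k + \<nu> + 1) / fact k * x ^ k) = real (Suc k) * (real (Suc k) + \<nu>) * (rGamma (of_nat (Suc k) + \<nu> + 1) / fact (Suc k) * x ^ Suc k)"
      by (simp only:) simp
  qed
  finally show ?thesis by (subst (asm) sums_Suc_iff) simp
qed

text \<open>The coefficient ratio is at most \<open>((k + 1)\<^sup>2)\<^sup>s\<close>, a concave function of \<open>(k + 1)\<^sup>2\<close>. Its mean is bounded
  by Jensen's inequality (in the tangent-line form of Young's inequality at the point \<open>x\<close>) and the mean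
  of \<open>(k + 1)\<^sup>2\<close> is \<open>x (1 + o(1))\<close> by the second moment identity.\<close>

lemma bessel_series_upper:
  fixes s \<eta> :: real
  assumes s: "0 < s" "s < 1" and \<eta>: "\<eta> > 0"
  shows "\<forall>\<^sub>F x in at_top. bessel_series (- s) x \<le> (1 + 2 * \<eta>) * (x powr s * bessel_series s x)"
  using eventually_ge_at_top[of "(1 + 1 / \<eta>) / \<eta>"]
proof eventually_elim
  case (elim x)
  have x: "x > 0" using elim \<eta> by (smt (verit) divide_pos_pos)
  define b where "b k = rGamma (of_nat k + s + 1) / fact k * x ^ k" for k
  have b0: "b k \<ge> 0" for k
    using s x unfolding b_def by (auto simp: rGamma_inverse_Gamma intro!: Gamma_real_nonneg)
  have bs: "b sums bessel_series s x"
    using bessel_series_sums[of s x] unfolding b_def by (simp only: of_real_eq_id id_apply)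
  have S0: "bessel_series s x \<ge> 0" using sums_le[OF _ sums_zero bs] b0 by auto
  have le: "rGamma (of_nat k + - s + 1) / fact k * x ^ k \<le>
      x powr s * (s / x * (1 + \<eta>)) * (real k * (real k + s) * b k) + x powr s * (s / x * (1 + 1 / \<eta>) + (1 - s)) * b k" for k
  proof -
    have "rGamma (of_nat k + - s + 1) \<le> (real k + 1) powr (2 * s) * rGamma (real k + s + 1)"
      by (rule rGamma_diff_le) fact+
    then have "rGamma (of_nat k + - s + 1) / fact k * x ^ k \<le> (real k + 1) powr (2 * s) * b k"
      using x unfolding b_def by (simp add: field_simps)
    also have "(real k + 1) powr (2 * s) = ((real k + 1)\<^sup>2) powr s"
      by (simp add: powr_powr powr_numeral[symmetric] del: powr_numeral)
    also have "\<dots> * b k \<le> x powr s * (s * ((real k + 1)\<^sup>2 / x) + (1 - s)) * b k"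
      using x s b0 by (intro mult_right_mono young_powr) auto
    also have "\<dots> \<le> x powr s * (s * (((1 + \<eta>) * (real k * (real k + s)) + (1 + 1 / \<eta>)) / x) + (1 - s)) * b k"
    proof -
      \<comment> \<open>The linear term \<open>2 k\<close> is absorbed into \<open>\<eta> k\<^sup>2\<close> at the cost of a constant.\<close>
      have "0 \<le> (sqrt \<eta> * real k - 1 / sqrt \<eta>)\<^sup>2" by simp
      also have "\<dots> = \<eta> * (real k)\<^sup>2 - 2 * real k + 1 / \<eta>" using \<eta>
        by (simp add: power2_diff power_mult_distrib power_divide)
      finally have "(real k + 1)\<^sup>2 \<le> (1 + \<eta>) * (real k * real k) + (1 + 1 / \<eta>)"
        by (simp add: power2_eq_square algebra_simps)
      also have "\<dots> \<le> (1 + \<eta>) * (real k * (real k + s)) + (1 + 1 / \<eta>)"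
        using s \<eta> by (intro add_right_mono mult_left_mono) auto
      finally show ?thesis using x s b0[of k]
        by (intro mult_right_mono mult_left_mono add_right_mono divide_right_mono) auto
    qed
    also have "\<dots> = x powr s * (s / x * (1 + \<eta>)) * (real k * (real k + s) * b k) + x powr s * (s / x * (1 + 1 / \<eta>) + (1 - s)) * b k"
      by (simp add: algebra_simps add_divide_distrib)
    finally show ?thesis .
  qed
  have "bessel_series (- s) x \<le> x powr s * (s / x * (1 + \<eta>)) * (x * bessel_series s x)
        + x powr s * (s / x * (1 + 1 / \<eta>) + (1 - s)) * bessel_series s x"
  proof (rule sums_le[OF le])
    show "(\<lambda>k. rGamma (of_nat k + - s + 1) / fact k * x ^ k) sums bessel_series (- s) x"
      using bessel_series_sums[of "-s" x] by (simp only: of_real_eq_id id_apply)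
    have "(\<lambda>k. real k * (real k + s) * b k) sums (x * bessel_series s x)"
      unfolding b_def by (rule bessel_series_second_moment)
    from sums_add[OF sums_mult[OF this] sums_mult[OF bs]]
    show "(\<lambda>k. x powr s * (s / x * (1 + \<eta>)) * (real k * (real k + s) * b k)
            + x powr s * (s / x * (1 + 1 / \<eta>) + (1 - s)) * b k) sums
        (x powr s * (s / x * (1 + \<eta>)) * (x * bessel_series s x)
        + x powr s * (s / x * (1 + 1 / \<eta>) + (1 - s)) * bessel_series s x)" .
  qed
  also have "\<dots> = (1 + s * \<eta> + s * ((1 + 1 / \<eta>) / x)) * (x powr s * bessel_series s x)"
    using x by (simp add: field_simps)
  also have "\<dots> \<le> (1 + 2 * \<eta>) * (x powr s * bessel_series s x)"
  proof (rule mult_right_mono)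
    have "(1 + 1 / \<eta>) / x \<le> \<eta>" using elim x \<eta> by (simp add: field_simps)
    then have "s * ((1 + 1 / \<eta>) / x) \<le> 1 * \<eta>" using s x \<eta> by (intro mult_mono) auto
    moreover have "s * \<eta> \<le> 1 * \<eta>" using s \<eta> by (intro mult_right_mono) auto
    ultimately show "1 + s * \<eta> + s * ((1 + 1 / \<eta>) / x) \<le> 1 + 2 * \<eta>" by simp
  qed (use S0 in auto)
  finally show ?case .
qed

text \<open>The upper bound with \<open>1 - s\<close> in place of \<open>s\<close> compares the derivatives of the two functions the other
  way round, since these derivatives are the series of index \<open>s - 1\<close> and \<open>1 - s\<close>. Integrating loses
  only a constant, and the series is unbounded.\<close>

lemma bessel_series_lower:
  fixes s \<eta> :: real
  assumes s: "0 < s" "s < 1" and \<eta>: "\<eta> > 0"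
  shows "\<forall>\<^sub>F x in at_top. x powr s * bessel_series s x \<le> (1 + 2 * \<eta>) * bessel_series (- s) x"
proof -
  have "\<forall>\<^sub>F x::real in at_top. x > 0 \<and> bessel_series (- (1 - s)) x \<le> (1 + 2 * (\<eta> / 2)) * (x powr (1 - s) * bessel_series (1 - s) x)"
    using s \<eta> by (intro eventually_conj bessel_series_upper eventually_gt_at_top) auto
  then obtain X where X: "\<And>x. x \<ge> X \<Longrightarrow> x > 0"
    "\<And>x. x \<ge> X \<Longrightarrow> bessel_series (s - 1) x \<le> (1 + \<eta>) * (x powr (1 - s) * bessel_series (1 - s) x)"
    unfolding eventually_at_top_linorder by (auto simp: algebra_simps)
  define D where "D x = x powr s * bessel_series s x - (1 + \<eta>) * bessel_series (- s) x" for x :: real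
  have D: "D x \<le> D X" if "x \<ge> X" for x
  proof (rule DERIV_nonpos_imp_nonincreasing[OF that])
    fix y assume y: "X \<le> y" "y \<le> x"
    have y0: "y > 0" using X(1) y by auto
    have "(D has_field_derivative (s * y powr (s - 1) * bessel_series s y + y powr s * bessel_series (s + 1) y
        - (1 + \<eta>) * bessel_series (1 - s) y)) (at y)"
      unfolding D_def using y0
      by (auto intro!: derivative_eq_intros has_field_derivative_bessel_series[THEN DERIV_cong])
    also have "s * y powr (s - 1) * bessel_series s y + y powr s * bessel_series (s + 1) y = y powr (s - 1) * bessel_series (s - 1) y"
      unfolding bessel_series_recurrence[of s y] using y0 by (simp add: algebra_simps powr_diff)
    finally have "(D has_field_derivative (y powr (s - 1) * bessel_series (s - 1) y - (1 + \<eta>) * bessel_series (1 - s) y)) (at y)" .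
    moreover have "y powr (s - 1) * bessel_series (s - 1) y \<le> y powr (s - 1) * ((1 + \<eta>) * (y powr (1 - s) * bessel_series (1 - s) y))"
      using X(2)[OF y(1)] by (intro mult_left_mono) auto
    moreover have "y powr (s - 1) * ((1 + \<eta>) * (y powr (1 - s) * bessel_series (1 - s) y)) = (1 + \<eta>) * bessel_series (1 - s) y"
    proof -
      have "y powr (s - 1) * y powr (1 - s) = 1" using y0 by (simp add: powr_add[symmetric])
      then show ?thesis
        by (metis mult.assoc mult.left_commute mult_1)
    qed
    ultimately show "\<exists>d. (D has_real_derivative d) (at y) \<and> d \<le> 0"
      by (intro exI[of _ "y powr (s - 1) * bessel_series (s - 1) y - (1 + \<eta>) * bessel_series (1 - s) y"]) simp
  qed
  have r: "rGamma (2 - s) > 0" using s by (simp add: rGamma_inverse_Gamma Gamma_real_pos)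
  show ?thesis
    using eventually_ge_at_top[of X] eventually_ge_at_top[of "\<bar>D X\<bar> / (\<eta> * rGamma (2 - s))"]
  proof eventually_elim
    case (elim x)
    have "\<bar>D X\<bar> \<le> \<eta> * (rGamma (2 - s) * x)" using elim(2) \<eta> r by (simp add: field_simps)
    also have "\<dots> \<le> \<eta> * bessel_series (- s) x"
      using bessel_series_ge(2)[of "-s" x] s \<eta> X(1)[OF elim(1)] by (intro mult_left_mono) auto
    finally have "\<bar>D X\<bar> \<le> \<eta> * bessel_series (- s) x" .
    with D[OF elim(1)] show ?case unfolding D_def[of x] by (simp add: algebra_simps)
  qed
qed

text \<open>In terms of \<open>x = w\<^sup>2/4\<close> this says that the quotient of the Bessel functions \<open>I\<close> of orders \<open>s\<close> and
  \<open>-s\<close> tends to 1 at infinity. It is what determines the decaying solution: the two growing solutions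
  must cancel with opposite coefficients, as they do in \<open>K\<^sub>s\<close>.\<close>

lemma bessel_series_ratio_tendsto:
  fixes s :: real
  assumes s: "0 < s" "s < 1"
  shows "((\<lambda>x. x powr s * bessel_series s x / bessel_series (- s) x) \<longlongrightarrow> 1) at_top"
proof (rule tendstoI)
  fix e :: real assume e: "e > 0"
  define \<eta> where "\<eta> = min (e / 4) 1"
  have \<eta>: "\<eta> > 0" "2 * \<eta> < e" using e by (auto simp: \<eta>_def)
  have r: "rGamma (1 - s) > 0" using s by (simp add: rGamma_inverse_Gamma Gamma_real_pos)
  show "\<forall>\<^sub>F x in at_top. dist (x powr s * bessel_series s x / bessel_series (- s) x) 1 < e"
    using bessel_series_upper[OF s \<eta>(1)] bessel_series_lower[OF s \<eta>(1)] eventually_ge_at_top[of 0]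
  proof eventually_elim
    case (elim x)
    define A B where "A = bessel_series (- s) x" and "B = x powr s * bessel_series s x"
    have A: "A > 0" unfolding A_def using bessel_series_ge(1)[of "-s" x] s r elim(3) by auto
    have 1: "B / A \<le> 1 + 2 * \<eta>" and 2: "1 / (1 + 2 * \<eta>) \<le> B / A"
      using elim A \<eta> unfolding A_def[symmetric] B_def[symmetric] by (auto simp: field_simps)
    have "1 - 2 * \<eta> \<le> 1 / (1 + 2 * \<eta>)" using \<eta> by (simp add: field_simps)
    with 1 2 \<eta> have "\<bar>B / A - 1\<bar> < e" unfolding abs_less_iff by linarith
    then show ?case by (simp only: dist_real_def A_def B_def)
  qed
qed

section \<open>Solutions of the Bessel equation\<close>

text \<open>The Frobenius solutions of \<open>m'' + (1 - 2s)/z m' = p m\<close> with exponents 0 and \<open>2s\<close> at \<open>z = 0\<close>.\<close>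

definition frob_zero :: "real \<Rightarrow> real \<Rightarrow> real \<Rightarrow> real" where
  "frob_zero s p z = bessel_series (- s) (p * z\<^sup>2 / 4)"

definition frob_two :: "real \<Rightarrow> real \<Rightarrow> real \<Rightarrow> real" where
  "frob_two s p z = z powr (2 * s) * bessel_series s (p * z\<^sup>2 / 4)"

text \<open>The weighted derivative \<open>z\<close> to the power \<open>1 - 2s\<close> times \<open>d/dz\<close> exchanges the two solutions and
  replaces \<open>s\<close> by \<open>1 - s\<close>. Applying this twice is the differential equation, and applying it once gives
  the Neumann data.\<close>

lemma has_field_derivative_frob_zero:
  assumes z: "z > 0"
  shows "(frob_zero s p has_field_derivative p / 2 * z powr (2 * s - 1) * frob_two (1 - s) p z) (at z)"
proof -
  have "((\<lambda>z. bessel_series (- s) (p * z\<^sup>2 / 4)) has_field_derivative bessel_series (- s + 1) (p * z\<^sup>2 / 4) * (p * z / 2)) (at z)"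
    by (rule DERIV_chain2[OF has_field_derivative_bessel_series]) (auto intro!: derivative_eq_intros)
  also have "bessel_series (- s + 1) (p * z\<^sup>2 / 4) * (p * z / 2) =
      p / 2 * (z powr (2 * s - 1) * z powr (2 * (1 - s))) * bessel_series (1 - s) (p * z\<^sup>2 / 4)"
    using z by (simp add: powr_add[symmetric] add.commute)
  finally show ?thesis by (simp add: frob_zero_def[abs_def] frob_two_def mult_ac)
qed

lemma has_field_derivative_frob_two:
  assumes z: "z > 0"
  shows "(frob_two s p has_field_derivative 2 * z powr (2 * s - 1) * frob_zero (1 - s) p z) (at z)"
proof -
  define x where "x = p * z\<^sup>2 / 4"
  have "((\<lambda>z. bessel_series s (p * z\<^sup>2 / 4)) has_field_derivative bessel_series (s + 1) x * (p * z / 2)) (at z)"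
    unfolding x_def by (rule DERIV_chain2[OF has_field_derivative_bessel_series]) (auto intro!: derivative_eq_intros)
  moreover have "((\<lambda>z. z powr (2 * s)) has_field_derivative 2 * s * z powr (2 * s - 1)) (at z)"
    using z by (rule has_real_derivative_powr)
  ultimately have "((\<lambda>z. z powr (2 * s) * bessel_series s (p * z\<^sup>2 / 4)) has_field_derivative
     2 * s * z powr (2 * s - 1) * bessel_series s x + bessel_series (s + 1) x * (p * z / 2) * z powr (2 * s)) (at z)"
    unfolding x_def by (intro DERIV_mult)
  also have "2 * s * z powr (2 * s - 1) * bessel_series s x + bessel_series (s + 1) x * (p * z / 2) * z powr (2 * s)
      = 2 * z powr (2 * s - 1) * (s * bessel_series s x + x * bessel_series (s + 1) x)"
  proof -
    have "z powr (2 * s) = z powr (2 * s - 1) * z" using z by (simp add: powr_diff)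
    then show ?thesis by (simp add: x_def power2_eq_square algebra_simps)
  qed
  also have "s * bessel_series s x + x * bessel_series (s + 1) x = bessel_series (- (1 - s)) x"
    using bessel_series_recurrence[of s x] by simp
  finally show ?thesis by (simp add: frob_zero_def frob_two_def[abs_def] x_def)
qed

lemma tendsto_frob_at_0:
  assumes s: "0 < s"
  shows "(frob_zero s p \<longlongrightarrow> rGamma (1 - s)) (at_right 0)"
    and "(frob_two s p \<longlongrightarrow> 0) (at_right 0)"
proof -
  have "((\<lambda>z. bessel_series (- s) (p * z\<^sup>2 / 4)) \<longlongrightarrow> bessel_series (- s) (p * 0\<^sup>2 / 4)) (at_right 0)"
    by (intro tendsto_intros) auto
  then show "(frob_zero s p \<longlongrightarrow> rGamma (1 - s)) (at_right 0)"
    by (simp add: frob_zero_def[abs_def] bessel_series_0)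
  have "((\<lambda>z. z powr (2 * s) * bessel_series s (p * z\<^sup>2 / 4)) \<longlongrightarrow> 0 powr (2 * s) * bessel_series s (p * 0\<^sup>2 / 4)) (at_right 0)"
    using s by (intro tendsto_intros) (auto simp: eventually_at_filter)
  then show "(frob_two s p \<longlongrightarrow> 0) (at_right 0)"
    by (simp add: frob_two_def[abs_def])
qed

lemma frob_zero_pos:
  assumes "0 < s" "s < 1" "p > 0"
  shows "frob_zero s p z \<ge> rGamma (1 - s)" "rGamma (1 - s) > 0"
proof -
  show "rGamma (1 - s) > 0" using assms by (simp add: rGamma_inverse_Gamma Gamma_real_pos)
  show "frob_zero s p z \<ge> rGamma (1 - s)"
    unfolding frob_zero_def using assms bessel_series_ge(1)[of "-s" "p * z\<^sup>2 / 4"] by simp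
qed

lemma frob_ratio_tendsto:
  assumes s: "0 < s" "s < 1" and p: "p > 0"
  shows "((\<lambda>z. frob_two s p z / frob_zero s p z) \<longlongrightarrow> (4 / p) powr s) at_top"
proof -
  define x where "x z = p * z\<^sup>2 / 4" for z :: real
  have "filterlim (\<lambda>z::real. z\<^sup>2) at_top at_top" by (intro filterlim_pow_at_top filterlim_ident) auto
  then have "filterlim (\<lambda>z. z\<^sup>2 * (p / 4)) at_top at_top"
    using p by (intro filterlim_at_top_mult_tendsto_pos[OF tendsto_const]) auto
  then have "filterlim x at_top at_top" by (simp add: x_def[abs_def] mult_ac)
  from filterlim_compose[OF bessel_series_ratio_tendsto[OF s] this]
  have "((\<lambda>z. (4 / p) powr s * (x z powr s * bessel_series s (x z) / bessel_series (- s) (x z))) \<longlongrightarrow> (4 / p) powr s * 1) at_top"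
    by (intro tendsto_mult_left)
  moreover have "\<forall>\<^sub>F z in at_top. (4 / p) powr s * (x z powr s * bessel_series s (x z) / bessel_series (- s) (x z))
      = frob_two s p z / frob_zero s p z"
    using eventually_gt_at_top[of 0]
  proof eventually_elim
    case (elim z)
    have "(4 / p) powr s * x z powr s = (z\<^sup>2) powr s"
      using p elim by (simp add: x_def powr_mult[symmetric])
    also have "\<dots> = z powr (2 * s)"
      using elim by (simp add: powr_powr powr_numeral[symmetric] del: powr_numeral)
    finally show ?case by (simp add: frob_two_def frob_zero_def x_def)
  qed
  ultimately show ?thesis by (simp add: filterlim_cong[OF refl refl])
qed

text \<open>The Bessel operator in divergence form.\<close>

lemma bessel_ode_flux:
  assumes m: "twice_diff_pos m" and ode: "\<And>z. z > 0 \<Longrightarrow> bessel_op a m z = of_real p * m z" and z: "z > 0"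
  shows "(m has_vector_derivative vector_derivative m (at z)) (at z)"
    and "((\<lambda>z. z powr a *\<^sub>R vector_derivative m (at z)) has_vector_derivative (p * z powr a) *\<^sub>R m z) (at z)"
proof -
  show "(m has_vector_derivative vector_derivative m (at z)) (at z)"
    using m z unfolding twice_diff_pos_def by (simp add: vector_derivative_works)
  have m2: "((\<lambda>y. vector_derivative m (at y)) has_vector_derivative vector_derivative (\<lambda>y. vector_derivative m (at y)) (at z)) (at z)"
    using m z unfolding twice_diff_pos_def by (simp add: vector_derivative_works)
  have "((\<lambda>z. z powr a *\<^sub>R vector_derivative m (at z)) has_vector_derivative
      z powr a *\<^sub>R vector_derivative (\<lambda>y. vector_derivative m (at y)) (at z) + (a * z powr (a - 1)) *\<^sub>R vector_derivative m (at z)) (at z)"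
    by (rule has_vector_derivative_scaleR[OF has_real_derivative_powr[OF z] m2])
  also have "z powr a *\<^sub>R vector_derivative (\<lambda>y. vector_derivative m (at y)) (at z) + (a * z powr (a - 1)) *\<^sub>R vector_derivative m (at z)
     = z powr a *\<^sub>R bessel_op a m z"
    using z by (simp add: bessel_op_def scaleR_conv_of_real algebra_simps powr_diff)
  also have "\<dots> = (p * z powr a) *\<^sub>R m z"
    using ode[OF z] by (simp add: scaleR_conv_of_real)
  finally show "((\<lambda>z. z powr a *\<^sub>R vector_derivative m (at z)) has_vector_derivative (p * z powr a) *\<^sub>R m z) (at z)" .
qed

lemma zero_vector_derivative_constant_pos:
  fixes f :: "real \<Rightarrow> 'a::real_normed_vector"
  assumes "\<And>z. z > 0 \<Longrightarrow> (f has_vector_derivative 0) (at z)"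
  shows "\<exists>c. \<forall>z>0. f z = c"
proof -
  have "\<exists>c. \<forall>z\<in>{0<..}. f z = c"
  proof (rule has_vector_derivative_zero_constant)
    show "convex {0::real<..}" by simp
    show "(f has_vector_derivative 0) (at z within {0<..})" if "z \<in> {0<..}" for z
      using that assms by (auto intro: has_vector_derivative_at_within)
  qed blast
  then show ?thesis by (metis greaterThan_iff)
qed

text \<open>The Wronskians of \<open>m\<close> with the two Frobenius solutions, and of these two with each other, are
  constant. The last one is nonzero, as its limit at 0 shows, and eliminating the derivative of \<open>m\<close>
  from the three identities expresses \<open>m\<close> by Cramer's rule.\<close>

lemma bessel_ode_general_solution:
  assumes s: "0 < s" "s < 1"
    and m: "twice_diff_pos m" and ode: "\<And>z. z > 0 \<Longrightarrow> bessel_op (1 - 2 * s) m z = of_real p * m z"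
  obtains \<alpha> \<beta> :: complex where "\<And>z. z > 0 \<Longrightarrow> m z = frob_zero s p z *\<^sub>R \<alpha> + frob_two s p z *\<^sub>R \<beta>"
proof -
  let ?f0 = "frob_zero s p" and ?f1 = "frob_two s p" and ?g0 = "frob_zero (1 - s) p" and ?g1 = "frob_two (1 - s) p"
  define n where "n z = z powr (1 - 2 * s) *\<^sub>R vector_derivative m (at z)" for z
  have d: "(?f0 has_field_derivative p / 2 * z powr (2 * s - 1) * ?g1 z) (at z)"
      "(?f1 has_field_derivative 2 * z powr (2 * s - 1) * ?g0 z) (at z)"
      "(?g0 has_field_derivative p / 2 * z powr (1 - 2 * s) * ?f1 z) (at z)"
      "(?g1 has_field_derivative 2 * z powr (1 - 2 * s) * ?f0 z) (at z)"
      "(m has_vector_derivative vector_derivative m (at z)) (at z)"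
      "(n has_vector_derivative (p * z powr (1 - 2 * s)) *\<^sub>R m z) (at z)"
      if "z > 0" for z
    using that has_field_derivative_frob_zero[of z] has_field_derivative_frob_two[of z]
      has_field_derivative_frob_zero[of z "1 - s" p] has_field_derivative_frob_two[of z "1 - s" p]
      bessel_ode_flux[OF m ode that]
    unfolding n_def by simp_all
  have n: "z powr (2 * s - 1) *\<^sub>R n z = vector_derivative m (at z)" if "z > 0" for z
    using that by (simp add: n_def powr_add[symmetric])
  \<comment> \<open>The weighted Wronskians; the weighted derivatives of the Frobenius solutions are \<open>p/2 ?g1\<close> and \<open>2 ?g0\<close>.\<close>
  define C0 where "C0 z = ?f0 z *\<^sub>R n z - (p / 2 * ?g1 z) *\<^sub>R m z" for z
  define C1 where "C1 z = ?f1 z *\<^sub>R n z - (2 * ?g0 z) *\<^sub>R m z" for z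
  define W where "W z = p / 2 * ?g1 z * ?f1 z - 2 * ?f0 z * ?g0 z" for z
  have "(C0 has_vector_derivative 0) (at z)" if "z > 0" for z
    unfolding C0_def
    by (rule has_vector_derivative_eq_rhs, (rule derivative_intros d that DERIV_cmult)+)
       (simp add: n[OF that, symmetric] algebra_simps scaleR_conv_of_real)
  then obtain c0 where c0: "\<And>z. z > 0 \<Longrightarrow> C0 z = c0"
    using zero_vector_derivative_constant_pos[of C0] by blast
  have "(C1 has_vector_derivative 0) (at z)" if "z > 0" for z
    unfolding C1_def
    by (rule has_vector_derivative_eq_rhs, (rule derivative_intros d that DERIV_cmult)+)
       (simp add: n[OF that, symmetric] algebra_simps scaleR_conv_of_real)
  then obtain c1 where c1: "\<And>z. z > 0 \<Longrightarrow> C1 z = c1"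
    using zero_vector_derivative_constant_pos[of C1] by blast
  have "(W has_vector_derivative 0) (at z)" if "z > 0" for z
    unfolding W_def has_real_derivative_iff_has_vector_derivative[symmetric]
    by (rule DERIV_cong[OF DERIV_diff[OF
          DERIV_mult[OF DERIV_cmult[OF d(4)[OF that]] d(2)[OF that]]
          DERIV_mult[OF DERIV_cmult[OF d(1)[OF that]] d(3)[OF that]]]])
       (simp add: algebra_simps)
  then obtain w where w: "\<And>z. z > 0 \<Longrightarrow> W z = w"
    using zero_vector_derivative_constant_pos[of W] by blast
  have "(W \<longlongrightarrow> p / 2 * 0 * 0 - 2 * rGamma (1 - s) * rGamma (1 - (1 - s))) (at_right 0)"
    unfolding W_def using s by (intro tendsto_intros tendsto_frob_at_0) auto
  moreover have "(W \<longlongrightarrow> w) (at_right 0)"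
    by (rule Lim_transform_eventually[OF tendsto_const]) (auto simp: eventually_at_filter w)
  ultimately have "w = - 2 * rGamma (1 - s) * rGamma s"
    by (auto dest: tendsto_unique[rotated])
  moreover have "Gamma s > 0" "Gamma (1 - s) > 0" using s by (auto intro: Gamma_real_pos)
  ultimately have w0: "w \<noteq> 0" by (simp add: rGamma_inverse_Gamma)
  show ?thesis
  proof (rule that[of "c1 /\<^sub>R w" "- c0 /\<^sub>R w"])
    fix z :: real assume z: "z > 0"
    have "w *\<^sub>R m z = ?f0 z *\<^sub>R c1 - ?f1 z *\<^sub>R c0"
      unfolding c0[OF z, symmetric] c1[OF z, symmetric] w[OF z, symmetric]
      by (simp add: C0_def C1_def W_def algebra_simps)
    then have "m z = (?f0 z *\<^sub>R c1 - ?f1 z *\<^sub>R c0) /\<^sub>R w"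
      using w0 by (metis scaleR_scaleR left_inverse scaleR_one)
    then show "m z = ?f0 z *\<^sub>R (c1 /\<^sub>R w) + ?f1 z *\<^sub>R (- c0 /\<^sub>R w)"
      by (simp add: algebra_simps)
  qed
qed

text \<open>The value 1 at 0 fixes the coefficient of the solution with exponent 0. Dividing by that solution,
  which is bounded below, and letting \<open>z\<close> tend to infinity fixes the other coefficient
  through the limit of the ratio of the two.\<close>

lemma decaying_profile:
  assumes s: "0 < s" "s < 1" and p: "p > 0" and m: "selected_profile s p m" and z: "z > 0"
  shows "m z = of_real (Gamma (1 - s) * (frob_zero s p z - (p / 4) powr s * frob_two s p z))"
proof -
  have m': "twice_diff_pos m" "\<And>z. z > 0 \<Longrightarrow> bessel_op (1 - 2 * s) m z = of_real p * m z"
    "(m \<longlongrightarrow> 1) (at_right 0)" "(m \<longlongrightarrow> 0) at_top"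
    using m p unfolding selected_profile_def by auto
  from bessel_ode_general_solution[OF s m'(1,2)] obtain \<alpha> \<beta> where
    ab: "\<And>z. z > 0 \<Longrightarrow> m z = frob_zero s p z *\<^sub>R \<alpha> + frob_two s p z *\<^sub>R \<beta>" by blast
  note pos = frob_zero_pos[OF s p]
  have "((\<lambda>z. frob_zero s p z *\<^sub>R \<alpha> + frob_two s p z *\<^sub>R \<beta>) \<longlongrightarrow> rGamma (1 - s) *\<^sub>R \<alpha> + 0 *\<^sub>R \<beta>) (at_right 0)"
    using s by (intro tendsto_intros tendsto_frob_at_0) auto
  moreover have "((\<lambda>z. frob_zero s p z *\<^sub>R \<alpha> + frob_two s p z *\<^sub>R \<beta>) \<longlongrightarrow> 1) (at_right 0)"
    by (rule Lim_transform_eventually[OF m'(3)]) (auto simp: eventually_at_filter ab)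
  ultimately have "rGamma (1 - s) *\<^sub>R \<alpha> = 1"
    by (auto dest: tendsto_unique[rotated])
  then have \<alpha>: "\<alpha> = of_real (Gamma (1 - s))"
    using pos(2) by (simp add: scaleR_conv_of_real rGamma_inverse_Gamma field_simps)
  have "((\<lambda>z. \<alpha> + (frob_two s p z / frob_zero s p z) *\<^sub>R \<beta>) \<longlongrightarrow> \<alpha> + (4 / p) powr s *\<^sub>R \<beta>) at_top"
    by (intro tendsto_intros frob_ratio_tendsto s p)
  moreover have "((\<lambda>z. \<alpha> + (frob_two s p z / frob_zero s p z) *\<^sub>R \<beta>) \<longlongrightarrow> 0) at_top"
  proof (rule Lim_null_comparison)
    show "((\<lambda>z. norm (m z) / rGamma (1 - s)) \<longlongrightarrow> 0) at_top"
      using m'(4) by (intro tendsto_divide_zero tendsto_norm_zero)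
    show "\<forall>\<^sub>F z in at_top. norm (\<alpha> + (frob_two s p z / frob_zero s p z) *\<^sub>R \<beta>) \<le> norm (m z) / rGamma (1 - s)"
      using eventually_gt_at_top[of 0]
    proof eventually_elim
      case (elim z)
      have f: "frob_zero s p z > 0" using pos by (rule less_le_trans[rotated])
      then have "\<alpha> + (frob_two s p z / frob_zero s p z) *\<^sub>R \<beta> = m z /\<^sub>R frob_zero s p z"
        using ab[OF elim] by (simp add: scaleR_conv_of_real field_simps)
      then have "norm (\<alpha> + (frob_two s p z / frob_zero s p z) *\<^sub>R \<beta>) = norm (m z) / frob_zero s p z"
        using f by (simp add: divide_inverse mult.commute)
      also have "\<dots> \<le> norm (m z) / rGamma (1 - s)"
        using pos by (intro divide_left_mono) (auto simp: f)
      finally show ?case .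
    qed
  qed
  ultimately have "\<alpha> + (4 / p) powr s *\<^sub>R \<beta> = 0" by (rule tendsto_unique[rotated]) auto
  then have "(p / 4) powr s *\<^sub>R (\<alpha> + (4 / p) powr s *\<^sub>R \<beta>) = 0" by simp
  then have "(p / 4) powr s *\<^sub>R \<alpha> + ((p / 4) powr s * (4 / p) powr s) *\<^sub>R \<beta> = 0"
    by (simp only: scaleR_add_right scaleR_scaleR)
  moreover have "(p / 4) powr s * (4 / p) powr s = 1" using p by (simp add: powr_mult[symmetric])
  ultimately have "of_real ((p / 4) powr s) * \<alpha> + \<beta> = 0"
    by (simp only: scaleR_one) (simp only: scaleR_conv_of_real)
  then have "\<beta> = - (of_real ((p / 4) powr s) * \<alpha>)"
    by (simp only: add_eq_0_iff)
  then show ?thesis unfolding ab[OF z] \<alpha>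
    by (simp only: scaleR_conv_of_real of_real_mult of_real_diff) (simp add: algebra_simps)
qed

section \<open>The selected profile\<close>

lemma Bessel_I_eq:
  "Bessel_I \<nu> w = (w / 2) powr of_real \<nu> * bessel_series \<nu> (w\<^sup>2 / 4)"
proof -
  have "(w / 2) ^ (2 * k) * rGamma (of_nat k + of_real \<nu> + 1) / fact k =
     of_real (rGamma (of_nat k + \<nu> + 1) / fact k) * (w\<^sup>2 / 4) ^ k" for k
    using rGamma_complex_of_real[of "real k + \<nu> + 1"]
    unfolding power_mult by (simp add: power_divide mult_ac)
  then show ?thesis unfolding Bessel_I_def bessel_series_def by simp
qed

definition macdonald_profile :: "real \<Rightarrow> complex \<Rightarrow> complex" where
  "macdonald_profile s w = of_real (2 powr (1 - s) / Gamma s) * w powr of_real s * Bessel_K s w"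

text \<open>The reflection formula \<open>\<Gamma>(s) \<Gamma>(1 - s) = \<pi> / sin (\<pi> s)\<close> absorbs all constants.\<close>

lemma macdonald_profile_eq:
  assumes s: "0 < s" "s < 1" and w: "w \<noteq> 0"
  shows "macdonald_profile s w = of_real (Gamma (1 - s)) *
     (bessel_series (- s) (w\<^sup>2 / 4) - (w / 2) powr of_real (2 * s) * bessel_series s (w\<^sup>2 / 4))"
proof -
  define P where "P = (w / 2) powr of_real s"
  have Ln2: "Ln (w / 2) = Ln w - of_real (ln 2)"
    using Ln_divide_of_real[of 2 w] w by simp
  have P0: "P \<noteq> 0" using w by (simp add: P_def)
  have 1: "w powr of_real s = of_real (2 powr s) * P"
    using w unfolding P_def powr_def Ln2
    by (simp add: powr_def exp_of_real[symmetric] exp_add[symmetric] algebra_simps)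
  have 2: "(w / 2) powr of_real (- s) = inverse P"
    unfolding P_def by (simp add: powr_minus)
  have 3: "(w / 2) powr of_real (2 * s) = P * P"
    unfolding P_def by (simp add: powr_add[symmetric])
  have sin0: "sin (pi * s) > 0" using s by (intro sin_gt_zero) auto
  have refl: "Gamma s * Gamma (1 - s) = pi / sin (pi * s)"
  proof -
    have "complex_of_real (Gamma s * Gamma (1 - s)) = of_real (pi / sin (pi * s))"
      using Gamma_reflection_complex[of "of_real s"]
      by (simp add: Gamma_complex_of_real[symmetric] sin_of_real[symmetric])
    then show ?thesis by (simp only: of_real_eq_iff)
  qed
  have G: "Gamma s > 0" using s by (simp add: Gamma_real_pos)
  have c: "2 powr (1 - s) / Gamma s * 2 powr s * (pi / 2) / sin (pi * s) = Gamma (1 - s)"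
  proof -
    have "2 powr (1 - s) * 2 powr s = (2::real)" by (simp add: powr_add[symmetric])
    then have "2 powr (1 - s) / Gamma s * 2 powr s * (pi / 2) / sin (pi * s) = (pi / sin (pi * s)) / Gamma s"
      by (simp add: field_simps)
    then show ?thesis using G by (simp add: refl[symmetric])
  qed
  have "macdonald_profile s w = of_real (2 powr (1 - s) / Gamma s * 2 powr s * (pi / 2) / sin (pi * s)) *
     (P * (inverse P * bessel_series (- s) (w\<^sup>2 / 4) - P * bessel_series s (w\<^sup>2 / 4)))"
    unfolding macdonald_profile_def Bessel_K_def Bessel_I_eq 1 2 P_def[symmetric]
    by (simp add: mult_ac)
  also have "P * (inverse P * bessel_series (- s) (w\<^sup>2 / 4) - P * bessel_series s (w\<^sup>2 / 4)) =
     bessel_series (- s) (w\<^sup>2 / 4) - P * P * bessel_series s (w\<^sup>2 / 4)"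
    using P0 by (simp add: algebra_simps)
  finally show ?thesis unfolding c 3 .
qed

definition sgn_phase :: "real \<Rightarrow> complex" where
  "sgn_phase p = (if p > 0 then 1 else - \<i>)"

text \<open>The phases of the Neumann constant combine to the principal power: for \<open>p > 0\<close> the argument is
  \<open>\<pi> s / 2\<close>, for \<open>p < 0\<close> it is \<open>\<pi> s / 2 - \<pi> s\<close>.\<close>

lemma sgn_phase_powr:
  assumes "p \<noteq> 0"
  shows "sgn_phase p powr of_real (2 * s) * exp (\<i> * of_real (pi * s / 2)) * of_real (\<bar>p\<bar> powr s)
    = (\<i> * of_real p) powr of_real s"
proof (cases "p > 0")
  case True
  have "(\<i> * of_real p) powr of_real s = exp (of_real s * (of_real (ln p) + \<i> * of_real (pi / 2)))"
    using True Ln_times_of_real[of p \<i>] by (simp add: powr_def mult.commute Ln_of_real)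
  also have "\<dots> = exp (\<i> * of_real (pi * s / 2)) * of_real (p powr s)"
    using True by (simp add: powr_def exp_of_real[symmetric] exp_add[symmetric] algebra_simps)
  finally show ?thesis using True by (simp add: sgn_phase_def)
next
  case False
  then have p: "p < 0" using assms by simp
  have "Ln (of_real (- p) * (- \<i>)) = of_real (ln (- p)) - \<i> * of_real (pi / 2)"
    using p Ln_of_real[of "- p"] by (subst Ln_times_of_real) simp_all
  moreover have "of_real (- p) * (- \<i>) = \<i> * of_real p" by simp
  ultimately have Ln: "Ln (\<i> * of_real p) = of_real (ln (- p)) - \<i> * of_real (pi / 2)" by metis
  have "(\<i> * of_real p) powr of_real s = exp (of_real s * (of_real (ln (- p)) - \<i> * of_real (pi / 2)))"
    using p by (simp add: powr_def Ln)
  also have "\<dots> = exp (of_real (2 * s) * (- (\<i> * of_real (pi / 2)))) * exp (\<i> * of_real (pi * s / 2)) * of_real ((- p) powr s)"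
    using p by (simp add: powr_def exp_of_real[symmetric] exp_add[symmetric] algebra_simps)
  finally show ?thesis using p by (simp add: sgn_phase_def powr_def)
qed

lemma macdonald_profile_real:
  assumes s: "0 < s" "s < 1" and p: "p \<noteq> 0" and z: "z > 0"
  shows "macdonald_profile s (of_real z * sgn_phase p * of_real (sqrt \<bar>p\<bar>)) =
    of_real (Gamma (1 - s)) * (of_real (frob_zero s p z)
      - sgn_phase p powr of_real (2 * s) * of_real ((\<bar>p\<bar> / 4) powr s * frob_two s p z))"
proof -
  define w where "w = of_real z * sgn_phase p * of_real (sqrt \<bar>p\<bar>)"
  have w0: "w \<noteq> 0" using p z by (auto simp: w_def sgn_phase_def)
  have "w\<^sup>2 = of_real (z\<^sup>2) * (sgn_phase p)\<^sup>2 * of_real ((sqrt \<bar>p\<bar>)\<^sup>2)"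
    by (simp only: w_def power_mult_distrib of_real_power)
  also have "\<dots> = of_real (p * z\<^sup>2)" using p by (simp add: sgn_phase_def)
  finally have w2: "w\<^sup>2 / 4 = of_real (p * z\<^sup>2 / 4)" by simp
  define r where "r = z * sqrt \<bar>p\<bar> / 2"
  have r: "r > 0" using p z by (simp add: r_def)
  have "w / 2 = of_real r * sgn_phase p" by (simp add: w_def r_def)
  then have "(w / 2) powr of_real (2 * s) = of_real (r powr (2 * s)) * sgn_phase p powr of_real (2 * s)"
    using r by (auto simp: powr_def Ln_times_of_real Ln_of_real sgn_phase_def exp_of_real[symmetric] exp_add[symmetric] algebra_simps)
  also have "r powr (2 * s) = z powr (2 * s) * (\<bar>p\<bar> / 4) powr s"
  proof -
    have "r powr (2 * s) = (r\<^sup>2) powr s" using r by (simp add: powr_powr powr_numeral[symmetric] del: powr_numeral)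
    also have "r\<^sup>2 = z\<^sup>2 * (\<bar>p\<bar> / 4)" by (simp add: r_def power_mult_distrib power_divide)
    also have "\<dots> powr s = (z\<^sup>2) powr s * (\<bar>p\<bar> / 4) powr s" by (rule powr_mult)
    also have "(z\<^sup>2) powr s = z powr (2 * s)" using z by (simp add: powr_powr powr_numeral[symmetric] del: powr_numeral)
    finally show ?thesis .
  qed
  finally show ?thesis
    unfolding w_def[symmetric] macdonald_profile_eq[OF s w0] w2 bessel_series_of_real
    by (simp add: frob_zero_def frob_two_def)
qed

text \<open>The principal root jumps across the negative axis, so its limit from below is read off from the
  formula for real and imaginary part.\<close>

lemma csqrt_below_tendsto:
  assumes p: "p < 0"
  shows "((\<lambda>\<epsilon>. csqrt (of_real p - \<i> * of_real \<epsilon>)) \<longlongrightarrow> - \<i> * of_real (sqrt \<bar>p\<bar>)) (at_right 0)"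
proof (rule Lim_transform_eventually)
  let ?r = "\<lambda>\<epsilon>. cmod (of_real p - \<i> * of_real \<epsilon>)"
  have r: "(?r \<longlongrightarrow> cmod (of_real p - \<i> * of_real 0)) (at_right 0)"
    by (intro tendsto_intros)
  have "((\<lambda>\<epsilon>. Complex (sqrt ((?r \<epsilon> + p) / 2)) (- sqrt ((?r \<epsilon> - p) / 2))) \<longlongrightarrow>
      Complex (sqrt ((cmod (of_real p - \<i> * of_real 0) + p) / 2)) (- sqrt ((cmod (of_real p - \<i> * of_real 0) - p) / 2))) (at_right 0)"
    by (intro tendsto_Complex tendsto_intros r) auto
  also have "Complex (sqrt ((cmod (of_real p - \<i> * of_real 0) + p) / 2)) (- sqrt ((cmod (of_real p - \<i> * of_real 0) - p) / 2))
     = - \<i> * of_real (sqrt \<bar>p\<bar>)"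
    using p by (simp add: complex_eq_iff)
  finally show "((\<lambda>\<epsilon>. Complex (sqrt ((?r \<epsilon> + p) / 2)) (- sqrt ((?r \<epsilon> - p) / 2))) \<longlongrightarrow> - \<i> * of_real (sqrt \<bar>p\<bar>)) (at_right 0)" .
  show "\<forall>\<^sub>F \<epsilon> in at_right 0. Complex (sqrt ((?r \<epsilon> + p) / 2)) (- sqrt ((?r \<epsilon> - p) / 2)) = csqrt (of_real p - \<i> * of_real \<epsilon>)"
    by (auto simp: eventually_at_filter complex_eq_iff)
qed

text \<open>The limit point \<open>- \<i> z sqrt \<bar>p\<bar>\<close> lies off the branch cut, so the profile is continuous there.\<close>

lemma limiting_absorption_profile:
  assumes s: "0 < s" "s < 1" and p: "p < 0" and z: "z > 0"
  shows "((\<lambda>\<epsilon>. macdonald_profile s (of_real z * csqrt (of_real p - \<i> * of_real \<epsilon>))) \<longlongrightarrow>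
     macdonald_profile s (of_real z * sgn_phase p * of_real (sqrt \<bar>p\<bar>))) (at_right 0)"
proof -
  define w0 where "w0 = of_real z * sgn_phase p * of_real (sqrt \<bar>p\<bar>)"
  define w where "w \<epsilon> = of_real z * csqrt (of_real p - \<i> * of_real \<epsilon>)" for \<epsilon> :: real
  have w0: "w0 \<noteq> 0" "w0 / 2 \<notin> \<real>\<^sub>\<le>\<^sub>0"
    using p z by (auto simp: w0_def sgn_phase_def complex_nonpos_Reals_iff)
  have lim: "(w \<longlongrightarrow> w0) (at_right 0)"
    using tendsto_mult_left[OF csqrt_below_tendsto[OF p], of "of_real z"] p
    by (simp add: w_def[abs_def] w0_def sgn_phase_def mult.assoc)
  have "((\<lambda>\<epsilon>. of_real (Gamma (1 - s)) * (bessel_series (- s) ((w \<epsilon>)\<^sup>2 / 4)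
          - (w \<epsilon> / 2) powr of_real (2 * s) * bessel_series s ((w \<epsilon>)\<^sup>2 / 4)))
      \<longlongrightarrow> of_real (Gamma (1 - s)) * (bessel_series (- s) (w0\<^sup>2 / 4)
          - (w0 / 2) powr of_real (2 * s) * bessel_series s (w0\<^sup>2 / 4))) (at_right 0)"
    by (intro tendsto_intros tendsto_powr_complex lim w0) auto
  moreover have "\<forall>\<^sub>F \<epsilon> in at_right 0. of_real (Gamma (1 - s)) * (bessel_series (- s) ((w \<epsilon>)\<^sup>2 / 4)
          - (w \<epsilon> / 2) powr of_real (2 * s) * bessel_series s ((w \<epsilon>)\<^sup>2 / 4)) = macdonald_profile s (w \<epsilon>)"
    using tendsto_imp_eventually_ne[OF lim w0(1)]
    by eventually_elim (simp add: macdonald_profile_eq[OF s])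
  ultimately show ?thesis
    unfolding w0_def[symmetric] w_def[symmetric] macdonald_profile_eq[OF s w0(1)]
    by (rule Lim_transform_eventually)
qed

theorem selected_profile_unique:
  assumes s: "0 < s" "s < 1" and p: "p \<noteq> 0" and m: "selected_profile s p m" and z: "z > 0"
  shows "m z = macdonald_profile s (of_real z * sgn_phase p * of_real (sqrt \<bar>p\<bar>))"
proof (cases "p > 0")
  case True
  show ?thesis unfolding macdonald_profile_real[OF s p z] decaying_profile[OF s True m z]
    using True by (simp add: sgn_phase_def)
next
  case False
  then have p': "p < 0" using p by simp
  have "((\<lambda>\<epsilon>. macdonald_profile s (of_real z * csqrt (of_real p - \<i> * of_real \<epsilon>))) \<longlongrightarrow> m z) (at_right 0)"
    using m p' z unfolding selected_profile_def Let_def macdonald_profile_def by auto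
  from tendsto_unique[OF _ this limiting_absorption_profile[OF s p' z]] show ?thesis by simp
qed

lemma macdonald_profile_has_vector_derivative:
  fixes s p :: real
  defines "G \<equiv> \<lambda>z. macdonald_profile s (of_real z * sgn_phase p * of_real (sqrt \<bar>p\<bar>))"
    and "c \<equiv> sgn_phase p powr of_real (2 * s) * of_real ((\<bar>p\<bar> / 4) powr s)"
  assumes s: "0 < s" "s < 1" and p: "p \<noteq> 0" and z: "z > 0"
  shows "(G has_vector_derivative of_real (z powr (2 * s - 1)) * of_real (Gamma (1 - s)) *
      (of_real (p / 2 * frob_two (1 - s) p z) - 2 * c * of_real (frob_zero (1 - s) p z))) (at z)"
proof (rule has_vector_derivative_transform_within_open)
  show "open {0::real<..}" "z \<in> {0<..}" using z by auto
  show "of_real (Gamma (1 - s)) * (of_real (frob_zero s p y) - c * of_real (frob_two s p y)) = G y"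
    if "y \<in> {0<..}" for y
    using that unfolding G_def c_def by (subst macdonald_profile_real[OF s p]) (auto simp: mult_ac)
  have "((\<lambda>y. of_real (frob_zero s p y) - c * of_real (frob_two s p y)) has_vector_derivative
     of_real (p / 2 * z powr (2 * s - 1) * frob_two (1 - s) p z) - c * of_real (2 * z powr (2 * s - 1) * frob_zero (1 - s) p z)) (at z)"
    using has_field_derivative_frob_zero[OF z] has_field_derivative_frob_two[OF z]
    by (intro has_vector_derivative_diff has_vector_derivative_mult_right has_vector_derivative_of_real)
       (auto simp: has_real_derivative_iff_has_vector_derivative)
  from has_vector_derivative_mult_right[OF this, of "of_real (Gamma (1 - s))"]
  show "((\<lambda>y. of_real (Gamma (1 - s)) * (of_real (frob_zero s p y) - c * of_real (frob_two s p y))) has_vector_derivative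
     of_real (z powr (2 * s - 1)) * of_real (Gamma (1 - s)) *
      (of_real (p / 2 * frob_two (1 - s) p z) - 2 * c * of_real (frob_zero (1 - s) p z))) (at z)"
    by (rule has_vector_derivative_eq_rhs) (simp add: algebra_simps)
qed

text \<open>The Dirichlet and Neumann data of the profile. In the weighted derivative the part from the exponent
  0 vanishes at \<open>z = 0\<close> and the part from the exponent \<open>2s\<close> has a nonzero limit.\<close>

theorem macdonald_profile_boundary:
  fixes s p :: real
  defines "G \<equiv> \<lambda>z. macdonald_profile s (of_real z * sgn_phase p * of_real (sqrt \<bar>p\<bar>))"
  assumes s: "0 < s" "s < 1" and p: "p \<noteq> 0"
  shows "(G \<longlongrightarrow> 1) (at_right 0)"
    and "\<exists>L. ((\<lambda>z. of_real (z powr (1 - 2 * s)) * vector_derivative G (at z)) \<longlongrightarrow> L) (at_right 0) \<and>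
      - of_real (2 powr (2 * s - 1) * Gamma s) * exp (\<i> * of_real (pi * s / 2)) / of_real (Gamma (1 - s)) * L
       = (\<i> * of_real p) powr of_real s"
proof -
  define \<theta> where "\<theta> = sgn_phase p powr of_real (2 * s)"
  have G: "Gamma s > 0" "Gamma (1 - s) > 0" using s by (auto intro: Gamma_real_pos)
  have "((\<lambda>z. of_real (Gamma (1 - s)) * (of_real (frob_zero s p z) - \<theta> * of_real ((\<bar>p\<bar> / 4) powr s * frob_two s p z)))
     \<longlongrightarrow> of_real (Gamma (1 - s)) * (of_real (rGamma (1 - s)) - \<theta> * of_real ((\<bar>p\<bar> / 4) powr s * 0))) (at_right 0)"
    using s by (intro tendsto_intros tendsto_frob_at_0) auto
  also have "of_real (Gamma (1 - s)) * (of_real (rGamma (1 - s)) - \<theta> * of_real ((\<bar>p\<bar> / 4) powr s * 0)) = 1"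
    using G by (simp add: rGamma_inverse_Gamma)
  finally show "(G \<longlongrightarrow> 1) (at_right 0)"
    by (rule Lim_transform_eventually)
       (auto simp: eventually_at_filter G_def \<theta>_def macdonald_profile_real[OF s p])
  define c where "c = \<theta> * of_real ((\<bar>p\<bar> / 4) powr s)"
  define L where "L = of_real (Gamma (1 - s)) * (of_real (p / 2 * 0) - 2 * c * of_real (rGamma (1 - (1 - s))))"
  have "((\<lambda>z. of_real (Gamma (1 - s)) * (of_real (p / 2 * frob_two (1 - s) p z) - 2 * c * of_real (frob_zero (1 - s) p z))) \<longlongrightarrow> L) (at_right 0)"
    unfolding L_def using s by (intro tendsto_intros tendsto_frob_at_0) auto
  then have lim: "((\<lambda>z. of_real (z powr (1 - 2 * s)) * vector_derivative G (at z)) \<longlongrightarrow> L) (at_right 0)"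
  proof (rule Lim_transform_eventually)
    have "of_real (Gamma (1 - s)) * (of_real (p / 2 * frob_two (1 - s) p z) - 2 * c * of_real (frob_zero (1 - s) p z))
        = of_real (z powr (1 - 2 * s)) * vector_derivative G (at z)" if z: "z > 0" for z
    proof -
      have "vector_derivative G (at z) = of_real (z powr (2 * s - 1)) * of_real (Gamma (1 - s)) *
        (of_real (p / 2 * frob_two (1 - s) p z) - 2 * c * of_real (frob_zero (1 - s) p z))"
        unfolding G_def c_def \<theta>_def using macdonald_profile_has_vector_derivative[OF s p z]
        by (rule vector_derivative_at)
      moreover have "of_real (z powr (1 - 2 * s)) * of_real (z powr (2 * s - 1)) = (1::complex)"
        using z by (simp add: of_real_mult[symmetric] powr_add[symmetric] del: of_real_mult)
      ultimately show ?thesis by (metis mult.assoc mult_1)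
    qed
    then show "\<forall>\<^sub>F z in at_right 0. of_real (Gamma (1 - s)) * (of_real (p / 2 * frob_two (1 - s) p z) - 2 * c * of_real (frob_zero (1 - s) p z))
        = of_real (z powr (1 - 2 * s)) * vector_derivative G (at z)"
      by (simp add: eventually_at_filter)
  qed
  have k: "2 powr (2 * s - 1) * 2 * (\<bar>p\<bar> / 4) powr s = \<bar>p\<bar> powr s"
  proof -
    have "2 powr (2 * s - 1) * 2 = (2::real) powr (2 * s)" by (simp add: powr_diff)
    also have "\<dots> = (2 powr 2) powr s" by (simp only: powr_powr)
    also have "\<dots> = 4 powr s" by simp
    finally show ?thesis using p by (simp add: powr_mult[symmetric])
  qed
  have "- of_real (2 powr (2 * s - 1) * Gamma s) * exp (\<i> * of_real (pi * s / 2)) / of_real (Gamma (1 - s)) * L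
      = \<theta> * exp (\<i> * of_real (pi * s / 2)) * of_real (2 powr (2 * s - 1) * 2 * (\<bar>p\<bar> / 4) powr s)"
    using G by (simp add: L_def c_def rGamma_inverse_Gamma field_simps)
  also have "\<dots> = (\<i> * of_real p) powr of_real s"
    unfolding k \<theta>_def by (rule sgn_phase_powr[OF p])
  finally show "\<exists>L. ((\<lambda>z. of_real (z powr (1 - 2 * s)) * vector_derivative G (at z)) \<longlongrightarrow> L) (at_right 0) \<and>
      - of_real (2 powr (2 * s - 1) * Gamma s) * exp (\<i> * of_real (pi * s / 2)) / of_real (Gamma (1 - s)) * L
       = (\<i> * of_real p) powr of_real s"
    using lim by blast
qed

section \<open>Fourier inversion\<close>

definition unit_exp :: "real \<Rightarrow> complex" where
  "unit_exp r = exp (2 * of_real pi * \<i> * of_real r)"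

lemma norm_unit_exp [simp]: "norm (unit_exp r) = 1"
  by (simp add: unit_exp_def norm_exp_eq_Re)

lemma unit_exp_0 [simp]: "unit_exp 0 = 1"
  by (simp add: unit_exp_def)

lemma unit_exp_add: "unit_exp (r + t) = unit_exp r * unit_exp t"
  by (simp add: unit_exp_def exp_add[symmetric] algebra_simps)

lemma unit_exp_diff: "unit_exp (r - t) = unit_exp r * unit_exp (- t)"
  using unit_exp_add[of r "- t"] by simp

lemma continuous_unit_exp [continuous_intros]:
  "continuous_on A f \<Longrightarrow> continuous_on A (\<lambda>x. unit_exp (f x))"
  unfolding unit_exp_def by (intro continuous_intros)

lemma isCont_unit_exp [continuous_intros]: "isCont f x \<Longrightarrow> isCont (\<lambda>x. unit_exp (f x)) x"
  unfolding unit_exp_def by (intro continuous_intros)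

lemma measurable_unit_exp [measurable]: "unit_exp \<in> borel_measurable borel"
  by (intro borel_measurable_continuous_onI continuous_intros)

lemma fourier_eq: "fourier f \<zeta> = (\<integral>y. unit_exp (- (\<zeta> \<bullet> y)) * f y \<partial>lborel)"
  by (simp add: fourier_def unit_exp_def)

lemma integrable_unit_exp_mult:
  assumes "integrable lborel f" and g: "g \<in> borel_measurable borel"
  shows "integrable lborel (\<lambda>y. unit_exp (g y) * f y)"
proof (rule Bochner_Integration.integrable_bound[OF assms(1)])
  have [measurable]: "f \<in> borel_measurable borel" using assms(1) by auto
  note g[measurable]
  show "(\<lambda>y. unit_exp (g y) * f y) \<in> borel_measurable lborel" by measurable
qed (simp add: norm_mult)

lemma norm_fourier_le: "norm (fourier f \<zeta>) \<le> (\<integral>y. norm (f y) \<partial>lborel)"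
  unfolding fourier_eq using integral_norm_bound[of lborel "\<lambda>y. unit_exp (- (\<zeta> \<bullet> y)) * f y"]
  by (simp add: norm_mult)

lemma isCont_fourier:
  assumes f: "integrable lborel f"
  shows "isCont (fourier f) \<zeta>"
proof -
  have [measurable]: "f \<in> borel_measurable borel" using f by auto
  show ?thesis
    unfolding continuous_at_sequentially
  proof (intro allI impI)
    fix X :: "nat \<Rightarrow> 'a" assume X: "X \<longlonglongrightarrow> \<zeta>"
    show "(fourier f \<circ> X) \<longlonglongrightarrow> fourier f \<zeta>"
      unfolding o_def fourier_eq
    proof (rule integral_dominated_convergence[where w="\<lambda>y. norm (f y)"])
      show "AE y in lborel. (\<lambda>i. unit_exp (- (X i \<bullet> y)) * f y) \<longlonglongrightarrow> unit_exp (- (\<zeta> \<bullet> y)) * f y"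
        using X by (intro AE_I2 tendsto_mult_right isCont_tendsto_compose[of _ unit_exp] tendsto_intros)
          (auto intro!: continuous_intros)
    qed (use f in \<open>auto simp: norm_mult\<close>)
  qed
qed

lemma measurable_fourier [measurable]:
  "integrable lborel f \<Longrightarrow> fourier f \<in> borel_measurable borel"
  by (intro borel_measurable_continuous_onI continuous_at_imp_continuous_on ballI isCont_fourier)

lemma lborel_prod_coords:
  fixes f :: "'a::euclidean_space \<Rightarrow> real \<Rightarrow> 'c::{real_normed_field,banach,second_countable_topology}"
  assumes f: "\<And>b. b \<in> Basis \<Longrightarrow> integrable lborel (f b)"
  shows "integrable lborel (\<lambda>x. \<Prod>b\<in>Basis. f b (x \<bullet> b))"
    and "(\<integral>x. (\<Prod>b\<in>Basis. f b (x \<bullet> b)) \<partial>lborel) = (\<Prod>b\<in>Basis. \<integral>x. f b x \<partial>lborel)"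
proof -
  interpret product_sigma_finite "\<lambda>_::'a. lborel :: real measure"
    by standard
  have [measurable]: "f b \<in> borel_measurable borel" if "b \<in> Basis" for b
    using f[OF that] by auto
  have T: "(\<lambda>f. \<Sum>b\<in>Basis. f b *\<^sub>R b) \<in> measurable (\<Pi>\<^sub>M b\<in>(Basis::'a set). lborel) (borel :: 'a measure)"
    by measurable
  have F: "(\<lambda>x::'a. \<Prod>b\<in>Basis. f b (x \<bullet> b)) \<in> borel_measurable borel"
    by measurable
  have eq: "(\<Prod>b\<in>Basis. f b ((\<Sum>c\<in>Basis. g c *\<^sub>R c) \<bullet> b)) = (\<Prod>b\<in>Basis. f b (g b))" for g
    by (intro prod.cong refl) (simp add: inner_sum_left inner_Basis if_distrib sum.delta cong: if_cong)
  show "integrable lborel (\<lambda>x::'a. \<Prod>b\<in>Basis. f b (x \<bullet> b))"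
    unfolding lborel_eq[where 'a='a] integrable_distr_eq[OF T F] eq
    using f by (intro product_integrable_prod) auto
  show "(\<integral>x. (\<Prod>b\<in>Basis. f b (x \<bullet> b)) \<partial>(lborel :: 'a measure)) = (\<Prod>b\<in>Basis. \<integral>x. f b x \<partial>lborel)"
    unfolding lborel_eq[where 'a='a] integral_distr[OF T F] eq
    using f by (intro product_integral_prod) auto
qed

text \<open>The exponent \<open>2 d\<close> in dimension \<open>d\<close> makes integrability elementary: the weight is at most the product
  of the one-dimensional weights \<open>1 / (1 + (x \<bullet> b)\<^sup>2)\<close> over the basis.\<close>

definition decay_weight :: "'a::euclidean_space \<Rightarrow> real" where
  "decay_weight x = 1 / (1 + norm x) ^ (2 * DIM('a))"

lemma measurable_decay_weight [measurable]: "decay_weight \<in> borel_measurable borel"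
  unfolding decay_weight_def[abs_def] by measurable

lemma decay_weight_bounds: "0 < decay_weight x" "decay_weight x \<le> 1"
  by (auto simp: decay_weight_def add_pos_nonneg intro!: divide_le_eq_1[THEN iffD2] one_le_power)

lemma integrable_decay_weight: "integrable lborel (decay_weight :: 'a::euclidean_space \<Rightarrow> real)"
proof (rule Bochner_Integration.integrable_bound)
  have "integrable lborel (\<lambda>x::real. inverse (1 + x\<^sup>2))"
    using integrable_inverse_1_plus_square by (simp add: set_integrable_def)
  then show "integrable lborel (\<lambda>x::'a. \<Prod>b\<in>Basis. inverse (1 + (x \<bullet> b)\<^sup>2))"
    by (rule lborel_prod_coords)
  show "AE x::'a in lborel. norm (decay_weight x) \<le> norm (\<Prod>b\<in>Basis. inverse (1 + (x \<bullet> b)\<^sup>2))"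
  proof (rule AE_I2)
    fix x :: 'a
    have "(\<Prod>b::'a\<in>Basis. inverse ((1 + norm x)\<^sup>2)) \<le> (\<Prod>b\<in>Basis. inverse (1 + (x \<bullet> b)\<^sup>2))"
    proof (intro prod_mono conjI le_imp_inverse_le)
      fix b :: 'a assume "b \<in> Basis"
      then have "\<bar>x \<bullet> b\<bar>\<^sup>2 \<le> (norm x)\<^sup>2" by (intro power_mono Basis_le_norm) auto
      then show "1 + (x \<bullet> b)\<^sup>2 \<le> (1 + norm x)\<^sup>2"
        using norm_ge_zero[of x] by (simp add: power2_sum del: norm_ge_zero)
      show "0 < 1 + (x \<bullet> b)\<^sup>2" by (simp add: add_pos_nonneg)
    qed simp
    moreover have "(\<Prod>b::'a\<in>Basis. inverse ((1 + norm x)\<^sup>2)) = decay_weight x"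
      by (simp add: decay_weight_def power_mult inverse_eq_divide power_divide)
    ultimately show "norm (decay_weight x) \<le> norm (\<Prod>b\<in>Basis. inverse (1 + (x \<bullet> b)\<^sup>2))"
      using decay_weight_bounds(1)[of x] by simp
  qed
qed measurable

lemma integrable_of_decay:
  fixes f :: "'a::euclidean_space \<Rightarrow> 'b::{banach,second_countable_topology}"
  assumes "f \<in> borel_measurable borel" and C: "\<And>x. (1 + norm x) ^ (2 * DIM('a)) * norm (f x) \<le> C"
  shows "integrable lborel f"
proof (rule Bochner_Integration.integrable_bound)
  show "integrable lborel (\<lambda>x::'a. C * decay_weight x)"
    by (intro integrable_mult_right integrable_decay_weight)
  have C0: "C \<ge> 0" using order_trans[OF _ C[of 0]] by simp
  have "norm (f x) \<le> C / (1 + norm x) ^ (2 * DIM('a))" for x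
    using C[of x] by (subst pos_le_divide_eq) (auto simp: mult.commute add_pos_nonneg)
  then show "AE x in lborel. norm (f x) \<le> norm (C * decay_weight x)"
    using C0 by (auto simp: abs_mult decay_weight_def)
qed (use assms in simp)

lemma lborel_integral_affine:
  fixes f :: "'a::euclidean_space \<Rightarrow> 'b::{banach,second_countable_topology}"
  assumes c: "c \<noteq> 0" and [measurable]: "f \<in> borel_measurable borel"
  shows "(\<integral>x. f x \<partial>lborel) = \<bar>c\<bar> ^ DIM('a) *\<^sub>R (\<integral>x. f (t + c *\<^sub>R x) \<partial>lborel)"
    and "integrable lborel f \<longleftrightarrow> integrable lborel (\<lambda>x. f (t + c *\<^sub>R x))"
proof -
  show "(\<integral>x. f x \<partial>lborel) = \<bar>c\<bar> ^ DIM('a) *\<^sub>R (\<integral>x. f (t + c *\<^sub>R x) \<partial>lborel)"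
    apply (subst lborel_affine[OF c, of t])
    apply (subst integral_density)
    apply (auto simp: integral_distr)
    done
  show "integrable lborel f \<longleftrightarrow> integrable lborel (\<lambda>x. f (t + c *\<^sub>R x))"
  proof -
    have "integrable lborel f \<longleftrightarrow> integrable lborel (\<lambda>x. \<bar>c\<bar> ^ DIM('a) *\<^sub>R f (t + c *\<^sub>R x))"
      apply (subst lborel_affine[OF c, of t])
      apply (subst integrable_density)
      apply (auto simp: integrable_distr_eq)
      done
    also have "\<dots> \<longleftrightarrow> integrable lborel (\<lambda>x. f (t + c *\<^sub>R x))"
      using c integrable_scaleR_right[of "inverse (\<bar>c\<bar> ^ DIM('a))" lborel "\<lambda>x. \<bar>c\<bar> ^ DIM('a) *\<^sub>R f (t + c *\<^sub>R x)"]
      by auto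
    finally show ?thesis .
  qed
qed

text \<open>Normalized to be its own Fourier transform.\<close>

definition gaussian :: "'a::euclidean_space \<Rightarrow> real" where
  "gaussian x = exp (- (pi * (norm x)\<^sup>2))"

lemma gaussian_prod: "gaussian x = (\<Prod>b\<in>Basis. gaussian (x \<bullet> b))"
proof -
  have "(norm x)\<^sup>2 = (\<Sum>b\<in>Basis. (x \<bullet> b)\<^sup>2)"
    unfolding power2_norm_eq_inner by (subst euclidean_inner) (simp add: power2_eq_square)
  then show ?thesis
    by (simp add: gaussian_def exp_sum[symmetric] sum_distrib_left sum_negf)
qed

lemma measurable_gaussian [measurable]: "gaussian \<in> borel_measurable borel"
  unfolding gaussian_def[abs_def] by measurable

text \<open>The substitution \<open>x = sqrt (2 \<pi>) y\<close> in the characteristic function of the standard normal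
  distribution.\<close>

lemma gaussian_real:
  shows "integrable lborel (gaussian :: real \<Rightarrow> real)"
    and "fourier (\<lambda>x::real. of_real (gaussian x)) t = of_real (gaussian t)"
proof -
  define c where "c = sqrt (2 * pi)"
  have c: "c > 0" "c\<^sup>2 = 2 * pi" by (simp_all add: c_def)
  have dens: "std_normal_density (c * x) = gaussian x / c" for x
    by (simp add: std_normal_density_def gaussian_def c_def power_mult_distrib)
  have "integrable lborel (\<lambda>x. std_normal_density (0 + c * x))"
    using c by (subst lborel_integrable_real_affine_iff) auto
  then have "integrable lborel (\<lambda>x. c * std_normal_density (0 + c * x))" by (rule integrable_mult_right)
  then show "integrable lborel (gaussian :: real \<Rightarrow> real)"
    using c by (simp add: dens)
  have "char std_normal_distribution (- (c * t)) = (\<integral>x. std_normal_density x *\<^sub>R exp (\<i> * of_real (- (c * t) * x)) \<partial>lborel)"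
    unfolding char_def by (subst integral_density) auto
  also have "\<dots> = \<bar>c\<bar> *\<^sub>R (\<integral>x. std_normal_density (0 + c * x) *\<^sub>R exp (\<i> * of_real (- (c * t) * (0 + c * x))) \<partial>lborel)"
    using c by (intro lborel_integral_real_affine) auto
  also have "\<dots> = (\<integral>x. \<bar>c\<bar> *\<^sub>R (std_normal_density (0 + c * x) *\<^sub>R exp (\<i> * of_real (- (c * t) * (0 + c * x)))) \<partial>lborel)"
    by (rule integral_scaleR_right[symmetric])
  also have "\<dots> = fourier (\<lambda>x::real. of_real (gaussian x)) t"
    unfolding fourier_eq
  proof (rule Bochner_Integration.integral_cong[OF refl])
    fix x :: real
    have "- (c * t) * (0 + c * x) = - (2 * pi * (t * x))" using c by (simp add: power2_eq_square algebra_simps)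
    then have "exp (\<i> * of_real (- (c * t) * (0 + c * x))) = unit_exp (- (t \<bullet> x))"
      by (simp only:) (simp add: unit_exp_def algebra_simps)
    moreover have "\<bar>c\<bar> * std_normal_density (0 + c * x) = gaussian x" using c by (simp add: dens)
    ultimately show "\<bar>c\<bar> *\<^sub>R (std_normal_density (0 + c * x) *\<^sub>R exp (\<i> * of_real (- (c * t) * (0 + c * x))))
       = unit_exp (- (t \<bullet> x)) * of_real (gaussian x)"
      by (simp only: scaleR_scaleR) (simp only: scaleR_conv_of_real mult.commute)
  qed
  also have "char std_normal_distribution (- (c * t)) = of_real (gaussian t)"
    using c by (simp add: char_std_normal_distribution gaussian_def power_mult_distrib)
  finally show "fourier (\<lambda>x::real. of_real (gaussian x)) t = of_real (gaussian t)" by simp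
qed

lemma integrable_gaussian: "integrable lborel (gaussian :: 'a::euclidean_space \<Rightarrow> real)"
  unfolding gaussian_prod[where 'a='a, abs_def] by (intro lborel_prod_coords gaussian_real)

lemma fourier_gaussian:
  fixes \<zeta> :: "'a::euclidean_space"
  shows "fourier (\<lambda>x. of_real (gaussian x)) \<zeta> = of_real (gaussian \<zeta>)"
proof -
  have "unit_exp (- (\<zeta> \<bullet> x)) * of_real (gaussian x) =
     (\<Prod>b\<in>Basis. unit_exp (- ((\<zeta> \<bullet> b) * (x \<bullet> b))) * of_real (gaussian (x \<bullet> b)))" for x
  proof -
    have "unit_exp (- (\<zeta> \<bullet> x)) = (\<Prod>b\<in>Basis. unit_exp (- ((\<zeta> \<bullet> b) * (x \<bullet> b))))"
      by (simp add: unit_exp_def exp_sum[symmetric] euclidean_inner[of \<zeta> x] sum_distrib_left sum_negf)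
    then show ?thesis by (simp add: prod.distrib gaussian_prod[of x])
  qed
  then have "fourier (\<lambda>x. of_real (gaussian x)) \<zeta> =
     (\<integral>x. (\<Prod>b\<in>Basis. unit_exp (- ((\<zeta> \<bullet> b) * (x \<bullet> b))) * of_real (gaussian (x \<bullet> b))) \<partial>lborel)"
    unfolding fourier_eq by simp
  also have "\<dots> = (\<Prod>b\<in>Basis. \<integral>x. unit_exp (- ((\<zeta> \<bullet> b) * x)) * of_real (gaussian x) \<partial>lborel)"
    by (intro lborel_prod_coords(2) integrable_unit_exp_mult integrable_of_real gaussian_real) auto
  also have "\<dots> = (\<Prod>b\<in>Basis. fourier (\<lambda>x::real. of_real (gaussian x)) (\<zeta> \<bullet> b))"
    by (simp add: fourier_eq)
  finally show ?thesis by (simp add: gaussian_real gaussian_prod[of \<zeta>])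
qed

lemma integral_gaussian: "(\<integral>x. gaussian (x :: 'a::euclidean_space) \<partial>lborel) = 1"
proof -
  have "complex_of_real (\<integral>x. gaussian (x :: 'a) \<partial>lborel) = fourier (\<lambda>x::'a. of_real (gaussian x)) 0"
    by (simp add: fourier_eq integral_of_real)
  also have "\<dots> = of_real 1" unfolding fourier_gaussian by (simp add: gaussian_def)
  finally show ?thesis by (simp only: of_real_eq_iff)
qed

lemma integrable_tensor:
  fixes f :: "'a::euclidean_space \<Rightarrow> 'c::{real_normed_field,banach,second_countable_topology}"
    and g :: "'b::euclidean_space \<Rightarrow> 'c"
  assumes f: "integrable lborel f" and g: "integrable lborel g"
  shows "integrable (lborel \<Otimes>\<^sub>M lborel) (\<lambda>(x, y). f x * g y)"
proof (rule lborel_pair.Fubini_integrable)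
  have [measurable]: "f \<in> borel_measurable borel" "g \<in> borel_measurable borel" using f g by auto
  show "(\<lambda>(x, y). f x * g y) \<in> borel_measurable (lborel \<Otimes>\<^sub>M lborel)" by measurable
  show "integrable lborel (\<lambda>x. \<integral>y. norm (case (x, y) of (x, y) \<Rightarrow> f x * g y) \<partial>lborel)"
    using f by (simp add: norm_mult)
  show "AE x in lborel. integrable lborel (\<lambda>y. case (x, y) of (x, y) \<Rightarrow> f x * g y)"
    using g by simp
qed

lemma fubini_dominated:
  fixes F :: "'a::euclidean_space \<Rightarrow> 'b::euclidean_space \<Rightarrow> complex"
  assumes [measurable]: "(\<lambda>(x, y). F x y) \<in> borel_measurable (lborel \<Otimes>\<^sub>M lborel)"
    and f: "integrable lborel (f :: 'a \<Rightarrow> real)" and g: "integrable lborel (g :: 'b \<Rightarrow> real)"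
    and le: "\<And>x y. norm (F x y) \<le> f x * g y"
  shows "integrable (lborel \<Otimes>\<^sub>M lborel) (\<lambda>(x, y). F x y)"
    and "(\<integral>x. \<integral>y. F x y \<partial>lborel \<partial>lborel) = (\<integral>y. \<integral>x. F x y \<partial>lborel \<partial>lborel)"
proof -
  show I: "integrable (lborel \<Otimes>\<^sub>M lborel) (\<lambda>(x, y). F x y)"
    by (rule Bochner_Integration.integrable_bound[OF integrable_tensor[OF f g]])
       (auto intro!: order_trans[OF le])
  show "(\<integral>x. \<integral>y. F x y \<partial>lborel \<partial>lborel) = (\<integral>y. \<integral>x. F x y \<partial>lborel \<partial>lborel)"
    using lborel_pair.Fubini_integral[OF I] by simp
qed

text \<open>Inserting the factor \<open>gaussian (h \<zeta>)\<close> makes the double integral absolutely convergent. Exchanging the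
  integrals turns it into the convolution of \<open>f\<close> with a Gaussian of width \<open>h\<close>, and \<open>h \<longlongrightarrow> 0\<close>
  gives \<open>f y\<close> on one side and the inversion integral on the other.\<close>

theorem fourier_inversion:
  fixes f :: "'a::euclidean_space \<Rightarrow> complex"
  assumes f: "integrable lborel f" and cont: "continuous_on UNIV f" and bound: "\<And>x. norm (f x) \<le> B"
    and fhat: "integrable lborel (fourier f)"
  shows "(\<integral>\<zeta>. unit_exp (\<zeta> \<bullet> y) * fourier f \<zeta> \<partial>lborel) = f y"
proof -
  have [measurable]: "f \<in> borel_measurable borel" "fourier f \<in> borel_measurable borel"
    using f by (auto intro: measurable_fourier)
  define h where "h n = 1 / real (Suc n)" for n
  have h: "h n > 0" for n by (simp add: h_def)
  have h0: "h \<longlonglongrightarrow> 0" unfolding h_def by (rule LIMSEQ_Suc[OF lim_1_over_n])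
  \<comment> \<open>The transform of the dilated Gaussian is a Gaussian of width \<open>h n\<close> and mass 1.\<close>
  have kernel: "(\<integral>\<zeta>. unit_exp (\<zeta> \<bullet> (y - x)) * of_real (gaussian (h n *\<^sub>R \<zeta>)) \<partial>lborel)
      = of_real (inverse (h n) ^ DIM('a) * gaussian (inverse (h n) *\<^sub>R (x - y)))" for n x
  proof -
    have "(\<integral>\<zeta>. unit_exp (\<zeta> \<bullet> (y - x)) * of_real (gaussian (h n *\<^sub>R \<zeta>)) \<partial>lborel)
      = \<bar>inverse (h n)\<bar> ^ DIM('a) *\<^sub>R (\<integral>\<zeta>. unit_exp ((0 + inverse (h n) *\<^sub>R \<zeta>) \<bullet> (y - x)) * of_real (gaussian (h n *\<^sub>R (0 + inverse (h n) *\<^sub>R \<zeta>))) \<partial>lborel)"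
      using h[of n] by (intro lborel_integral_affine) auto
    also have "(\<integral>\<zeta>. unit_exp ((0 + inverse (h n) *\<^sub>R \<zeta>) \<bullet> (y - x)) * of_real (gaussian (h n *\<^sub>R (0 + inverse (h n) *\<^sub>R \<zeta>))) \<partial>lborel)
       = fourier (\<lambda>\<zeta>. of_real (gaussian \<zeta>)) (inverse (h n) *\<^sub>R (x - y))"
      unfolding fourier_eq
    proof (intro Bochner_Integration.integral_cong refl)
      fix \<zeta> :: 'a
      have "(0 + inverse (h n) *\<^sub>R \<zeta>) \<bullet> (y - x) = - (inverse (h n) *\<^sub>R (x - y) \<bullet> \<zeta>)"
        by (simp add: inner_diff_right inner_diff_left inner_commute algebra_simps)
      moreover have "h n *\<^sub>R (0 + inverse (h n) *\<^sub>R \<zeta>) = \<zeta>" using h[of n] by simp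
      ultimately show "unit_exp ((0 + inverse (h n) *\<^sub>R \<zeta>) \<bullet> (y - x)) * of_real (gaussian (h n *\<^sub>R (0 + inverse (h n) *\<^sub>R \<zeta>)))
        = unit_exp (- (inverse (h n) *\<^sub>R (x - y) \<bullet> \<zeta>)) * of_real (gaussian \<zeta>)" by (simp only:)
    qed
    finally show ?thesis using h[of n] by (simp add: fourier_gaussian scaleR_conv_of_real)
  qed
  have mollified: "(\<integral>\<zeta>. unit_exp (\<zeta> \<bullet> y) * fourier f \<zeta> * of_real (gaussian (h n *\<^sub>R \<zeta>)) \<partial>lborel)
      = (\<integral>v. f (y + h n *\<^sub>R v) * of_real (gaussian v) \<partial>lborel)" for n
  proof -
    have g: "integrable lborel (\<lambda>\<zeta>::'a. gaussian (h n *\<^sub>R \<zeta>))"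
      using integrable_gaussian[where 'a='a] h[of n] lborel_integral_affine(2)[of "h n" "gaussian :: 'a \<Rightarrow> real" 0] by simp
    have "(\<integral>\<zeta>. unit_exp (\<zeta> \<bullet> y) * fourier f \<zeta> * of_real (gaussian (h n *\<^sub>R \<zeta>)) \<partial>lborel)
       = (\<integral>\<zeta>. \<integral>x. unit_exp (\<zeta> \<bullet> (y - x)) * of_real (gaussian (h n *\<^sub>R \<zeta>)) * f x \<partial>lborel \<partial>lborel)"
    proof (intro Bochner_Integration.integral_cong refl)
      fix \<zeta> :: 'a
      have "unit_exp (\<zeta> \<bullet> y) * fourier f \<zeta> * of_real (gaussian (h n *\<^sub>R \<zeta>)) =
         (\<integral>x. (unit_exp (\<zeta> \<bullet> y) * of_real (gaussian (h n *\<^sub>R \<zeta>))) * (unit_exp (- (\<zeta> \<bullet> x)) * f x) \<partial>lborel)"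
        unfolding fourier_eq by simp
      also have "\<dots> = (\<integral>x. unit_exp (\<zeta> \<bullet> (y - x)) * of_real (gaussian (h n *\<^sub>R \<zeta>)) * f x \<partial>lborel)"
        by (intro Bochner_Integration.integral_cong refl)
           (simp add: inner_diff_right unit_exp_diff)
      finally show "unit_exp (\<zeta> \<bullet> y) * fourier f \<zeta> * of_real (gaussian (h n *\<^sub>R \<zeta>)) = \<dots>" .
    qed
    also have "\<dots> = (\<integral>x. \<integral>\<zeta>. unit_exp (\<zeta> \<bullet> (y - x)) * of_real (gaussian (h n *\<^sub>R \<zeta>)) * f x \<partial>lborel \<partial>lborel)"
      by (rule fubini_dominated(2)[OF _ g integrable_norm[OF f]])
         (auto simp: norm_mult gaussian_def)
    also have "\<dots> = (\<integral>x. of_real (inverse (h n) ^ DIM('a) * gaussian (inverse (h n) *\<^sub>R (x - y))) * f x \<partial>lborel)"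
      by (simp add: kernel)
    also have "\<dots> = \<bar>h n\<bar> ^ DIM('a) *\<^sub>R (\<integral>v. of_real (inverse (h n) ^ DIM('a) * gaussian (inverse (h n) *\<^sub>R ((y + h n *\<^sub>R v) - y))) * f (y + h n *\<^sub>R v) \<partial>lborel)"
      using h[of n] by (intro lborel_integral_affine(1)[of "h n"]) auto
    also have "\<dots> = (\<integral>v. of_real (h n ^ DIM('a)) * (of_real (inverse (h n) ^ DIM('a)) * of_real (gaussian v) * f (y + h n *\<^sub>R v)) \<partial>lborel)"
      using h[of n] by (simp add: scaleR_conv_of_real)
    also have "\<dots> = (\<integral>v. f (y + h n *\<^sub>R v) * of_real (gaussian v) \<partial>lborel)"
    proof (intro Bochner_Integration.integral_cong refl)
      fix v :: 'a
      have "complex_of_real (h n ^ DIM('a)) * of_real (inverse (h n) ^ DIM('a)) = 1"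
        using h[of n] by (simp add: power_mult_distrib[symmetric])
      then show "of_real (h n ^ DIM('a)) * (of_real (inverse (h n) ^ DIM('a)) * of_real (gaussian v) * f (y + h n *\<^sub>R v)) = f (y + h n *\<^sub>R v) * of_real (gaussian v)"
        by (metis mult.assoc mult.commute mult_1)
    qed
    finally show ?thesis .
  qed
  have "(\<lambda>n. \<integral>v. f (y + h n *\<^sub>R v) * of_real (gaussian v) \<partial>lborel) \<longlonglongrightarrow> (\<integral>v. f y * of_real (gaussian v) \<partial>(lborel :: 'a measure))"
  proof (rule integral_dominated_convergence[where w="\<lambda>v::'a. B * gaussian v"])
    show "integrable lborel (\<lambda>v::'a. B * gaussian v)" by (intro integrable_mult_right integrable_gaussian)
    show "AE v in lborel. (\<lambda>n. f (y + h n *\<^sub>R v) * of_real (gaussian v)) \<longlonglongrightarrow> f y * of_real (gaussian v)"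
    proof (intro AE_I2 tendsto_mult_right)
      fix v :: 'a
      have "(\<lambda>n. y + h n *\<^sub>R v) \<longlonglongrightarrow> y + 0 *\<^sub>R v" by (intro tendsto_intros h0)
      then show "(\<lambda>n. f (y + h n *\<^sub>R v)) \<longlonglongrightarrow> f y"
        using cont by (intro isCont_tendsto_compose[of _ f]) (auto simp: continuous_on_eq_continuous_at)
    qed
    show "AE v in lborel. norm (f (y + h n *\<^sub>R v) * of_real (gaussian v)) \<le> B * gaussian v" for n
      using bound by (auto simp: norm_mult gaussian_def intro!: mult_right_mono)
  qed measurable
  moreover have "(\<integral>v. f y * of_real (gaussian v) \<partial>(lborel :: 'a measure)) = f y"
    by (simp add: integral_of_real integral_gaussian)
  moreover have "(\<lambda>n. \<integral>\<zeta>. unit_exp (\<zeta> \<bullet> y) * fourier f \<zeta> * of_real (gaussian (h n *\<^sub>R \<zeta>)) \<partial>lborel)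
     \<longlonglongrightarrow> (\<integral>\<zeta>. unit_exp (\<zeta> \<bullet> y) * fourier f \<zeta> \<partial>lborel)"
  proof (rule integral_dominated_convergence[where w="\<lambda>\<zeta>. norm (fourier f \<zeta>)"])
    show "AE \<zeta> in lborel. (\<lambda>n. unit_exp (\<zeta> \<bullet> y) * fourier f \<zeta> * of_real (gaussian (h n *\<^sub>R \<zeta>))) \<longlonglongrightarrow> unit_exp (\<zeta> \<bullet> y) * fourier f \<zeta>"
    proof (rule AE_I2)
      fix \<zeta> :: 'a
      have "(\<lambda>n. unit_exp (\<zeta> \<bullet> y) * fourier f \<zeta> * of_real (gaussian (h n *\<^sub>R \<zeta>))) \<longlonglongrightarrow> unit_exp (\<zeta> \<bullet> y) * fourier f \<zeta> * of_real (exp (- (pi * (norm (0 *\<^sub>R \<zeta>))\<^sup>2)))"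
        unfolding gaussian_def by (intro tendsto_intros h0)
      then show "(\<lambda>n. unit_exp (\<zeta> \<bullet> y) * fourier f \<zeta> * of_real (gaussian (h n *\<^sub>R \<zeta>))) \<longlonglongrightarrow> unit_exp (\<zeta> \<bullet> y) * fourier f \<zeta>" by simp
    qed
    show "AE \<zeta> in lborel. norm (unit_exp (\<zeta> \<bullet> y) * fourier f \<zeta> * of_real (gaussian (h n *\<^sub>R \<zeta>))) \<le> norm (fourier f \<zeta>)" for n
      by (auto simp: norm_mult gaussian_def intro!: mult_left_le)
  qed (use fhat in auto)
  ultimately show ?thesis unfolding mollified using LIMSEQ_unique by fastforce
qed

section \<open>Schwartz functions\<close>

lemma iter_deriv_append: "iter_deriv (bs @ [b]) f = iter_deriv bs (iter_deriv [b] f)"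
  by (induction bs) auto

lemma schwartz_deriv:
  assumes "schwartz f" "b \<in> Basis"
  shows "schwartz (iter_deriv [b] f)"
  unfolding schwartz_def
proof
  fix bs :: "'a list" assume "bs \<in> lists Basis"
  then have "bs @ [b] \<in> lists Basis" using assms(2) by auto
  then show "(\<forall>x. iter_deriv bs (iter_deriv [b] f) differentiable (at x)) \<and>
      (\<forall>k. \<exists>C. \<forall>x. (1 + norm x) ^ k * norm (iter_deriv bs (iter_deriv [b] f) x) \<le> C)"
    using assms(1) unfolding schwartz_def iter_deriv_append[symmetric] by blast
qed

lemma schwartz_differentiable: "schwartz f \<Longrightarrow> f differentiable (at x)"
  unfolding schwartz_def by (metis iter_deriv.simps(1) lists.Nil)

lemma schwartz_decay: "schwartz f \<Longrightarrow> \<exists>C. \<forall>x. (1 + norm x) ^ k * norm (f x) \<le> C"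
  unfolding schwartz_def by (metis iter_deriv.simps(1) lists.Nil)

lemma schwartz_continuous: "schwartz f \<Longrightarrow> continuous_on UNIV f"
  by (intro continuous_at_imp_continuous_on ballI differentiable_imp_continuous_within schwartz_differentiable)

lemma schwartz_measurable: "schwartz f \<Longrightarrow> f \<in> borel_measurable borel"
  by (intro borel_measurable_continuous_onI schwartz_continuous)

lemma schwartz_integrable: "schwartz f \<Longrightarrow> integrable lborel f"
  using schwartz_decay[of f "2 * DIM('a)"] integrable_of_decay[of f] schwartz_measurable[of f] by blast

lemma schwartz_bounded: "schwartz f \<Longrightarrow> \<exists>B. \<forall>x. norm (f x) \<le> B"
  using schwartz_decay[of f 0] by simp

lemma schwartz_has_directional_derivative:
  fixes f :: "'a::euclidean_space \<Rightarrow> complex"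
  assumes "schwartz f"
  shows "((\<lambda>t. f (x + t *\<^sub>R b)) has_vector_derivative iter_deriv [b] f (x + t *\<^sub>R b)) (at t)"
proof -
  let ?D = "frechet_derivative f (at (x + t *\<^sub>R b))"
  have D: "(f has_derivative ?D) (at (x + t *\<^sub>R b))"
    using schwartz_differentiable[OF assms] by (simp add: frechet_derivative_works[symmetric])
  have "((\<lambda>t. x + t *\<^sub>R b) has_derivative (\<lambda>r. r *\<^sub>R b)) (at t)"
    by (auto intro!: derivative_eq_intros)
  from has_derivative_compose[where f="\<lambda>t. x + t *\<^sub>R b" and g=f and g'="?D", OF this D]
  have "((\<lambda>t. f (x + t *\<^sub>R b)) has_derivative (\<lambda>r. ?D (r *\<^sub>R b))) (at t)" .
  moreover have "?D (r *\<^sub>R b) = r *\<^sub>R ?D b" for r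
    using has_derivative_linear[OF D] by (rule linear_scale)
  ultimately show ?thesis by (simp add: has_vector_derivative_def)
qed

lemma has_vector_derivative_tendsto_quotient:
  assumes "(f has_vector_derivative D) (at 0)"
  shows "((\<lambda>t. (f t - f 0) /\<^sub>R t) \<longlongrightarrow> D) (at 0)"
proof (rule Lim_null[THEN iffD2], rule tendsto_norm_zero_iff[THEN iffD1], rule Lim_transform_eventually)
  show "((\<lambda>t. norm (f t - f 0 - t *\<^sub>R D) / norm t) \<longlongrightarrow> 0) (at 0)"
    using assms by (simp add: has_vector_derivative_def has_derivative_iff_norm)
  have "norm (f t - f 0 - t *\<^sub>R D) / norm t = norm ((f t - f 0) /\<^sub>R t - D)" if "t \<noteq> 0" for t
  proof -
    have "(f t - f 0) /\<^sub>R t - D = (f t - f 0 - t *\<^sub>R D) /\<^sub>R t"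
      using that by (simp add: scaleR_diff_right)
    then show ?thesis by (simp add: divide_inverse mult.commute)
  qed
  then show "\<forall>\<^sub>F t in at 0. norm (f t - f 0 - t *\<^sub>R D) / norm t = norm ((f t - f 0) /\<^sub>R t - D)"
    by (simp add: eventually_at_filter)
qed

text \<open>A difference quotient inherits the decay of the derivative, since the base point moves by at most 1
  and \<open>1 + \<bar>x\<bar>\<close> changes by at most a factor 2. This bound dominates the difference
  quotients in \<open>fourier_deriv\<close>.\<close>

lemma schwartz_increment:
  fixes f :: "'a::euclidean_space \<Rightarrow> complex"
  assumes f: "schwartz f" and b: "b \<in> Basis" and h: "0 < h" "h \<le> 1"
    and C: "\<And>x. (1 + norm x) ^ N * norm (iter_deriv [b] f x) \<le> C"
  shows "norm (f (x + h *\<^sub>R b) - f x) \<le> h * (2 ^ N * C / (1 + norm x) ^ N)"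
proof -
  note d = schwartz_has_directional_derivative[OF f, of x b, unfolded has_vector_derivative_def]
  have "\<exists>t\<in>{0<..<h}. norm (f (x + h *\<^sub>R b) - f (x + 0 *\<^sub>R b)) \<le> norm ((h - 0) *\<^sub>R iter_deriv [b] f (x + t *\<^sub>R b))"
    using h by (intro mvt_general[where f="\<lambda>t. f (x + t *\<^sub>R b)"] d has_derivative_continuous_on[OF has_derivative_at_withinI[OF d]]) auto
  then obtain t where t: "0 < t" "t < h"
    and le: "norm (f (x + h *\<^sub>R b) - f x) \<le> h * norm (iter_deriv [b] f (x + t *\<^sub>R b))"
    using h by auto
  note le
  also have "norm (iter_deriv [b] f (x + t *\<^sub>R b)) \<le> 2 ^ N * C / (1 + norm x) ^ N"
  proof -
    have "norm x \<le> norm (x + t *\<^sub>R b) + norm (t *\<^sub>R b)"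
      using norm_triangle_ineq4[of "x + t *\<^sub>R b" "t *\<^sub>R b"] by simp
    moreover have "norm (t *\<^sub>R b) \<le> 1" using t h b by simp
    ultimately have "1 + norm x \<le> 2 + 2 * norm (x + t *\<^sub>R b)"
      using norm_ge_zero[of "x + t *\<^sub>R b"] by linarith
    then have "1 + norm x \<le> 2 * (1 + norm (x + t *\<^sub>R b))" by simp
    then have "(1 + norm x) ^ N \<le> (2 * (1 + norm (x + t *\<^sub>R b))) ^ N"
      by (intro power_mono) auto
    then have "(1 + norm x) ^ N * norm (iter_deriv [b] f (x + t *\<^sub>R b))
        \<le> (2 * (1 + norm (x + t *\<^sub>R b))) ^ N * norm (iter_deriv [b] f (x + t *\<^sub>R b))"
      by (intro mult_right_mono) auto
    also have "\<dots> = 2 ^ N * ((1 + norm (x + t *\<^sub>R b)) ^ N * norm (iter_deriv [b] f (x + t *\<^sub>R b)))"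
      by (simp only: power_mult_distrib mult.assoc)
    also have "\<dots> \<le> 2 ^ N * C" by (intro mult_left_mono C) auto
    finally show ?thesis by (subst pos_le_divide_eq) (auto simp: mult.commute add_pos_nonneg)
  qed
  finally show ?thesis using h by simp
qed

lemma fourier_translate:
  assumes [measurable]: "f \<in> borel_measurable borel"
  shows "fourier (\<lambda>x. f (x + h)) \<zeta> = unit_exp (\<zeta> \<bullet> h) * fourier f \<zeta>"
proof -
  have "fourier f \<zeta> = (\<integral>x. unit_exp (- (\<zeta> \<bullet> (h + 1 *\<^sub>R x))) * f (h + 1 *\<^sub>R x) \<partial>lborel)"
    unfolding fourier_eq by (subst lborel_integral_affine(1)[of 1 _ h]) auto
  also have "\<dots> = (\<integral>x. unit_exp (- (\<zeta> \<bullet> h)) * (unit_exp (- (\<zeta> \<bullet> x)) * f (x + h)) \<partial>lborel)"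
    by (simp add: inner_add_right unit_exp_diff add.commute mult_ac)
  also have "\<dots> = unit_exp (- (\<zeta> \<bullet> h)) * fourier (\<lambda>x. f (x + h)) \<zeta>"
    by (simp add: fourier_eq)
  finally have "unit_exp (\<zeta> \<bullet> h) * fourier f \<zeta> = (unit_exp (\<zeta> \<bullet> h) * unit_exp (- (\<zeta> \<bullet> h))) * fourier (\<lambda>x. f (x + h)) \<zeta>"
    by simp
  then show ?thesis by (simp add: unit_exp_diff[symmetric])
qed

text \<open>Translation invariance gives the transform of a difference quotient exactly, as a difference quotient
  of \<open>unit_exp\<close> times the transform of \<open>f\<close>. The limit replaces an integration by parts, and works in
  every Euclidean space without slicing it.\<close>

lemma fourier_deriv:
  fixes f :: "'a::euclidean_space \<Rightarrow> complex"
  assumes f: "schwartz f" and b: "b \<in> Basis"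
  shows "fourier (iter_deriv [b] f) \<zeta> = 2 * of_real pi * \<i> * of_real (\<zeta> \<bullet> b) * fourier f \<zeta>"
proof -
  define h where "h n = 1 / real (Suc n)" for n
  have h: "0 < h n" "h n \<le> 1" for n by (simp_all add: h_def)
  have h0: "h \<longlonglongrightarrow> 0" unfolding h_def by (rule LIMSEQ_Suc[OF lim_1_over_n])
  have h_at: "filterlim (\<lambda>n. h n) (at 0) sequentially"
    using h0 h by (auto simp: filterlim_at intro!: eventuallyI less_imp_neq[symmetric])
  have [measurable]: "f \<in> borel_measurable borel" "iter_deriv [b] f \<in> borel_measurable borel"
    using schwartz_measurable f schwartz_deriv[OF f b] by blast+
  obtain C where C: "\<And>x. (1 + norm x) ^ (2 * DIM('a)) * norm (iter_deriv [b] f x) \<le> C"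
    using schwartz_decay[OF schwartz_deriv[OF f b]] by blast
  define w where "w x = 2 ^ (2 * DIM('a)) * C * decay_weight x" for x :: 'a
  have "(\<lambda>n. \<integral>x. unit_exp (- (\<zeta> \<bullet> x)) * ((f (x + h n *\<^sub>R b) - f x) /\<^sub>R h n) \<partial>lborel)
      \<longlonglongrightarrow> (\<integral>x. unit_exp (- (\<zeta> \<bullet> x)) * iter_deriv [b] f x \<partial>lborel)"
  proof (rule integral_dominated_convergence[where w=w])
    show "integrable lborel w" unfolding w_def by (intro integrable_mult_right integrable_decay_weight)
    show "AE x in lborel. (\<lambda>n. unit_exp (- (\<zeta> \<bullet> x)) * ((f (x + h n *\<^sub>R b) - f x) /\<^sub>R h n)) \<longlonglongrightarrow> unit_exp (- (\<zeta> \<bullet> x)) * iter_deriv [b] f x"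
    proof (intro AE_I2 tendsto_mult_left)
      fix x :: 'a
      have "((\<lambda>t. (f (x + t *\<^sub>R b) - f x) /\<^sub>R t) \<longlongrightarrow> iter_deriv [b] f x) (at 0)"
        using schwartz_has_directional_derivative[OF f, of x b 0]
        by (auto dest: has_vector_derivative_tendsto_quotient)
      from filterlim_compose[OF this h_at]
      show "(\<lambda>n. (f (x + h n *\<^sub>R b) - f x) /\<^sub>R h n) \<longlonglongrightarrow> iter_deriv [b] f x" by simp
    qed
    show "AE x in lborel. norm (unit_exp (- (\<zeta> \<bullet> x)) * ((f (x + h n *\<^sub>R b) - f x) /\<^sub>R h n)) \<le> w x" for n
    proof (rule AE_I2)
      fix x :: 'a
      have "norm (f (x + h n *\<^sub>R b) - f x) \<le> h n * w x"
        using schwartz_increment[OF f b h C] by (simp add: w_def decay_weight_def)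
      then show "norm (unit_exp (- (\<zeta> \<bullet> x)) * ((f (x + h n *\<^sub>R b) - f x) /\<^sub>R h n)) \<le> w x"
        using h[of n] by (simp add: norm_mult inverse_eq_divide divide_le_eq mult.commute)
    qed
  qed measurable
  moreover have "(\<integral>x. unit_exp (- (\<zeta> \<bullet> x)) * ((f (x + h n *\<^sub>R b) - f x) /\<^sub>R h n) \<partial>lborel)
     = ((unit_exp (h n * (\<zeta> \<bullet> b)) - 1) / of_real (h n)) * fourier f \<zeta>" for n
  proof -
    have i: "integrable lborel (\<lambda>x. unit_exp (- (\<zeta> \<bullet> x)) * f x)"
      by (intro integrable_unit_exp_mult schwartz_integrable f) auto
    have i': "integrable lborel (\<lambda>x. unit_exp (- (\<zeta> \<bullet> x)) * f (x + h n *\<^sub>R b))"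
      using lborel_integral_affine(2)[of 1 f "h n *\<^sub>R b"] schwartz_integrable[OF f]
      by (intro integrable_unit_exp_mult) (auto simp: add.commute)
    have "(\<integral>x. unit_exp (- (\<zeta> \<bullet> x)) * ((f (x + h n *\<^sub>R b) - f x) /\<^sub>R h n) \<partial>lborel)
      = (\<integral>x. (unit_exp (- (\<zeta> \<bullet> x)) * f (x + h n *\<^sub>R b) - unit_exp (- (\<zeta> \<bullet> x)) * f x) /\<^sub>R h n \<partial>lborel)"
      by (simp add: algebra_simps)
    also have "\<dots> = (fourier (\<lambda>x. f (x + h n *\<^sub>R b)) \<zeta> - fourier f \<zeta>) /\<^sub>R h n"
      unfolding integral_scaleR_right fourier_eq Bochner_Integration.integral_diff[OF i' i] ..
    also have "\<dots> = ((unit_exp (h n * (\<zeta> \<bullet> b)) - 1) / of_real (h n)) * fourier f \<zeta>"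
      by (subst fourier_translate) (simp_all add: scaleR_conv_of_real field_simps)
    finally show ?thesis .
  qed
  moreover have "(\<lambda>n. ((unit_exp (h n * (\<zeta> \<bullet> b)) - 1) / of_real (h n)) * fourier f \<zeta>)
     \<longlonglongrightarrow> 2 * of_real pi * \<i> * of_real (\<zeta> \<bullet> b) * fourier f \<zeta>"
  proof (rule tendsto_mult_right)
    let ?c = "2 * of_real pi * \<i> * of_real (\<zeta> \<bullet> b)"
    have "((\<lambda>z. exp (?c * z)) has_field_derivative ?c) (at 0)"
      by (auto intro!: derivative_eq_intros)
    then have lim: "((\<lambda>z. (exp (?c * z) - 1) / z) \<longlongrightarrow> ?c) (at 0)"
      by (simp add: has_field_derivative_iff)
    have "filterlim (\<lambda>n. complex_of_real (h n)) (at 0) sequentially"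
      using tendsto_of_real[OF h0, where 'a=complex] h by (auto simp: filterlim_at intro!: eventuallyI less_imp_neq[symmetric])
    from filterlim_compose[OF lim this]
    show "(\<lambda>n. (unit_exp (h n * (\<zeta> \<bullet> b)) - 1) / of_real (h n)) \<longlonglongrightarrow> ?c"
      by (simp add: unit_exp_def mult_ac)
  qed
  ultimately show ?thesis unfolding fourier_eq[of "iter_deriv [b] f"] using LIMSEQ_unique by fastforce
qed

text \<open>Each factor \<open>\<bar>\<zeta> \<bullet> b\<bar>\<close> is paid for by one derivative, and \<open>\<bar>\<zeta>\<bar>\<close> is at most the sum of these factors.\<close>

theorem fourier_schwartz_decay:
  fixes f :: "'a::euclidean_space \<Rightarrow> complex"
  assumes "schwartz f"
  shows "\<exists>C. \<forall>\<zeta>. (1 + norm \<zeta>) ^ N * norm (fourier f \<zeta>) \<le> C"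
  using assms
proof (induction N arbitrary: f)
  case 0
  then show ?case using norm_fourier_le[of f] by auto
next
  case (Suc N)
  obtain C0 where C0: "\<And>\<zeta>. (1 + norm \<zeta>) ^ N * norm (fourier f \<zeta>) \<le> C0" using Suc by blast
  have "\<exists>C. \<forall>b\<in>Basis. \<forall>\<zeta>. (1 + norm \<zeta>) ^ N * norm (fourier (iter_deriv [b] f) \<zeta>) \<le> C b"
    using Suc.IH[OF schwartz_deriv[OF Suc.prems]] by metis
  then obtain C where C: "\<And>b \<zeta>. b \<in> Basis \<Longrightarrow> (1 + norm \<zeta>) ^ N * norm (fourier (iter_deriv [b] f) \<zeta>) \<le> C b"
    by blast
  have "(1 + norm \<zeta>) ^ Suc N * norm (fourier f \<zeta>) \<le> C0 + (\<Sum>b\<in>Basis. C b)" for \<zeta> :: 'a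
  proof -
    have "norm \<zeta> \<le> (\<Sum>b\<in>Basis. \<bar>\<zeta> \<bullet> b\<bar>)" by (rule norm_le_l1)
    then have "(1 + norm \<zeta>) ^ Suc N * norm (fourier f \<zeta>)
      \<le> (1 + (\<Sum>b\<in>Basis. \<bar>\<zeta> \<bullet> b\<bar>)) * ((1 + norm \<zeta>) ^ N * norm (fourier f \<zeta>))"
      unfolding power_Suc mult.assoc by (intro mult_right_mono) auto
    also have "\<dots> = (1 + norm \<zeta>) ^ N * norm (fourier f \<zeta>) + (\<Sum>b\<in>Basis. \<bar>\<zeta> \<bullet> b\<bar> * ((1 + norm \<zeta>) ^ N * norm (fourier f \<zeta>)))"
      by (simp add: distrib_right sum_distrib_right)
    also have "\<dots> \<le> C0 + (\<Sum>b\<in>Basis. C b)"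
    proof (intro add_mono C0 sum_mono)
      fix b :: 'a assume b: "b \<in> Basis"
      have "\<bar>\<zeta> \<bullet> b\<bar> * ((1 + norm \<zeta>) ^ N * norm (fourier f \<zeta>)) \<le> (2 * pi * \<bar>\<zeta> \<bullet> b\<bar>) * ((1 + norm \<zeta>) ^ N * norm (fourier f \<zeta>))"
        using pi_ge_two by (intro mult_right_mono) (auto simp: mult_le_cancel_right1)
      also have "\<dots> = (1 + norm \<zeta>) ^ N * norm (fourier (iter_deriv [b] f) \<zeta>)"
        unfolding fourier_deriv[OF Suc.prems b] by (simp add: norm_mult)
      also have "\<dots> \<le> C b" by (rule C[OF b])
      finally show "\<bar>\<zeta> \<bullet> b\<bar> * ((1 + norm \<zeta>) ^ N * norm (fourier f \<zeta>)) \<le> C b" .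
    qed
    finally show ?thesis .
  qed
  then show ?case by blast
qed

lemma fourier_schwartz_integrable: "schwartz f \<Longrightarrow> integrable lborel (fourier f)"
  using fourier_schwartz_decay[of f "2 * DIM('a)"] integrable_of_decay[of "fourier f"]
    measurable_fourier[OF schwartz_integrable] by blast

lemma schwartz_fourier_inversion:
  assumes "schwartz f"
  shows "(\<integral>\<zeta>. unit_exp (\<zeta> \<bullet> y) * fourier f \<zeta> \<partial>lborel) = f y"
proof -
  obtain B where "\<And>x. norm (f x) \<le> B" using schwartz_bounded[OF assms] by blast
  then show ?thesis
    by (intro fourier_inversion schwartz_integrable schwartz_continuous fourier_schwartz_integrable assms)
qed

section \<open>The fractional power as an oscillatory integral\<close>

text \<open>The parameter is complex because the operator needs \<open>w = \<i> p\<close>, while the integral is evaluated for \<open>Re w > 0\<close>.\<close>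

definition frac_kernel :: "real \<Rightarrow> complex \<Rightarrow> real \<Rightarrow> complex" where
  "frac_kernel s w \<sigma> = indicator {0<..} \<sigma> *\<^sub>R ((exp (- (w * of_real \<sigma>)) - 1) / of_real (\<sigma> powr (1 + s)))"

definition frac_weight :: "real \<Rightarrow> real \<Rightarrow> real" where
  "frac_weight s \<sigma> = indicator {0<..} \<sigma> * (min 1 \<sigma> / \<sigma> powr (1 + s))"

lemma measurable_frac_kernel [measurable]: "frac_kernel s w \<in> borel_measurable borel"
  unfolding frac_kernel_def[abs_def] by measurable

lemma measurable_frac_weight [measurable]: "frac_weight s \<in> borel_measurable borel"
  unfolding frac_weight_def[abs_def] by measurable

lemma lborel_integrable_of_nonneg_HK:
  fixes f :: "real \<Rightarrow> real"
  assumes "f integrable_on A" "\<And>x. x \<in> A \<Longrightarrow> f x \<ge> 0"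
    and [measurable]: "f \<in> borel_measurable borel" "A \<in> sets borel"
  shows "integrable lborel (\<lambda>x. indicator A x * f x)"
proof -
  have "integrable lebesgue (\<lambda>x. indicator A x * f x)"
    using nonnegative_absolutely_integrable_1[OF assms(1,2)] by (simp add: set_integrable_def)
  then show ?thesis by (subst (asm) integrable_completion) auto
qed

lemma integrable_frac_weight:
  assumes s: "0 < s" "s < 1"
  shows "integrable lborel (frac_weight s)"
proof (rule Bochner_Integration.integrable_bound)
  have "integrable lborel (\<lambda>\<sigma>::real. indicator {0..1} \<sigma> * \<sigma> powr (- s))"
    using s integrable_on_powr_from_0[of "- s" 1] by (intro lborel_integrable_of_nonneg_HK) auto
  moreover have "integrable lborel (\<lambda>\<sigma>::real. indicator {1..} \<sigma> * \<sigma> powr (- (1 + s)))"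
  proof (rule lborel_integrable_of_nonneg_HK)
    show "(\<lambda>\<sigma>::real. \<sigma> powr (- (1 + s))) integrable_on {1..}"
      using s has_integral_powr_to_inf[of "- (1 + s)" 1] unfolding integrable_on_def by auto
  qed auto
  ultimately show "integrable lborel (\<lambda>\<sigma>::real. indicator {0..1} \<sigma> * \<sigma> powr (- s) + indicator {1..} \<sigma> * \<sigma> powr (- (1 + s)))"
    by (rule Bochner_Integration.integrable_add)
  show "AE \<sigma> in lborel. norm (frac_weight s \<sigma>) \<le> norm (indicator {0..1} \<sigma> * \<sigma> powr (- s) + indicator {1..} \<sigma> * \<sigma> powr (- (1 + s)))"
  proof (rule AE_I2)
    fix \<sigma> :: real
    have "\<sigma> / \<sigma> powr (1 + s) = \<sigma> powr (- s)" if "\<sigma> > 0"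
      using that by (simp add: powr_add powr_minus field_simps)
    moreover have "1 / \<sigma> powr (1 + s) = \<sigma> powr (- (1 + s))"
      by (simp only: powr_minus inverse_eq_divide)
    ultimately show "norm (frac_weight s \<sigma>) \<le> norm (indicator {0..1} \<sigma> * \<sigma> powr (- s) + indicator {1..} \<sigma> * \<sigma> powr (- (1 + s)))"
      by (auto simp: frac_weight_def indicator_def min_def)
  qed
qed measurable

lemma norm_exp_diff_le:
  fixes a b :: complex
  assumes "Re a \<le> c" "Re b \<le> c"
  shows "norm (exp a - exp b) \<le> exp c * norm (a - b)"
proof (rule field_differentiable_bound[where S="{z. Re z \<le> c}" and f'=exp])
  show "convex {z. Re z \<le> c}" by (rule convex_halfspace_Re_le)
  show "norm (exp z) \<le> exp c" if "z \<in> {z. Re z \<le> c}" for z :: complex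
    using that by (simp add: norm_exp_eq_Re)
qed (use assms in \<open>auto intro: DERIV_exp DERIV_subset\<close>)

lemma norm_frac_kernel_le:
  assumes "Re w \<ge> 0"
  shows "norm (frac_kernel s w \<sigma>) \<le> (2 + norm w) * frac_weight s \<sigma>"
proof (cases "\<sigma> > 0")
  case True
  have re: "Re (- (w * of_real \<sigma>)) \<le> 0" using assms True by simp
  have "norm (exp (- (w * of_real \<sigma>)) - 1) \<le> norm w * \<sigma>"
    using norm_exp_diff_le[OF re, of 0] True by (simp add: norm_mult)
  moreover have "norm (exp (- (w * of_real \<sigma>)) - 1) \<le> 2 + norm w"
  proof -
    have "norm (exp (- (w * of_real \<sigma>)) - 1) \<le> norm (exp (- (w * of_real \<sigma>))) + norm (1::complex)"
      by (rule norm_triangle_ineq4)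
    also have "norm (exp (- (w * of_real \<sigma>))) \<le> 1" using re by (simp add: norm_exp_eq_Re)
    finally have "norm (exp (- (w * of_real \<sigma>)) - 1) \<le> 2" by simp
    then show ?thesis using norm_ge_zero[of w] by linarith
  qed
  ultimately have "norm (exp (- (w * of_real \<sigma>)) - 1) \<le> (2 + norm w) * min 1 \<sigma>"
    using True by (auto simp: min_def algebra_simps)
  then show ?thesis using True
    by (simp add: frac_kernel_def frac_weight_def norm_divide divide_right_mono)
qed (simp add: frac_kernel_def frac_weight_def)

lemma integrable_frac_kernel:
  assumes s: "0 < s" "s < 1" and w: "Re w \<ge> 0"
  shows "integrable lborel (frac_kernel s w)"
proof (rule Bochner_Integration.integrable_bound)
  show "integrable lborel (\<lambda>\<sigma>. (2 + norm w) * frac_weight s \<sigma>)"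
    by (intro integrable_mult_right integrable_frac_weight s)
  show "AE \<sigma> in lborel. norm (frac_kernel s w \<sigma>) \<le> norm ((2 + norm w) * frac_weight s \<sigma>)"
    by (intro AE_I2 order_trans[OF norm_frac_kernel_le[OF w]]) simp
qed measurable

definition frac_integral :: "real \<Rightarrow> complex \<Rightarrow> complex" where
  "frac_integral s w = (\<integral>\<sigma>. frac_kernel s w \<sigma> \<partial>lborel)"

text \<open>Minus the derivative of \<open>frac_kernel\<close> in \<open>w\<close>.\<close>

definition gamma_kernel :: "real \<Rightarrow> complex \<Rightarrow> real \<Rightarrow> complex" where
  "gamma_kernel s w \<sigma> = indicator {0<..} \<sigma> *\<^sub>R (of_real (\<sigma> powr (- s)) * exp (- (w * of_real \<sigma>)))"

lemma measurable_gamma_kernel [measurable]: "gamma_kernel s w \<in> borel_measurable borel"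
  unfolding gamma_kernel_def[abs_def] by measurable

lemma gamma_kernel_1:
  assumes s: "s < 1"
  shows "(\<integral>\<sigma>. gamma_kernel s 1 \<sigma> \<partial>lborel) = of_real (Gamma (1 - s))"
proof -
  let ?g = "\<lambda>t::real. indicator {0..} t * t powr (1 - s - 1) / exp t"
  have "ennreal (Gamma (1 - s)) = (\<integral>\<^sup>+t. ennreal (?g t) \<partial>lborel)"
    using s by (intro Gamma_conv_nn_integral_real) auto
  then have "(\<integral>t. ?g t \<partial>lborel) = Gamma (1 - s)"
    using s by (intro integral_eq_nn_integral[THEN trans]) (auto intro!: Gamma_real_nonneg)
  moreover have "gamma_kernel s 1 t = of_real (?g t)" for t
    by (cases "t = 0") (auto simp: gamma_kernel_def indicator_def exp_minus exp_of_real[symmetric] field_simps)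
  ultimately show ?thesis by (simp only: integral_complex_of_real)
qed

lemma integrable_gamma_kernel_real:
  assumes s: "s < 1" and r: "r > 0"
  shows "integrable lborel (\<lambda>\<sigma>::real. indicator {0<..} \<sigma> * (\<sigma> powr (- s) * exp (- (r * \<sigma>))))"
proof -
  have "(\<lambda>t. complex_of_real t powr (of_real (1 - s) - 1) / of_real (exp (r * t))) absolutely_integrable_on {0<..}"
    using s r by (intro absolutely_integrable_Gamma_integral) auto
  then have "integrable lebesgue (\<lambda>t. norm (indicator {0<..} t *\<^sub>R (complex_of_real t powr (of_real (1 - s) - 1) / of_real (exp (r * t)))))"
    unfolding set_integrable_def by (rule integrable_norm)
  also have "(\<lambda>t. norm (indicator {0<..} t *\<^sub>R (complex_of_real t powr (of_real (1 - s) - 1) / of_real (exp (r * t)))))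
     = (\<lambda>\<sigma>::real. indicator {0<..} \<sigma> * (\<sigma> powr (- s) * exp (- (r * \<sigma>))))"
    by (auto simp: indicator_def norm_divide norm_powr_real_powr exp_minus field_simps)
  finally show ?thesis by (subst (asm) integrable_completion) auto
qed

text \<open>Differentiation under the integral. Near \<open>w\<close> the difference quotients are dominated with the decay
  rate \<open>r = Re w / 2\<close>, which is why the limit is taken within a ball.\<close>

lemma has_field_derivative_frac_integral:
  assumes s: "0 < s" "s < 1" and w: "Re w > 0"
  shows "(frac_integral s has_field_derivative - (\<integral>\<sigma>. gamma_kernel s w \<sigma> \<partial>lborel)) (at w)"
proof -
  define r where "r = Re w / 2"
  have r: "r > 0" using w by (simp add: r_def)
  have ball: "Re v \<ge> r" if "v \<in> ball w r" for v
    using that abs_Re_le_cmod[of "w - v"] by (simp add: dist_norm r_def abs_le_iff)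
  have "((\<lambda>v. (frac_integral s v - frac_integral s w) / (v - w)) \<longlongrightarrow> - (\<integral>\<sigma>. gamma_kernel s w \<sigma> \<partial>lborel)) (at w within ball w r)"
    unfolding tendsto_at_iff_sequentially
  proof (intro allI impI)
    fix X :: "nat \<Rightarrow> complex" assume X: "\<forall>i. X i \<in> ball w r - {w}" and lim: "X \<longlonglongrightarrow> w"
    have Xr: "Re (X i) \<ge> r" "X i \<noteq> w" for i using X ball by auto
    have "(\<lambda>i. \<integral>\<sigma>. (frac_kernel s (X i) \<sigma> - frac_kernel s w \<sigma>) / (X i - w) \<partial>lborel) \<longlonglongrightarrow> (\<integral>\<sigma>. - gamma_kernel s w \<sigma> \<partial>lborel)"
    proof (rule integral_dominated_convergence[where w="\<lambda>\<sigma>. indicator {0<..} \<sigma> * (\<sigma> powr (- s) * exp (- (r * \<sigma>)))"])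
      show "integrable lborel (\<lambda>\<sigma>::real. indicator {0<..} \<sigma> * (\<sigma> powr (- s) * exp (- (r * \<sigma>))))"
        by (rule integrable_gamma_kernel_real) fact+
      show "AE \<sigma> in lborel. (\<lambda>i. (frac_kernel s (X i) \<sigma> - frac_kernel s w \<sigma>) / (X i - w)) \<longlonglongrightarrow> - gamma_kernel s w \<sigma>"
      proof (rule AE_I2)
        fix \<sigma> :: real
        show "(\<lambda>i. (frac_kernel s (X i) \<sigma> - frac_kernel s w \<sigma>) / (X i - w)) \<longlonglongrightarrow> - gamma_kernel s w \<sigma>"
        proof (cases "\<sigma> > 0")
          case True
          have "((\<lambda>v. exp (- (v * of_real \<sigma>))) has_field_derivative - of_real \<sigma> * exp (- (w * of_real \<sigma>))) (at w)"
            by (auto intro!: derivative_eq_intros)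
          then have "((\<lambda>v. (exp (- (v * of_real \<sigma>)) - exp (- (w * of_real \<sigma>))) / (v - w)) \<longlongrightarrow> - of_real \<sigma> * exp (- (w * of_real \<sigma>))) (at w)"
            by (simp add: has_field_derivative_iff)
          moreover have "filterlim X (at w) sequentially"
            using lim Xr by (auto simp: filterlim_at)
          ultimately have "(\<lambda>i. (exp (- (X i * of_real \<sigma>)) - exp (- (w * of_real \<sigma>))) / (X i - w)) \<longlonglongrightarrow> - of_real \<sigma> * exp (- (w * of_real \<sigma>))"
            by (rule filterlim_compose)
          then have "(\<lambda>i. (exp (- (X i * of_real \<sigma>)) - exp (- (w * of_real \<sigma>))) / (X i - w) / of_real (\<sigma> powr (1 + s))) \<longlonglongrightarrow> (- of_real \<sigma> * exp (- (w * of_real \<sigma>))) / of_real (\<sigma> powr (1 + s))"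
            using True by (intro tendsto_divide tendsto_const) auto
          moreover have "(exp (- (X i * of_real \<sigma>)) - exp (- (w * of_real \<sigma>))) / (X i - w) / of_real (\<sigma> powr (1 + s)) = (frac_kernel s (X i) \<sigma> - frac_kernel s w \<sigma>) / (X i - w)" for i
            using True by (simp add: frac_kernel_def diff_divide_distrib mult.commute)
          moreover have "(- of_real \<sigma> * exp (- (w * of_real \<sigma>))) / of_real (\<sigma> powr (1 + s)) = - gamma_kernel s w \<sigma>"
            using True by (simp add: gamma_kernel_def powr_add powr_minus field_simps)
          ultimately show ?thesis by simp
        qed (simp add: frac_kernel_def gamma_kernel_def)
      qed
      show "AE \<sigma> in lborel. norm ((frac_kernel s (X i) \<sigma> - frac_kernel s w \<sigma>) / (X i - w)) \<le> indicator {0<..} \<sigma> * (\<sigma> powr (- s) * exp (- (r * \<sigma>)))" for i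
      proof (rule AE_I2)
        fix \<sigma> :: real
        show "norm ((frac_kernel s (X i) \<sigma> - frac_kernel s w \<sigma>) / (X i - w)) \<le> indicator {0<..} \<sigma> * (\<sigma> powr (- s) * exp (- (r * \<sigma>)))"
        proof (cases "\<sigma> > 0")
          case True
          have "norm (exp (- (X i * of_real \<sigma>)) - exp (- (w * of_real \<sigma>))) \<le> exp (- (r * \<sigma>)) * norm (- (X i * of_real \<sigma>) - - (w * of_real \<sigma>))"
            using True Xr[of i] r by (intro norm_exp_diff_le) (auto simp: r_def)
          also have "- (X i * of_real \<sigma>) - - (w * of_real \<sigma>) = - ((X i - w) * of_real \<sigma>)" by (simp add: algebra_simps)
          also have "norm (- ((X i - w) * of_real \<sigma>)) = \<sigma> * norm (X i - w)"
            using True by (simp only: norm_minus_cancel norm_mult norm_of_real abs_of_pos mult.commute)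
          also have "exp (- (r * \<sigma>)) * (\<sigma> * norm (X i - w)) = exp (- (r * \<sigma>)) * \<sigma> * norm (X i - w)" by simp
          finally have le: "norm (exp (- (X i * of_real \<sigma>)) - exp (- (w * of_real \<sigma>))) / norm (X i - w) \<le> exp (- (r * \<sigma>)) * \<sigma>"
            using Xr[of i] by (subst pos_divide_le_eq) auto
          have "norm ((frac_kernel s (X i) \<sigma> - frac_kernel s w \<sigma>) / (X i - w)) = norm (exp (- (X i * of_real \<sigma>)) - exp (- (w * of_real \<sigma>))) / norm (X i - w) / \<sigma> powr (1 + s)"
            using True by (simp add: frac_kernel_def diff_divide_distrib[symmetric] norm_divide norm_mult mult.commute)
          also have "\<dots> \<le> exp (- (r * \<sigma>)) * \<sigma> / \<sigma> powr (1 + s)"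
            by (intro divide_right_mono le) auto
          also have "\<dots> = indicator {0<..} \<sigma> * (\<sigma> powr (- s) * exp (- (r * \<sigma>)))"
            using True by (simp add: powr_add powr_minus field_simps)
          finally show ?thesis .
        qed (simp add: frac_kernel_def)
      qed
    qed measurable
    moreover have "(\<integral>\<sigma>. (frac_kernel s (X i) \<sigma> - frac_kernel s w \<sigma>) / (X i - w) \<partial>lborel) = (frac_integral s (X i) - frac_integral s w) / (X i - w)" for i
      using w Xr(1)[of i] r unfolding frac_integral_def
      by (simp add: integrable_frac_kernel s)
    ultimately have "(\<lambda>i. (frac_integral s (X i) - frac_integral s w) / (X i - w)) \<longlonglongrightarrow> (\<integral>\<sigma>. - gamma_kernel s w \<sigma> \<partial>lborel)"
      by (simp only:)
    then show "((\<lambda>v. (frac_integral s v - frac_integral s w) / (v - w)) \<circ> X) \<longlonglongrightarrow> - (\<integral>\<sigma>. gamma_kernel s w \<sigma> \<partial>lborel)"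
      by (simp add: o_def)
  qed
  then show ?thesis
    using r by (simp add: has_field_derivative_iff at_within_open[of w "ball w r"])
qed

lemma frac_integral_scale:
  assumes t: "t > 0"
  shows "frac_integral s (of_real t * w) = of_real (t powr s) * frac_integral s w"
proof -
  have k: "frac_kernel s (of_real t * w) (0 + 1 / t * \<sigma>) = of_real (t powr (1 + s)) * frac_kernel s w \<sigma>" for \<sigma>
    using t by (cases "\<sigma> > 0") (simp_all add: frac_kernel_def indicator_def powr_divide zero_less_divide_iff field_simps)
  have "frac_integral s (of_real t * w) = \<bar>1 / t\<bar> *\<^sub>R (\<integral>\<sigma>. frac_kernel s (of_real t * w) (0 + 1 / t * \<sigma>) \<partial>lborel)"
    unfolding frac_integral_def using t by (intro lborel_integral_real_affine) auto
  also have "\<dots> = of_real (t powr s) * frac_integral s w"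
    unfolding k using t by (simp add: frac_integral_def scaleR_conv_of_real powr_add)
  finally show ?thesis .
qed

text \<open>Euler's identity for the homogeneity of degree \<open>s\<close>: up to sign, both sides are the derivative
  of the integral along the ray through \<open>w\<close>.\<close>

lemma frac_integral_euler:
  assumes s: "0 < s" "s < 1" and w: "Re w > 0"
  shows "w * (\<integral>\<sigma>. gamma_kernel s w \<sigma> \<partial>lborel) = - (of_real s * frac_integral s w)"
proof -
  let ?D = "- (\<integral>\<sigma>. gamma_kernel s w \<sigma> \<partial>lborel)"
  have "((\<lambda>t. of_real t * w) has_vector_derivative w) (at 1)"
    by (auto intro!: derivative_eq_intros simp: has_vector_derivative_def scaleR_conv_of_real)
  moreover have "(frac_integral s has_field_derivative ?D) (at (of_real 1 * w))"
    using has_field_derivative_frac_integral[OF s w] by simp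
  ultimately have 1: "(frac_integral s \<circ> (\<lambda>t. of_real t * w) has_vector_derivative w * ?D) (at 1)"
    by (rule field_vector_diff_chain_at)
  have "((\<lambda>t. t powr s) has_real_derivative s * 1 powr (s - 1)) (at 1)"
    by (rule has_real_derivative_powr) simp
  then have "((\<lambda>t. of_real (t powr s) * frac_integral s w) has_vector_derivative of_real s * frac_integral s w) (at 1)"
    by (intro has_vector_derivative_mult_left has_vector_derivative_of_real)
       (simp add: has_real_derivative_iff_has_vector_derivative)
  then have "(frac_integral s \<circ> (\<lambda>t. of_real t * w) has_vector_derivative of_real s * frac_integral s w) (at 1)"
    by (rule has_vector_derivative_transform_within_open[where S="{0<..}"]) (auto simp: frac_integral_scale)
  from vector_derivative_unique_at[OF 1 this] show ?thesis by (simp add: minus_equation_iff)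
qed

text \<open>By Euler's identity the quotient by \<open>w powr s\<close> has derivative zero; at \<open>w = 1\<close> Euler's identity
  itself evaluates it, because there the derivative is minus the integral for \<open>\<Gamma>(1 - s)\<close>.\<close>

lemma frac_integral_right_half_plane:
  assumes s: "0 < s" "s < 1" and w: "Re w > 0"
  shows "frac_integral s w = - of_real (Gamma (1 - s) / s) * w powr of_real s"
proof -
  have "\<exists>c. \<forall>v\<in>{v. Re v > 0}. frac_integral s v * v powr (- of_real s) = c"
  proof (rule has_field_derivative_zero_constant)
    show "convex {v. Re v > 0}" by (rule convex_halfspace_Re_gt)
    fix v :: complex assume "v \<in> {v. Re v > 0}"
    then have v: "Re v > 0" "v \<noteq> 0" "v \<notin> \<real>\<^sub>\<le>\<^sub>0" by (auto simp: complex_nonpos_Reals_iff)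
    have "((\<lambda>v. frac_integral s v * v powr (- of_real s)) has_field_derivative
        - (\<integral>\<sigma>. gamma_kernel s v \<sigma> \<partial>lborel) * v powr (- of_real s) + - of_real s * v powr (- of_real s - 1) * frac_integral s v) (at v)"
      using v by (intro DERIV_mult has_field_derivative_frac_integral s has_field_derivative_powr) auto
    also have "- (\<integral>\<sigma>. gamma_kernel s v \<sigma> \<partial>lborel) * v powr (- of_real s) + - of_real s * v powr (- of_real s - 1) * frac_integral s v
       = - (v powr (- of_real s - 1)) * (v * (\<integral>\<sigma>. gamma_kernel s v \<sigma> \<partial>lborel) + of_real s * frac_integral s v)"
    proof -
      have "v powr (- of_real s) = v powr (- of_real s - 1) * v" using v by (simp add: powr_diff)
      then show ?thesis by (simp add: algebra_simps)
    qed
    also have "\<dots> = 0" using frac_integral_euler[OF s v(1)] by simp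
    finally show "((\<lambda>v. frac_integral s v * v powr (- of_real s)) has_field_derivative 0) (at v within {v. Re v > 0})"
      by (rule has_field_derivative_at_within)
  qed
  then obtain c where c: "\<And>v. Re v > 0 \<Longrightarrow> frac_integral s v * v powr (- of_real s) = c" by auto
  have "of_real s * frac_integral s 1 = - of_real (Gamma (1 - s))"
    using frac_integral_euler[OF s, of 1] s by (simp add: gamma_kernel_1)
  then have "frac_integral s 1 = - of_real (Gamma (1 - s) / s)" using s by (simp add: field_simps)
  with c[of 1] c[OF w] have "frac_integral s w * w powr (- of_real s) = - of_real (Gamma (1 - s) / s)" by simp
  then have "frac_integral s w * (w powr (- of_real s) * w powr of_real s) = - of_real (Gamma (1 - s) / s) * w powr of_real s"
    by (simp only: mult.assoc[symmetric])
  moreover have "w powr (- of_real s) * w powr of_real s = 1"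
    using w by (auto simp: powr_add[symmetric])
  ultimately show ?thesis by simp
qed

text \<open>The boundary value from \<open>Re w > 0\<close>, where both sides are continuous.\<close>

theorem frac_integral_imaginary:
  assumes s: "0 < s" "s < 1"
  shows "frac_integral s (\<i> * of_real p) = - of_real (Gamma (1 - s) / s) * (\<i> * of_real p) powr of_real s"
proof (cases "p = 0")
  case True
  then show ?thesis by (simp add: frac_integral_def frac_kernel_def[abs_def])
next
  case False
  \<comment> \<open>The imaginary axis is approached from the right half-plane.\<close>
  define w where "w n = of_real (1 / real (Suc n)) + \<i> * of_real p" for n
  have Re: "Re (w n) > 0" for n by (simp add: w_def)
  have w: "w \<longlonglongrightarrow> of_real 0 + \<i> * of_real p"
    unfolding w_def by (intro tendsto_intros LIMSEQ_Suc[OF lim_1_over_n])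
  have "(\<lambda>n. frac_integral s (w n)) \<longlonglongrightarrow> frac_integral s (\<i> * of_real p)"
    unfolding frac_integral_def
  proof (rule integral_dominated_convergence[where w="\<lambda>\<sigma>. (3 + \<bar>p\<bar>) * frac_weight s \<sigma>"])
    show "integrable lborel (\<lambda>\<sigma>. (3 + \<bar>p\<bar>) * frac_weight s \<sigma>)"
      by (intro integrable_mult_right integrable_frac_weight s)
    show "AE \<sigma> in lborel. (\<lambda>n. frac_kernel s (w n) \<sigma>) \<longlonglongrightarrow> frac_kernel s (\<i> * of_real p) \<sigma>"
    proof (rule AE_I2)
      fix \<sigma> :: real
      show "(\<lambda>n. frac_kernel s (w n) \<sigma>) \<longlonglongrightarrow> frac_kernel s (\<i> * of_real p) \<sigma>"
        using w unfolding frac_kernel_def by (cases "\<sigma> > 0") (auto intro!: tendsto_intros)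
    qed
    show "AE \<sigma> in lborel. norm (frac_kernel s (w n) \<sigma>) \<le> (3 + \<bar>p\<bar>) * frac_weight s \<sigma>" for n
    proof (rule AE_I2)
      fix \<sigma> :: real
      have "norm (w n) \<le> norm (complex_of_real (1 / real (Suc n))) + norm (\<i> * of_real p)"
        unfolding w_def by (rule norm_triangle_ineq)
      also have "norm (complex_of_real (1 / real (Suc n))) \<le> 1" by (simp only: norm_of_real) simp
      also have "norm (\<i> * of_real p) = \<bar>p\<bar>" by (simp add: norm_mult)
      finally have "norm (w n) \<le> 1 + \<bar>p\<bar>" by simp
      then have "(2 + norm (w n)) * frac_weight s \<sigma> \<le> (3 + \<bar>p\<bar>) * frac_weight s \<sigma>"
        by (intro mult_right_mono) (auto simp: frac_weight_def indicator_def)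
      then show "norm (frac_kernel s (w n) \<sigma>) \<le> (3 + \<bar>p\<bar>) * frac_weight s \<sigma>"
        using norm_frac_kernel_le[of "w n" s \<sigma>] Re[of n] by linarith
    qed
  qed measurable
  moreover have "(\<lambda>n. frac_integral s (w n)) \<longlonglongrightarrow> - of_real (Gamma (1 - s) / s) * (of_real 0 + \<i> * of_real p) powr of_real s"
    unfolding frac_integral_right_half_plane[OF s Re]
    using False by (intro tendsto_intros tendsto_powr_complex w) (auto simp: complex_nonpos_Reals_iff)
  ultimately show ?thesis using LIMSEQ_unique by fastforce
qed

section \<open>The multiplier of the fractional Schroedinger operator\<close>

lemma tensor_decay:
  fixes f :: "'a::euclidean_space \<times> 'b::euclidean_space \<Rightarrow> complex"
  assumes "\<And>N. \<exists>C. \<forall>z. (1 + norm z) ^ N * norm (f z) \<le> C"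
  shows "\<exists>C. \<forall>x y. norm (f (x, y)) \<le> C * decay_weight x * decay_weight y"
proof -
  obtain C where C: "\<And>z. (1 + norm z) ^ (2 * DIM('a) + 2 * DIM('b)) * norm (f z) \<le> C"
    using assms by blast
  have "norm (f (x, y)) \<le> C * decay_weight x * decay_weight y" for x y
  proof -
    have "(1 + norm x) ^ (2 * DIM('a)) * (1 + norm y) ^ (2 * DIM('b))
        \<le> (1 + norm (x, y)) ^ (2 * DIM('a)) * (1 + norm (x, y)) ^ (2 * DIM('b))"
      using norm_fst_le[of x y] norm_snd_le[of y x] by (intro mult_mono power_mono) auto
    then have "(1 + norm x) ^ (2 * DIM('a)) * (1 + norm y) ^ (2 * DIM('b)) * norm (f (x, y))
        \<le> (1 + norm (x, y)) ^ (2 * DIM('a) + 2 * DIM('b)) * norm (f (x, y))"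
      unfolding power_add by (rule mult_right_mono) simp
    also have "\<dots> \<le> C" by (rule C)
    finally have "norm (f (x, y)) \<le> C / ((1 + norm x) ^ (2 * DIM('a)) * (1 + norm y) ^ (2 * DIM('b)))"
      by (subst pos_le_divide_eq) (auto simp: mult.commute add_pos_nonneg)
    then show ?thesis by (simp add: decay_weight_def)
  qed
  then show ?thesis by blast
qed

text \<open>Inversion in the second variable alone: the partial transform in the first variable is an integrable
  continuous function of \<open>t\<close> whose transform is the full one.\<close>

lemma fourier_slice_inversion:
  fixes u :: "'a::euclidean_space \<times> 'b::euclidean_space \<Rightarrow> complex"
  assumes u: "schwartz u"
  shows "fourier (\<lambda>y. u (y, t)) \<xi> = (\<integral>\<tau>. unit_exp (\<tau> \<bullet> t) * fourier u (\<xi>, \<tau>) \<partial>lborel)"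
proof -
  obtain C where C: "\<And>y t. norm (u (y, t)) \<le> C * decay_weight y * decay_weight t"
    using tensor_decay[OF schwartz_decay[OF u]] by blast
  obtain C' where C': "\<And>\<xi> \<tau>. norm (fourier u (\<xi>, \<tau>)) \<le> C' * decay_weight \<xi> * decay_weight \<tau>"
    using tensor_decay[OF fourier_schwartz_decay[OF u]] by blast
  have [measurable]: "u \<in> borel_measurable borel" "fourier u \<in> borel_measurable borel"
    using schwartz_measurable[OF u] measurable_fourier[OF schwartz_integrable[OF u]] by auto
  have cont: "isCont u z" for z
    using schwartz_continuous[OF u] by (cases z) (simp add: continuous_on_eq_continuous_at)
  define g where "g t = fourier (\<lambda>y. u (y, t)) \<xi>" for t
  define K where "K = C * (\<integral>y. decay_weight (y :: 'a) \<partial>lborel)"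
  have C0: "C \<ge> 0"
  proof -
    have "0 \<le> C * (decay_weight (0::'a) * decay_weight (0::'b))"
      using order_trans[OF norm_ge_zero C[of 0 0]] by (simp add: mult.assoc)
    moreover have "0 < decay_weight (0::'a) * decay_weight (0::'b)"
      by (intro mult_pos_pos decay_weight_bounds)
    ultimately show ?thesis by (simp add: zero_le_mult_iff)
  qed
  have int: "integrable lborel (\<lambda>y::'a. C * decay_weight y * decay_weight (t :: 'b))" for t
    by (intro integrable_mult_left integrable_mult_right integrable_decay_weight)
  have g_le: "norm (g t) \<le> K * decay_weight t" for t
  proof -
    have "norm (g t) \<le> (\<integral>y. norm (u (y, t)) \<partial>lborel)" unfolding g_def by (rule norm_fourier_le)
    also have "\<dots> \<le> (\<integral>y. C * decay_weight y * decay_weight t \<partial>(lborel :: 'a measure))"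
    proof (rule Bochner_Integration.integral_mono[OF _ int C])
      show "integrable lborel (\<lambda>y. norm (u (y, t)))"
        by (rule Bochner_Integration.integrable_bound[OF int[of t]])
           (auto intro!: AE_I2 order_trans[OF C])
    qed
    also have "\<dots> = K * decay_weight t" by (simp add: K_def)
    finally show ?thesis .
  qed
  have g_cont: "continuous_on UNIV g"
    unfolding continuous_on_eq_continuous_at[OF open_UNIV] continuous_at_sequentially
  proof (intro ballI allI impI)
    fix t :: 'b and X :: "nat \<Rightarrow> 'b" assume X: "X \<longlonglongrightarrow> t"
    show "(g \<circ> X) \<longlonglongrightarrow> g t"
      unfolding o_def g_def fourier_eq
    proof (rule integral_dominated_convergence[where w="\<lambda>y. C * decay_weight y"])
      show "integrable lborel (\<lambda>y::'a. C * decay_weight y)"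
        by (intro integrable_mult_right integrable_decay_weight)
      show "AE y in lborel. (\<lambda>i. unit_exp (- (\<xi> \<bullet> y)) * u (y, X i)) \<longlonglongrightarrow> unit_exp (- (\<xi> \<bullet> y)) * u (y, t)"
        by (intro AE_I2 tendsto_mult_left isCont_tendsto_compose[OF cont] tendsto_Pair tendsto_const X)
      show "AE y in lborel. norm (unit_exp (- (\<xi> \<bullet> y)) * u (y, X i)) \<le> C * decay_weight y" for i
      proof (rule AE_I2)
        fix y :: 'a
        have "C * decay_weight y * decay_weight (X i) \<le> C * decay_weight y * 1"
          using C0 decay_weight_bounds by (intro mult_left_mono mult_nonneg_nonneg) (auto intro: less_imp_le)
        then show "norm (unit_exp (- (\<xi> \<bullet> y)) * u (y, X i)) \<le> C * decay_weight y"
          using C[of y "X i"] by (simp add: norm_mult)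
      qed
    qed measurable
  qed
  then have [measurable]: "g \<in> borel_measurable borel" by (rule borel_measurable_continuous_onI)
  have g_int: "integrable lborel g"
    by (rule Bochner_Integration.integrable_bound[where f="\<lambda>t. K * decay_weight t"])
       (auto intro!: AE_I2 integrable_mult_right integrable_decay_weight order_trans[OF g_le])
  have g_hat: "fourier g \<tau> = fourier u (\<xi>, \<tau>)" for \<tau>
  proof -
    have i: "integrable (lborel \<Otimes>\<^sub>M lborel) (\<lambda>(y, t). unit_exp (- (\<xi> \<bullet> y + \<tau> \<bullet> t)) * u (y, t))"
    proof (rule fubini_dominated(1)[where f="\<lambda>y. C * decay_weight y" and g=decay_weight])
      show "(\<lambda>(y, t). unit_exp (- (\<xi> \<bullet> y + \<tau> \<bullet> t)) * u (y, t)) \<in> borel_measurable (lborel \<Otimes>\<^sub>M lborel)"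
      proof -
        have "(\<lambda>z. unit_exp (- (\<xi> \<bullet> fst z + \<tau> \<bullet> snd z))) \<in> borel_measurable borel"
          by (intro borel_measurable_continuous_onI continuous_intros)
        then have "(\<lambda>z. unit_exp (- (\<xi> \<bullet> fst z + \<tau> \<bullet> snd z)) * u z) \<in> borel_measurable borel"
          by measurable
        then show ?thesis unfolding lborel_prod by (simp add: case_prod_beta')
      qed
    qed (auto intro!: integrable_mult_right integrable_decay_weight simp: norm_mult C)
    have "fourier u (\<xi>, \<tau>) = (\<integral>z. (case z of (y, t) \<Rightarrow> unit_exp (- (\<xi> \<bullet> y + \<tau> \<bullet> t)) * u (y, t)) \<partial>(lborel \<Otimes>\<^sub>M lborel))"
      unfolding fourier_eq lborel_prod by (intro Bochner_Integration.integral_cong refl) (auto simp: inner_prod_def)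
    also have "\<dots> = (\<integral>t. \<integral>y. unit_exp (- (\<xi> \<bullet> y + \<tau> \<bullet> t)) * u (y, t) \<partial>lborel \<partial>lborel)"
      using lborel_pair.integral_snd[OF i] by simp
    also have "\<dots> = (\<integral>t. \<integral>y. unit_exp (- (\<tau> \<bullet> t)) * (unit_exp (- (\<xi> \<bullet> y)) * u (y, t)) \<partial>lborel \<partial>lborel)"
      by (simp add: unit_exp_add[symmetric] mult.assoc[symmetric] add.commute)
    also have "\<dots> = fourier g \<tau>" unfolding fourier_eq[of g] g_def fourier_eq by simp
    finally show ?thesis by simp
  qed
  have "integrable lborel (fourier g)"
    unfolding g_hat[abs_def]
    by (rule Bochner_Integration.integrable_bound[where f="\<lambda>\<tau>. C' * decay_weight \<xi> * decay_weight \<tau>"])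
       (auto intro!: AE_I2 integrable_mult_right integrable_decay_weight order_trans[OF C'])
  moreover have "norm (g t) \<le> K" for t
  proof -
    have "K \<ge> 0" unfolding K_def
      by (intro mult_nonneg_nonneg C0 Bochner_Integration.integral_nonneg less_imp_le decay_weight_bounds)
    then have "K * decay_weight t \<le> K * 1" using decay_weight_bounds by (intro mult_left_mono)
    then show ?thesis using g_le[of t] by simp
  qed
  ultimately have "(\<integral>\<tau>. unit_exp (\<tau> \<bullet> t) * fourier g \<tau> \<partial>lborel) = g t"
    by (intro fourier_inversion g_int g_cont)
  then show ?thesis by (simp add: g_hat g_def)
qed

abbreviation full_symb :: "(real ^ 'n) \<times> real \<Rightarrow> real" where
  "full_symb \<zeta> \<equiv> symb (fst \<zeta>) (snd \<zeta>)"

lemma continuous_full_symb: "continuous_on A (full_symb :: (real ^ 'n) \<times> real \<Rightarrow> real)"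
  unfolding symb_def by (intro continuous_intros)

lemma measurable_full_symb [measurable]: "(full_symb :: (real ^ 'n) \<times> real \<Rightarrow> real) \<in> borel_measurable borel"
  by (intro borel_measurable_continuous_onI continuous_full_symb)

lemma full_symb_bound: "2 + \<bar>full_symb \<zeta>\<bar> \<le> (2 + 2 * pi + 4 * pi\<^sup>2) * (1 + norm \<zeta>)\<^sup>2"
proof -
  have 1: "norm (fst \<zeta>) \<le> norm \<zeta>" "\<bar>snd \<zeta>\<bar> \<le> norm \<zeta>"
    using norm_fst_le[of "fst \<zeta>" "snd \<zeta>"] norm_snd_le[of "snd \<zeta>" "fst \<zeta>"] by simp_all
  have sq: "(1 + norm \<zeta>)\<^sup>2 = 1 + 2 * norm \<zeta> + (norm \<zeta>)\<^sup>2" by (simp add: power2_sum)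
  have 2: "(norm (fst \<zeta>))\<^sup>2 \<le> (1 + norm \<zeta>)\<^sup>2" using 1 by (intro power_mono) auto
  have 3: "\<bar>snd \<zeta>\<bar> \<le> (1 + norm \<zeta>)\<^sup>2"
    using 1(2) norm_ge_zero[of \<zeta>] zero_le_power2[of "norm \<zeta>"] unfolding sq by linarith
  have 4: "1 \<le> (1 + norm \<zeta>)\<^sup>2" by (intro one_le_power) simp
  have "\<bar>full_symb \<zeta>\<bar> \<le> 2 * pi * \<bar>snd \<zeta>\<bar> + 4 * pi\<^sup>2 * (norm (fst \<zeta>))\<^sup>2"
    unfolding symb_def by (rule order_trans[OF abs_triangle_ineq]) (simp add: abs_mult)
  also have "\<dots> \<le> 2 * pi * (1 + norm \<zeta>)\<^sup>2 + 4 * pi\<^sup>2 * (1 + norm \<zeta>)\<^sup>2"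
    using 2 3 by (intro add_mono mult_left_mono) auto
  finally show ?thesis using 4 unfolding distrib_right by linarith
qed

lemma integrable_symb_fourier:
  fixes u :: "(real ^ 'n) \<times> real \<Rightarrow> complex"
  assumes u: "schwartz u"
  shows "integrable lborel (\<lambda>\<zeta>. (2 + \<bar>full_symb \<zeta>\<bar>) * norm (fourier u \<zeta>))"
proof -
  let ?D = "DIM((real ^ 'n) \<times> real)" and ?K = "2 + 2 * pi + 4 * pi\<^sup>2"
  have [measurable]: "fourier u \<in> borel_measurable borel"
    using measurable_fourier[OF schwartz_integrable[OF u]] by auto
  obtain C where C: "\<And>\<zeta>. (1 + norm \<zeta>) ^ (2 * ?D + 2) * norm (fourier u \<zeta>) \<le> C"
    using fourier_schwartz_decay[OF u] by blast
  show ?thesis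
  proof (rule integrable_of_decay)
    show "(\<lambda>\<zeta>. (2 + \<bar>full_symb \<zeta>\<bar>) * norm (fourier u \<zeta>)) \<in> borel_measurable borel" by measurable
    fix \<zeta> :: "(real ^ 'n) \<times> real"
    have K0: "?K \<ge> 0" by (simp add: add_nonneg_nonneg)
    have "(1 + norm \<zeta>) ^ (2 * ?D) * norm ((2 + \<bar>full_symb \<zeta>\<bar>) * norm (fourier u \<zeta>))
       = (1 + norm \<zeta>) ^ (2 * ?D) * ((2 + \<bar>full_symb \<zeta>\<bar>) * norm (fourier u \<zeta>))"
      by (simp add: abs_mult)
    also have "\<dots> \<le> (1 + norm \<zeta>) ^ (2 * ?D) * ((?K * (1 + norm \<zeta>)\<^sup>2) * norm (fourier u \<zeta>))"
      by (intro mult_left_mono mult_right_mono full_symb_bound) auto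
    also have "\<dots> = ?K * ((1 + norm \<zeta>) ^ (2 * ?D + 2) * norm (fourier u \<zeta>))"
      by (simp only: power_add mult_ac)
    also have "\<dots> \<le> ?K * C" by (intro mult_left_mono C K0)
    finally show "(1 + norm \<zeta>) ^ (2 * ?D) * norm ((2 + \<bar>full_symb \<zeta>\<bar>) * norm (fourier u \<zeta>)) \<le> ?K * C" .
  qed
qed

text \<open>The Schroedinger group contributes \<open>exp (- \<i> \<sigma> 4 \<pi>\<^sup>2 \<bar>\<xi>\<bar>\<^sup>2)\<close> and the time shift contributes
  \<open>exp (- \<i> \<sigma> 2 \<pi> \<tau>)\<close>; their product is \<open>exp (- \<i> \<sigma> p)\<close>.\<close>

lemma evolutive_group_fourier:
  fixes u :: "(real ^ 'n) \<times> real \<Rightarrow> complex"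
  assumes u: "schwartz u"
  shows "evolutive_group \<sigma> u y =
    (\<integral>\<zeta>. unit_exp (\<zeta> \<bullet> y) * exp (- (\<i> * of_real (full_symb \<zeta>) * of_real \<sigma>)) * fourier u \<zeta> \<partial>lborel)"
proof -
  obtain x t where y: "y = (x, t)" by (cases y)
  define E where "E \<xi> \<tau> = unit_exp (\<xi> \<bullet> x + \<tau> * t) * exp (- (\<i> * of_real (symb \<xi> \<tau>) * of_real \<sigma>))" for \<xi> :: "real ^ 'n" and \<tau>
  have fi: "integrable lborel (fourier u)" by (rule fourier_schwartz_integrable[OF u])
  have [measurable]: "fourier u \<in> borel_measurable borel" using fi by auto
  have E: "exp (2 * of_real pi * \<i> * of_real (\<xi> \<bullet> x)) * exp (- (\<i> * of_real (\<sigma> * (4 * pi\<^sup>2 * (norm \<xi>)\<^sup>2)))) * unit_exp (\<tau> \<bullet> (t - \<sigma>)) = E \<xi> \<tau>" for \<xi> \<tau>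
    unfolding E_def unit_exp_def symb_def exp_add[symmetric]
    by (rule arg_cong[of _ _ exp]) (simp add: algebra_simps)
  have nE: "norm (E \<xi> \<tau>) = 1" for \<xi> \<tau>
    by (simp add: E_def norm_mult norm_exp_eq_Re)
  have i: "integrable (lborel \<Otimes>\<^sub>M lborel) (\<lambda>(\<xi>, \<tau>). E \<xi> \<tau> * fourier u (\<xi>, \<tau>))"
    unfolding lborel_prod
  proof (rule Bochner_Integration.integrable_bound[OF fi])
    have "(\<lambda>\<zeta>. E (fst \<zeta>) (snd \<zeta>)) \<in> borel_measurable borel"
      unfolding E_def by (intro borel_measurable_continuous_onI continuous_intros continuous_full_symb)
    then have "(\<lambda>\<zeta>. E (fst \<zeta>) (snd \<zeta>) * fourier u \<zeta>) \<in> borel_measurable borel"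
      by measurable
    then show "(\<lambda>(\<xi>, \<tau>). E \<xi> \<tau> * fourier u (\<xi>, \<tau>)) \<in> borel_measurable lborel"
      by (simp add: case_prod_beta')
  qed (auto simp: norm_mult nE)
  have "evolutive_group \<sigma> u y = (\<integral>\<xi>. \<integral>\<tau>. E \<xi> \<tau> * fourier u (\<xi>, \<tau>) \<partial>lborel \<partial>lborel)"
    unfolding evolutive_group_def schroedinger_group_def y fourier_slice_inversion[OF u] split
    by (simp only: integral_mult_right_zero[symmetric] mult.assoc E[symmetric])
  also have "\<dots> = (\<integral>z. (case z of (\<xi>, \<tau>) \<Rightarrow> E \<xi> \<tau> * fourier u (\<xi>, \<tau>)) \<partial>(lborel \<Otimes>\<^sub>M lborel))"
    using lborel_pair.integral_fst[OF i] by simp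
  also have "\<dots> = (\<integral>\<zeta>. unit_exp (\<zeta> \<bullet> y) * exp (- (\<i> * of_real (full_symb \<zeta>) * of_real \<sigma>)) * fourier u \<zeta> \<partial>lborel)"
    unfolding lborel_prod
    by (intro Bochner_Integration.integral_cong refl) (auto simp: E_def y inner_prod_def)
  finally show ?thesis .
qed

lemma norm_powr_of_real: "norm (w powr of_real s) = norm w powr s" for w :: complex
  by (cases "w = 0") (simp_all add: powr_def norm_exp_eq_Re)

definition frac_symb_fourier :: "real \<Rightarrow> ((real ^ 'n) \<times> real \<Rightarrow> complex) \<Rightarrow> (real ^ 'n) \<times> real \<Rightarrow> complex" where
  "frac_symb_fourier s u \<zeta> = (\<i> * of_real (full_symb \<zeta>)) powr of_real s * fourier u \<zeta>"

lemma continuous_frac_symb_fourier: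
  assumes s: "0 < s" and u: "schwartz u"
  shows "continuous_on UNIV (frac_symb_fourier s u)"
  unfolding frac_symb_fourier_def
proof (intro continuous_on_mult)
  show "continuous_on UNIV (fourier u)"
    by (intro continuous_at_imp_continuous_on ballI isCont_fourier schwartz_integrable u)
  show "continuous_on UNIV (\<lambda>\<zeta>. (\<i> * of_real (full_symb \<zeta>)) powr of_real s)"
    using s by (intro continuous_on_powr_complex continuous_intros continuous_full_symb) auto
qed

lemma integrable_frac_symb_fourier:
  fixes u :: "(real ^ 'n) \<times> real \<Rightarrow> complex"
  assumes s: "0 < s" "s < 1" and u: "schwartz u"
  shows "integrable lborel (frac_symb_fourier s u)"
proof (rule Bochner_Integration.integrable_bound[OF integrable_symb_fourier[OF u]])
  show "frac_symb_fourier s u \<in> borel_measurable lborel"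
    using borel_measurable_continuous_onI[OF continuous_frac_symb_fourier[OF s(1) u]] by simp
  show "AE \<zeta> in lborel. norm (frac_symb_fourier s u \<zeta>) \<le> norm ((2 + \<bar>full_symb \<zeta>\<bar>) * norm (fourier u \<zeta>))"
  proof (rule AE_I2)
    fix \<zeta> :: "(real ^ 'n) \<times> real"
    have "\<bar>full_symb \<zeta>\<bar> powr s \<le> (1 + \<bar>full_symb \<zeta>\<bar>) powr s" using s by (intro powr_mono2) auto
    also have "\<dots> \<le> (1 + \<bar>full_symb \<zeta>\<bar>) powr 1" using s by (intro powr_mono) auto
    finally have "\<bar>full_symb \<zeta>\<bar> powr s \<le> 2 + \<bar>full_symb \<zeta>\<bar>" by simp
    then show "norm (frac_symb_fourier s u \<zeta>) \<le> norm ((2 + \<bar>full_symb \<zeta>\<bar>) * norm (fourier u \<zeta>))"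
      by (simp add: frac_symb_fourier_def norm_mult norm_powr_of_real mult_right_mono)
  qed
qed

text \<open>The integral over \<open>\<sigma>\<close> is moved inside the inversion integral. The bound by \<open>2 + \<bar>p\<bar>\<close> times an
  integrable function of \<open>\<sigma>\<close> allows this, as the transform of \<open>u\<close> beats the quadratic growth of \<open>p\<close>.\<close>

lemma frac_schroedinger_fourier:
  fixes u :: "(real ^ 'n) \<times> real \<Rightarrow> complex"
  assumes s: "0 < s" "s < 1" and u: "schwartz u"
  shows "frac_schroedinger s u y = (\<integral>\<zeta>. unit_exp (\<zeta> \<bullet> y) * frac_symb_fourier s u \<zeta> \<partial>lborel)"
proof -
  have fi: "integrable lborel (fourier u)" by (rule fourier_schwartz_integrable[OF u])
  have [measurable]: "fourier u \<in> borel_measurable borel" using fi by auto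
  have inner: "indicator {0<..} \<sigma> *\<^sub>R ((evolutive_group \<sigma> u y - u y) / of_real (\<sigma> powr (1 + s)))
     = (\<integral>\<zeta>. frac_kernel s (\<i> * of_real (full_symb \<zeta>)) \<sigma> * (unit_exp (\<zeta> \<bullet> y) * fourier u \<zeta>) \<partial>lborel)" for \<sigma>
  proof -
    let ?e = "\<lambda>\<zeta>. exp (- (\<i> * of_real (full_symb \<zeta>) * of_real \<sigma>))"
    let ?c = "complex_of_real (indicator {0<..} \<sigma> / \<sigma> powr (1 + s))"
    have i1: "integrable lborel (\<lambda>\<zeta>. unit_exp (\<zeta> \<bullet> y) * ?e \<zeta> * fourier u \<zeta>)"
      by (rule Bochner_Integration.integrable_bound[OF fi]) (auto simp: norm_mult norm_exp_eq_Re)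
    have i2: "integrable lborel (\<lambda>\<zeta>. unit_exp (\<zeta> \<bullet> y) * fourier u \<zeta>)"
      by (intro integrable_unit_exp_mult fi) auto
    have diff: "evolutive_group \<sigma> u y - u y = (\<integral>\<zeta>. unit_exp (\<zeta> \<bullet> y) * ?e \<zeta> * fourier u \<zeta> - unit_exp (\<zeta> \<bullet> y) * fourier u \<zeta> \<partial>lborel)"
      unfolding Bochner_Integration.integral_diff[OF i1 i2] evolutive_group_fourier[OF u] schwartz_fourier_inversion[OF u] ..
    have "indicator {0<..} \<sigma> *\<^sub>R ((evolutive_group \<sigma> u y - u y) / of_real (\<sigma> powr (1 + s)))
      = ?c * (evolutive_group \<sigma> u y - u y)"
      by (simp add: scaleR_conv_of_real)
    also have "\<dots> = (\<integral>\<zeta>. ?c * (unit_exp (\<zeta> \<bullet> y) * ?e \<zeta> * fourier u \<zeta> - unit_exp (\<zeta> \<bullet> y) * fourier u \<zeta>) \<partial>lborel)"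
      unfolding diff by (rule integral_mult_right_zero[symmetric])
    also have "\<dots> = (\<integral>\<zeta>. frac_kernel s (\<i> * of_real (full_symb \<zeta>)) \<sigma> * (unit_exp (\<zeta> \<bullet> y) * fourier u \<zeta>) \<partial>lborel)"
      by (intro Bochner_Integration.integral_cong refl)
         (simp add: frac_kernel_def scaleR_conv_of_real algebra_simps diff_divide_distrib)
    finally show ?thesis .
  qed
  have "(LINT \<sigma>:{0<..}|lborel. (evolutive_group \<sigma> u y - u y) / of_real (\<sigma> powr (1 + s)))
      = (\<integral>\<sigma>. \<integral>\<zeta>. frac_kernel s (\<i> * of_real (full_symb \<zeta>)) \<sigma> * (unit_exp (\<zeta> \<bullet> y) * fourier u \<zeta>) \<partial>lborel \<partial>lborel)"
    unfolding set_lebesgue_integral_def inner ..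
  also have "\<dots> = (\<integral>\<zeta>. \<integral>\<sigma>. frac_kernel s (\<i> * of_real (full_symb \<zeta>)) \<sigma> * (unit_exp (\<zeta> \<bullet> y) * fourier u \<zeta>) \<partial>lborel \<partial>lborel)"
  proof (rule fubini_dominated(2)[OF _ integrable_frac_weight[OF s] integrable_symb_fourier[OF u]])
    show "(\<lambda>(\<sigma>, \<zeta>). frac_kernel s (\<i> * of_real (full_symb \<zeta>)) \<sigma> * (unit_exp (\<zeta> \<bullet> y) * fourier u \<zeta>)) \<in> borel_measurable (lborel \<Otimes>\<^sub>M lborel)"
      unfolding frac_kernel_def by measurable
    fix \<sigma> :: real and \<zeta> :: "(real ^ 'n) \<times> real"
    have "norm (frac_kernel s (\<i> * of_real (full_symb \<zeta>)) \<sigma>) \<le> (2 + \<bar>full_symb \<zeta>\<bar>) * frac_weight s \<sigma>"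
      using norm_frac_kernel_le[of "\<i> * of_real (full_symb \<zeta>)" s \<sigma>] by (simp add: norm_mult)
    then have "norm (frac_kernel s (\<i> * of_real (full_symb \<zeta>)) \<sigma>) * norm (fourier u \<zeta>) \<le> (2 + \<bar>full_symb \<zeta>\<bar>) * frac_weight s \<sigma> * norm (fourier u \<zeta>)"
      by (rule mult_right_mono) simp
    then show "norm (frac_kernel s (\<i> * of_real (full_symb \<zeta>)) \<sigma> * (unit_exp (\<zeta> \<bullet> y) * fourier u \<zeta>)) \<le> frac_weight s \<sigma> * ((2 + \<bar>full_symb \<zeta>\<bar>) * norm (fourier u \<zeta>))"
      by (simp add: norm_mult mult_ac)
  qed
  also have "\<dots> = (\<integral>\<zeta>. frac_integral s (\<i> * of_real (full_symb \<zeta>)) * (unit_exp (\<zeta> \<bullet> y) * fourier u \<zeta>) \<partial>lborel)"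
    by (simp add: frac_integral_def)
  finally have eq: "frac_schroedinger s u y =
     - of_real (s / Gamma (1 - s)) * (\<integral>\<zeta>. frac_integral s (\<i> * of_real (full_symb \<zeta>)) * (unit_exp (\<zeta> \<bullet> y) * fourier u \<zeta>) \<partial>lborel)"
    unfolding frac_schroedinger_def by simp
  have G: "Gamma (1 - s) \<noteq> 0" using s Gamma_real_pos[of "1 - s"] by (metis diff_gt_0_iff_gt less_irrefl)
  show ?thesis
    unfolding eq integral_mult_right_zero[symmetric]
    using s G by (intro Bochner_Integration.integral_cong refl)
      (simp add: frac_integral_imaginary[OF s] frac_symb_fourier_def)
qed

text \<open>The inverse transform of an integrable function has that function as its distributional transform:
  exchange the integrals and invert the transform of the test function.\<close>

lemma fourier_pair_inverse_transform:
  fixes F :: "'a::euclidean_space \<Rightarrow> complex"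
  assumes F: "integrable lborel F"
  shows "fourier_pair (\<lambda>y. \<integral>\<zeta>. unit_exp (\<zeta> \<bullet> y) * F \<zeta> \<partial>lborel) F"
  unfolding fourier_pair_def
proof (intro allI impI conjI)
  fix \<phi> :: "'a \<Rightarrow> complex" assume \<phi>: "schwartz \<phi>"
  have fi: "integrable lborel (fourier \<phi>)" by (rule fourier_schwartz_integrable[OF \<phi>])
  have [measurable]: "F \<in> borel_measurable borel" "fourier \<phi> \<in> borel_measurable borel" "\<phi> \<in> borel_measurable borel"
    using F fi schwartz_measurable[OF \<phi>] by auto
  define f where "f y = (\<integral>\<zeta>. unit_exp (\<zeta> \<bullet> y) * F \<zeta> \<partial>lborel)" for y
  have f: "f y = fourier F (- y)" for y
    by (simp add: f_def fourier_eq inner_commute)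
  have [measurable]: "f \<in> borel_measurable borel"
    unfolding f[abs_def] using measurable_fourier[OF F] by measurable
  have "integrable lborel (\<lambda>y. f y * fourier \<phi> y)"
  proof (rule Bochner_Integration.integrable_bound)
    show "integrable lborel (\<lambda>y. (\<integral>\<zeta>. norm (F \<zeta>) \<partial>lborel) * norm (fourier \<phi> y))"
      by (intro integrable_mult_right integrable_norm fi)
    show "AE y in lborel. norm (f y * fourier \<phi> y) \<le> norm ((\<integral>\<zeta>. norm (F \<zeta>) \<partial>lborel) * norm (fourier \<phi> y))"
      unfolding f by (auto simp: norm_mult intro!: AE_I2 mult_right_mono norm_fourier_le[THEN order_trans])
  qed measurable
  then show "integrable lborel (\<lambda>y. (\<integral>\<zeta>. unit_exp (\<zeta> \<bullet> y) * F \<zeta> \<partial>lborel) * fourier \<phi> y)"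
    by (simp add: f_def)
  obtain B where B: "\<And>x. norm (\<phi> x) \<le> B" using schwartz_bounded[OF \<phi>] by blast
  show "integrable lborel (\<lambda>y. F y * \<phi> y)"
  proof (rule Bochner_Integration.integrable_bound)
    show "integrable lborel (\<lambda>y. norm (F y) * B)" by (intro integrable_mult_left integrable_norm F)
    show "AE y in lborel. norm (F y * \<phi> y) \<le> norm (norm (F y) * B)"
      by (auto simp: norm_mult abs_mult intro!: AE_I2 mult_left_mono B[THEN order_trans])
  qed measurable
  have "(\<integral>y. (\<integral>\<zeta>. unit_exp (\<zeta> \<bullet> y) * F \<zeta> \<partial>lborel) * fourier \<phi> y \<partial>lborel)
      = (\<integral>y. \<integral>\<zeta>. unit_exp (\<zeta> \<bullet> y) * F \<zeta> * fourier \<phi> y \<partial>lborel \<partial>lborel)"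
    by simp
  also have "\<dots> = (\<integral>\<zeta>. \<integral>y. unit_exp (\<zeta> \<bullet> y) * F \<zeta> * fourier \<phi> y \<partial>lborel \<partial>lborel)"
    by (rule fubini_dominated(2)[OF _ integrable_norm[OF fi] integrable_norm[OF F]]) (auto simp: norm_mult)
  also have "\<dots> = (\<integral>\<zeta>. \<integral>y. F \<zeta> * (unit_exp (y \<bullet> \<zeta>) * fourier \<phi> y) \<partial>lborel \<partial>lborel)"
    by (simp add: inner_commute mult_ac)
  also have "\<dots> = (\<integral>\<zeta>. F \<zeta> * \<phi> \<zeta> \<partial>lborel)"
    by (simp add: schwartz_fourier_inversion[OF \<phi>])
  finally show "(\<integral>y. (\<integral>\<zeta>. unit_exp (\<zeta> \<bullet> y) * F \<zeta> \<partial>lborel) * fourier \<phi> y \<partial>lborel) = (\<integral>\<zeta>. F \<zeta> * \<phi> \<zeta> \<partial>lborel)" .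
qed

theorem has_fourier_at_frac_schroedinger:
  fixes u :: "(real ^ 'n) \<times> real \<Rightarrow> complex"
  assumes s: "0 < s" "s < 1" and u: "schwartz u"
  shows "has_fourier_at (frac_schroedinger s u) (\<xi>, \<tau>)
     ((\<i> * of_real (symb \<xi> \<tau>)) powr of_real s * fourier u (\<xi>, \<tau>))"
  unfolding has_fourier_at_def
proof (intro exI conjI)
  have "frac_schroedinger s u = (\<lambda>y. \<integral>\<zeta>. unit_exp (\<zeta> \<bullet> y) * frac_symb_fourier s u \<zeta> \<partial>lborel)"
    by (intro ext frac_schroedinger_fourier s u)
  then show "fourier_pair (frac_schroedinger s u) (frac_symb_fourier s u)"
    using fourier_pair_inverse_transform[OF integrable_frac_symb_fourier[OF s u]] by simp
  show "isCont (frac_symb_fourier s u) (\<xi>, \<tau>)"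
    using continuous_frac_symb_fourier[OF s(1) u] by (simp add: continuous_on_eq_continuous_at)
qed (simp add: frac_symb_fourier_def)

section \<open>The extension theorem\<close>

theorem theoremA:
  fixes s a :: real
    and u :: "(real ^ 'n) \<times> real \<Rightarrow> complex"
    and U Uhat :: "real ^ 'n \<Rightarrow> real \<Rightarrow> real \<Rightarrow> complex"
    and m :: "real \<Rightarrow> real \<Rightarrow> complex"
  assumes s: "0 < s" "s < 1" and a: "a = 1 - 2 * s"
    and u: "schwartz u"
    and U: "extension_solution a u U"
    and Uhat: "\<And>\<xi> z \<tau>. z > 0 \<Longrightarrow> symb \<xi> \<tau> \<noteq> 0 \<Longrightarrow>
                  has_fourier_at (\<lambda>(x, t). U x z t) (\<xi>, \<tau>) (Uhat \<xi> z \<tau>)"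
    and m: "\<And>p. p \<noteq> 0 \<Longrightarrow> selected_profile s p (m p)"
    and sel: "\<And>\<xi> z \<tau>. z > 0 \<Longrightarrow> symb \<xi> \<tau> \<noteq> 0 \<Longrightarrow>
                  Uhat \<xi> z \<tau> = m (symb \<xi> \<tau>) z * fourier u (\<xi>, \<tau>)"
  shows "\<forall>\<xi> \<tau>. symb \<xi> \<tau> \<noteq> 0 \<longrightarrow>
      (\<forall>z>0. Uhat \<xi> z \<tau> =
         (let w = of_real z * phase \<xi> \<tau> * of_real (sqrt \<bar>symb \<xi> \<tau>\<bar>)
          in of_real (2 powr (1 - s) / Gamma s) * w powr of_real s * Bessel_K s w)
         * fourier u (\<xi>, \<tau>)) \<and>
      ((\<lambda>z. Uhat \<xi> z \<tau>) \<longlongrightarrow> fourier u (\<xi>, \<tau>)) (at_right 0) \<and>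
      (\<forall>z>0. (\<lambda>z. Uhat \<xi> z \<tau>) differentiable (at z)) \<and>
      (\<exists>L. ((\<lambda>z. of_real (z powr a) * vector_derivative (\<lambda>z. Uhat \<xi> z \<tau>) (at z))
               \<longlongrightarrow> L) (at_right 0) \<and>
           - of_real (2 powr (2 * s - 1) * Gamma s) * exp (\<i> * of_real (pi * s / 2))
             / of_real (Gamma (1 - s)) * L
           = (\<i> * of_real (symb \<xi> \<tau>)) powr of_real s * fourier u (\<xi>, \<tau>)) \<and>
      has_fourier_at (frac_schroedinger s u) (\<xi>, \<tau>)
        ((\<i> * of_real (symb \<xi> \<tau>)) powr of_real s * fourier u (\<xi>, \<tau>))"
proof (intro allI impI)
  fix \<xi> :: "real ^ 'n" and \<tau> :: real
  assume p0: "symb \<xi> \<tau> \<noteq> 0"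
  define p where "p = symb \<xi> \<tau>"
  define c where "c = fourier u (\<xi>, \<tau>)"
  define G where "G = (\<lambda>z. macdonald_profile s (of_real z * sgn_phase p * of_real (sqrt \<bar>p\<bar>)))"
  have p: "p \<noteq> 0" using p0 by (simp add: p_def)
  have phase: "phase \<xi> \<tau> = sgn_phase p" by (simp add: phase_def sgn_phase_def p_def)
  have hat: "Uhat \<xi> z \<tau> = G z * c" if "z > 0" for z
    using sel[OF that p0] selected_profile_unique[OF s p m[OF p] that] by (simp add: G_def c_def p_def)
  obtain L where L: "((\<lambda>z. of_real (z powr a) * vector_derivative G (at z)) \<longlongrightarrow> L) (at_right 0)"
    "- of_real (2 powr (2 * s - 1) * Gamma s) * exp (\<i> * of_real (pi * s / 2)) / of_real (Gamma (1 - s)) * L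
       = (\<i> * of_real p) powr of_real s"
    using macdonald_profile_boundary(2)[OF s p] unfolding a G_def by blast
  have der: "((\<lambda>z. Uhat \<xi> z \<tau>) has_vector_derivative vector_derivative G (at z) * c) (at z)" if z: "z > 0" for z
  proof (rule has_vector_derivative_transform_within_open)
    have "G differentiable (at z)"
      using macdonald_profile_has_vector_derivative[OF s p z] unfolding G_def by (rule differentiableI_vector)
    then show "((\<lambda>z. G z * c) has_vector_derivative vector_derivative G (at z) * c) (at z)"
      by (intro has_vector_derivative_mult_left) (simp add: vector_derivative_works[symmetric])
  qed (use z in \<open>auto simp: hat intro: open_greaterThan[of 0]\<close>)
  have form: "\<forall>z>0. Uhat \<xi> z \<tau> =
         (let w = of_real z * phase \<xi> \<tau> * of_real (sqrt \<bar>symb \<xi> \<tau>\<bar>)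
          in of_real (2 powr (1 - s) / Gamma s) * w powr of_real s * Bessel_K s w)
         * fourier u (\<xi>, \<tau>)"
    using hat by (simp add: Let_def G_def c_def phase macdonald_profile_def p_def[symmetric])
  have dirichlet: "((\<lambda>z. Uhat \<xi> z \<tau>) \<longlongrightarrow> fourier u (\<xi>, \<tau>)) (at_right 0)"
  proof (rule Lim_transform_eventually)
    show "((\<lambda>z. G z * c) \<longlongrightarrow> fourier u (\<xi>, \<tau>)) (at_right 0)"
      using tendsto_mult_right[OF macdonald_profile_boundary(1)[OF s p], of c] by (simp add: G_def c_def)
  qed (simp add: eventually_at_filter hat)
  have neumann: "((\<lambda>z. of_real (z powr a) * vector_derivative (\<lambda>z. Uhat \<xi> z \<tau>) (at z)) \<longlongrightarrow> L * c) (at_right 0)"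
    by (rule Lim_transform_eventually[OF tendsto_mult_right[OF L(1), of c]])
       (auto simp: eventually_at_filter vector_derivative_at[OF der])
  show "(\<forall>z>0. Uhat \<xi> z \<tau> =
         (let w = of_real z * phase \<xi> \<tau> * of_real (sqrt \<bar>symb \<xi> \<tau>\<bar>)
          in of_real (2 powr (1 - s) / Gamma s) * w powr of_real s * Bessel_K s w)
         * fourier u (\<xi>, \<tau>)) \<and>
      ((\<lambda>z. Uhat \<xi> z \<tau>) \<longlongrightarrow> fourier u (\<xi>, \<tau>)) (at_right 0) \<and>
      (\<forall>z>0. (\<lambda>z. Uhat \<xi> z \<tau>) differentiable (at z)) \<and>
      (\<exists>L. ((\<lambda>z. of_real (z powr a) * vector_derivative (\<lambda>z. Uhat \<xi> z \<tau>) (at z))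
               \<longlongrightarrow> L) (at_right 0) \<and>
           - of_real (2 powr (2 * s - 1) * Gamma s) * exp (\<i> * of_real (pi * s / 2))
             / of_real (Gamma (1 - s)) * L
           = (\<i> * of_real (symb \<xi> \<tau>)) powr of_real s * fourier u (\<xi>, \<tau>)) \<and>
      has_fourier_at (frac_schroedinger s u) (\<xi>, \<tau>)
        ((\<i> * of_real (symb \<xi> \<tau>)) powr of_real s * fourier u (\<xi>, \<tau>))"
  proof (intro conjI form dirichlet has_fourier_at_frac_schroedinger s u exI neumann allI impI)
    show "(\<lambda>z. Uhat \<xi> z \<tau>) differentiable (at z)" if "z > 0" for z
      using der[OF that] by (rule differentiableI_vector)
    show "- of_real (2 powr (2 * s - 1) * Gamma s) * exp (\<i> * of_real (pi * s / 2))
             / of_real (Gamma (1 - s)) * (L * c) = (\<i> * of_real (symb \<xi> \<tau>)) powr of_real s * fourier u (\<xi>, \<tau>)"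
      unfolding mult.assoc[symmetric, of _ L c] L(2) by (simp add: p_def c_def)
  qed (rule neumann)
qed

end
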